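(* Assuming the Orthogonal Vectors Conjecture (or the Strong Exponential Time Hypothesis), for no $\epsilon>0$ is there an $O(m^{2-\epsilon})$ or $O((k\cdot m)^{1-\epsilon})$ algorithm for each of the following problems: (1) computing the almost-sure winning set in an MDP with a disjunctive query of $k$ Büchi objectives; (2) computing the almost-sure winning set in an MDP with a disjunctive objective or a disjunctive query of $k$ coBüchi objectives; (3) computing the almost-sure winning set in an MDP with a disjunctive objective or a disjunctive query of $k$ singleton coBüchi objectives (coBüchi objectives whose target sets have cardinality one); (4) computing the almost-sure winning set in an MDP with a Rabin objective with $k$ pairs.
   Context: An MDP $P=((V,E),(V_1,V_R),\delta)$: finite directed graph with $m$ edges, vertices partitioned into player-1 vertices $V_1$ and random vertices $V_R$, each $v\in V_R$ with a probability distribution over its out-neighbours (positive on each). Player-1 strategies choose successors at $V_1$ vertices based on the history; $\langle\langle 1\rangle\rangle_{as}(P,\psi)$ is the set of vertices from which player 1 can satisfy $\psi$ with probability 1. $\mathrm{Inf}(\omega)$: vertices occurring infinitely often in play $\omega$. $\mathrm{B\ddot{u}chi}(T)=\{\omega:\mathrm{Inf}(\omega)\cap T\ne\emptyset\}$, $\mathrm{coB\ddot{u}chi}(T)=\{\omega:\mathrm{Inf}(\omega)\cap T=\emptyset\}$. Rabin objective for pairs $(L_i,U_i)$: plays with $L_i\cap\mathrm{Inf}(\omega)\ne\emptyset$ and $U_i\cap\mathrm{Inf}(\omega)=\emptyset$ for some $i$. Disjunctive objective: $\langle\langle1\rangle\rangle_{as}(P,\bigcup_i\psi_i)$; disjunctive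 query: $\bigcup_i\langle\langle1\rangle\rangle_{as}(P,\psi_i)$. Orthogonal Vectors Conjecture: no $O(N^{2-\epsilon})$ algorithm decides, for sets $S_1,S_2$ of at most $N$ vectors in $\{0,1\}^d$ with $d\in\Theta(\log N)$, whether some $u\in S_1,v\in S_2$ have $\sum_iu_iv_i=0$. Strong Exponential Time Hypothesis: for each $\epsilon>0$ there is $k$ such that $k$-CNF-SAT on $n$ variables and $m$ clauses cannot be solved in $O(2^{(1-\epsilon)n}\mathrm{poly}(m))$ time. *)

theory Defs
  imports "HOL-Probability.Probability" "HOL-Library.Landau_Symbols"
    "HOL-Library.Discrete_Functions"
begin

section \<open>Algorithms: random access machines with logarithmic cost\<close>

text \<open>
  A program is a structured program for a random access machine. It uses finitely many registers
  and finitely many unbounded arrays of natural numbers; registers and arrays are named by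
  numbers that are fixed in the program text. Each operation costs the binary lengths of the operands and of the addresses it handles.
  Up to polylogarithmic factors this agrees with the word RAM, and it needs no word-size parameter.
\<close>

datatype com =
    Skip
  | Const nat nat            \<comment> \<open>\<open>Const r c\<close>: \<open>r := c\<close>\<close>
  | Add nat nat nat          \<comment> \<open>\<open>Add r a b\<close>: \<open>r := a + b\<close>\<close>
  | Sub nat nat nat          \<comment> \<open>\<open>Sub r a b\<close>: \<open>r := a - b\<close>, truncated at 0\<close>
  | Load nat nat nat         \<comment> \<open>\<open>Load r A i\<close>: \<open>r := A[i]\<close>\<close>
  | Store nat nat nat        \<comment> \<open>\<open>Store A i r\<close>: \<open>A[i] := r\<close>\<close>
  | Seq com com
  | If nat nat com com       \<comment> \<open>\<open>If a b\<close>: branch on \<open>a < b\<close>\<close>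
  | While nat nat com        \<comment> \<open>\<open>While a b\<close>: loop while \<open>a < b\<close>\<close>

type_synonym ram_state = "(nat \<Rightarrow> nat) \<times> (nat \<Rightarrow> nat \<Rightarrow> nat)"

definition bit_length :: "nat \<Rightarrow> nat" where
  "bit_length n = Suc (floor_log n)"

inductive exec :: "com \<Rightarrow> ram_state \<Rightarrow> nat \<Rightarrow> ram_state \<Rightarrow> bool" where
  Skip: "exec Skip s 1 s"
| Const: "exec (Const r c) (R, M) (bit_length c) (R(r := c), M)"
| Add: "exec (Add r a b) (R, M) (bit_length (R a) + bit_length (R b)) (R(r := R a + R b), M)"
| Sub: "exec (Sub r a b) (R, M) (bit_length (R a) + bit_length (R b)) (R(r := R a - R b), M)"
| Load: "exec (Load r A i) (R, M) (bit_length (R i) + bit_length (M A (R i))) (R(r := M A (R i)), M)"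
| Store: "exec (Store A i r) (R, M) (bit_length (R i) + bit_length (R r))
            (R, M(A := (M A)(R i := R r)))"
| Seq: "exec p s c s' \<Longrightarrow> exec q s' d s'' \<Longrightarrow> exec (Seq p q) s (c + d) s''"
| IfTrue: "R a < R b \<Longrightarrow> exec p (R, M) c s' \<Longrightarrow>
            exec (If a b p q) (R, M) (bit_length (R a) + bit_length (R b) + c) s'"
| IfFalse: "\<not> R a < R b \<Longrightarrow> exec q (R, M) c s' \<Longrightarrow>
            exec (If a b p q) (R, M) (bit_length (R a) + bit_length (R b) + c) s'"
| WhileFalse: "\<not> R a < R b \<Longrightarrow>
            exec (While a b p) (R, M) (bit_length (R a) + bit_length (R b)) (R, M)"
| WhileTrue: "R a < R b \<Longrightarrow> exec p (R, M) c s' \<Longrightarrow> exec (While a b p) s' d s'' \<Longrightarrow>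
            exec (While a b p) (R, M) (bit_length (R a) + bit_length (R b) + c + d) s''"

text \<open>The input is in array 0 and the output in array 1; everything else is initially 0.\<close>

definition initial_state :: "nat list \<Rightarrow> ram_state" where
  "initial_state xs =
     ((\<lambda>_. 0), (\<lambda>A i. if A = 0 \<and> i < length xs then xs ! i else 0))"

definition result_of :: "ram_state \<Rightarrow> nat \<Rightarrow> nat" where
  "result_of s = snd s 1"

text \<open>The size of an input is the cost of loading each of its cells once.\<close>

definition input_size :: "nat list \<Rightarrow> nat" where
  "input_size xs = (\<Sum>i<length xs. bit_length i + bit_length (xs ! i))"

text \<open>
  An instance may have several codes (sets are given by enumerations in any order); an algorithm
  must be correct for each of them.
\<close>

record 'i problem =
  instances :: "'i set"
  codes :: "'i \<Rightarrow> nat list \<Rightarrow> bool"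
  correct :: "'i \<Rightarrow> (nat \<Rightarrow> nat) \<Rightarrow> bool"

definition solves_within :: "com \<Rightarrow> 'i problem \<Rightarrow> ('i \<Rightarrow> nat list \<Rightarrow> real) \<Rightarrow> bool" where
  "solves_within p Pb t \<longleftrightarrow>
     (\<forall>x\<in>instances Pb. \<forall>xs. codes Pb x xs \<longrightarrow>
        (\<exists>c s. exec p (initial_state xs) c s \<and> correct Pb x (result_of s) \<and> real c \<le> t x xs))"

definition solves_in_O :: "com \<Rightarrow> 'i problem \<Rightarrow> ('i \<Rightarrow> nat list \<Rightarrow> real) \<Rightarrow> bool" where
  "solves_in_O p Pb t \<longleftrightarrow> (\<exists>C. solves_within p Pb (\<lambda>x xs. C * t x xs))"

definition decides :: "bool \<Rightarrow> (nat \<Rightarrow> nat) \<Rightarrow> bool" where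
  "decides b out \<longleftrightarrow> (out 0 \<noteq> 0 \<longleftrightarrow> b)"


section \<open>Orthogonal Vectors Conjecture\<close>

definition bit_vectors :: "nat \<Rightarrow> nat list set" where
  "bit_vectors d = {u. length u = d \<and> set u \<subseteq> {0, 1}}"

definition vectors_code :: "nat list set \<Rightarrow> nat list \<Rightarrow> bool" where
  "vectors_code S xs \<longleftrightarrow> (\<exists>us. distinct us \<and> set us = S \<and> xs = length us # concat us)"

text \<open>The dimension is a function \<open>D\<close> of the bound \<open>N\<close> on the number of vectors.\<close>

definition ov_problem :: "(nat \<Rightarrow> nat) \<Rightarrow> (nat \<times> nat list set \<times> nat list set) problem" where
  "ov_problem D = \<lparr>
     instances = {(N, S1, S2). 1 \<le> N \<and> S1 \<subseteq> bit_vectors (D N) \<and> S2 \<subseteq> bit_vectors (D N) \<and>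
                    card S1 \<le> N \<and> card S2 \<le> N},
     codes = (\<lambda>(N, S1, S2) xs. \<exists>c1 c2. vectors_code S1 c1 \<and> vectors_code S2 c2 \<and>
                    xs = [N, D N] @ c1 @ c2),
     correct = (\<lambda>(N, S1, S2).
                    decides (\<exists>u\<in>S1. \<exists>v\<in>S2. (\<Sum>i<D N. u ! i * v ! i) = 0)) \<rparr>"

text \<open>
  A refuting algorithm has to run in time \<open>O(N powr (2 - \<epsilon>))\<close> for every choice of the dimension
  in \<open>\<Theta>(log N)\<close>; the constant may depend on that choice.
  Asking instead for one hard \<open>D\<close> for each \<open>\<epsilon>\<close> would be a stronger conjecture.
\<close>

definition OVC :: bool where
  "OVC \<longleftrightarrow> \<not> (\<exists>\<epsilon>>0. \<exists>p. \<forall>D. (\<lambda>N. real (D N)) \<in> \<Theta>(\<lambda>N. ln (real N)) \<longrightarrow>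
     solves_in_O p (ov_problem D) (\<lambda>(N, S1, S2) xs. real N powr (2 - \<epsilon>)))"


section \<open>Strong Exponential Time Hypothesis\<close>

text \<open>A formula is a list of clauses; the literal \<open>(v, b)\<close> is true iff variable \<open>v\<close> has value \<open>b\<close>.\<close>

type_synonym cnf = "(nat \<times> bool) list list"

definition satisfiable :: "cnf \<Rightarrow> bool" where
  "satisfiable F \<longleftrightarrow> (\<exists>\<alpha> :: nat \<Rightarrow> bool. \<forall>cl\<in>set F. \<exists>(v, b)\<in>set cl. \<alpha> v = b)"

definition clause_code :: "(nat \<times> bool) list \<Rightarrow> nat list" where
  "clause_code cl = length cl # concat (map (\<lambda>(v, b). [v, of_bool b]) cl)"

definition ksat_problem :: "nat \<Rightarrow> (nat \<times> cnf) problem" where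
  "ksat_problem k = \<lparr>
     instances = {(n, F). \<forall>cl\<in>set F. length cl \<le> k \<and> (\<forall>(v, b)\<in>set cl. v < n)},
     codes = (\<lambda>(n, F) xs. xs = [n, length F] @ concat (map clause_code F)),
     correct = (\<lambda>(n, F). decides (satisfiable F)) \<rparr>"

definition SETH :: bool where
  "SETH \<longleftrightarrow> (\<forall>\<epsilon>>0. \<exists>k. \<not> (\<exists>p e. solves_in_O p (ksat_problem k)
     (\<lambda>(n, F) xs. 2 powr ((1 - \<epsilon>) * real n) * (real (length F) + 1) ^ e)))"


section \<open>Markov decision processes\<close>

record 'v mdp =
  verts :: "'v set"
  edges :: "('v \<times> 'v) set"
  player1 :: "'v set"
  random_verts :: "'v set"
  trans_prob :: "'v \<Rightarrow> 'v pmf"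

text \<open>As usual, every vertex has a successor, so that all plays are infinite.\<close>

definition is_mdp :: "'v mdp \<Rightarrow> bool" where
  "is_mdp P \<longleftrightarrow> finite (verts P) \<and> verts P \<noteq> {} \<and>
     edges P \<subseteq> verts P \<times> verts P \<and> (\<forall>v\<in>verts P. \<exists>w. (v, w) \<in> edges P) \<and>
     player1 P \<union> random_verts P = verts P \<and> player1 P \<inter> random_verts P = {} \<and>
     (\<forall>v\<in>random_verts P. set_pmf (trans_prob P v) = {w. (v, w) \<in> edges P})"

text \<open>A strategy maps a history ending in a player-1 vertex to a successor of that vertex.\<close>

definition strategy :: "'v mdp \<Rightarrow> ('v list \<Rightarrow> 'v) \<Rightarrow> bool" where
  "strategy P \<sigma> \<longleftrightarrow>
     (\<forall>h. set h \<subseteq> verts P \<longrightarrow> (\<forall>v\<in>player1 P. (v, \<sigma> (h @ [v])) \<in> edges P))"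

definition next_vertex :: "'v mdp \<Rightarrow> ('v list \<Rightarrow> 'v) \<Rightarrow> 'v list \<Rightarrow> 'v pmf" where
  "next_vertex P \<sigma> h =
     (if last h \<in> player1 P then return_pmf (\<sigma> h) else trans_prob P (last h))"

definition play_kernel ::
  "'v mdp \<Rightarrow> ('v list \<Rightarrow> 'v) \<Rightarrow> 'v \<Rightarrow> nat \<Rightarrow> (nat \<Rightarrow> 'v) \<Rightarrow> 'v measure" where
  "play_kernel P \<sigma> v i \<omega> = measure_pmf
     (if i = 0 then return_pmf v else next_vertex P \<sigma> (map \<omega> [0..<i]))"

text \<open>The measure on infinite plays from \<open>v\<close> given by the Ionescu-Tulcea theorem.\<close>

definition play_measure ::
  "('v::countable) mdp \<Rightarrow> ('v list \<Rightarrow> 'v) \<Rightarrow> 'v \<Rightarrow> (nat \<Rightarrow> 'v) measure" where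
  "play_measure P \<sigma> v = projective_family.lim UNIV
     (Ionescu_Tulcea.CI (play_kernel P \<sigma> v) (\<lambda>_. count_space UNIV)) (\<lambda>_. count_space UNIV)"

lemma Ionescu_Tulcea_play_kernel:
  fixes P :: "('v::countable) mdp"
  shows "Ionescu_Tulcea (play_kernel P \<sigma> v) (\<lambda>_. count_space UNIV)"
proof (unfold Ionescu_Tulcea_def, safe)
  fix i :: nat
  have "PiM {0..<i} (\<lambda>_. count_space (UNIV :: 'v set)) = count_space (PiE {0..<i} (\<lambda>_. UNIV))"
    by (rule count_space_PiM_finite) auto
  moreover have "play_kernel P \<sigma> v i \<omega> \<in> space (subprob_algebra (count_space UNIV))" for \<omega>
    by (auto simp: play_kernel_def space_subprob_algebra
        intro!: prob_space_imp_subprob_space measure_pmf.prob_space_axioms)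
  ultimately show "play_kernel P \<sigma> v i
      \<in> measurable (PiM {0..<i} (\<lambda>_. count_space UNIV)) (subprob_algebra (count_space UNIV))"
    by simp
next
  show "prob_space (play_kernel P \<sigma> v i x)" for i x
    unfolding play_kernel_def by (rule measure_pmf.prob_space_axioms)
qed

definition almost_sure_win :: "('v::countable) mdp \<Rightarrow> (nat \<Rightarrow> 'v) set \<Rightarrow> 'v set" where
  "almost_sure_win P \<psi> =
     {v \<in> verts P. \<exists>\<sigma>. strategy P \<sigma> \<and> (AE \<omega> in play_measure P \<sigma> v. \<omega> \<in> \<psi>)}"

definition inf_verts :: "(nat \<Rightarrow> 'v) \<Rightarrow> 'v set" where
  "inf_verts \<omega> = {v. infinite {i. \<omega> i = v}}"

definition buechi :: "'v set \<Rightarrow> (nat \<Rightarrow> 'v) set" where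
  "buechi T = {\<omega>. inf_verts \<omega> \<inter> T \<noteq> {}}"

definition cobuechi :: "'v set \<Rightarrow> (nat \<Rightarrow> 'v) set" where
  "cobuechi T = {\<omega>. inf_verts \<omega> \<inter> T = {}}"

definition rabin :: "('v set \<times> 'v set) list \<Rightarrow> (nat \<Rightarrow> 'v) set" where
  "rabin ps = {\<omega>. \<exists>(L, U)\<in>set ps. L \<inter> inf_verts \<omega> \<noteq> {} \<and> U \<inter> inf_verts \<omega> = {}}"

definition disjunctive_objective ::
  "('o \<Rightarrow> (nat \<Rightarrow> 'v) set) \<Rightarrow> ('v::countable) mdp \<Rightarrow> 'o list \<Rightarrow> 'v set" where
  "disjunctive_objective obj P os = almost_sure_win P (\<Union>t\<in>set os. obj t)"

definition disjunctive_query ::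
  "('o \<Rightarrow> (nat \<Rightarrow> 'v) set) \<Rightarrow> ('v::countable) mdp \<Rightarrow> 'o list \<Rightarrow> 'v set" where
  "disjunctive_query obj P os = (\<Union>t\<in>set os. almost_sure_win P (obj t))"


section \<open>Computing almost-sure winning sets\<close>

text \<open>
  The vertices of an input MDP are \<open>0, \<dots>, n - 1\<close>. It is given by its numbers of vertices and
  edges, the owner of each vertex, and a list of the edges, where the edges leaving random
  vertices carry their probabilities as reduced fractions. Hence MDPs with irrational
  probabilities have no code.
\<close>

definition mdp_code :: "nat mdp \<Rightarrow> nat list \<Rightarrow> bool" where
  "mdp_code P xs \<longleftrightarrow> (\<exists>es num den.
     distinct es \<and> set es = edges P \<and>
     (\<forall>(u, v)\<in>edges P. u \<in> random_verts P \<longrightarrow> coprime (num u v) (den u v) \<and> 0 < den u v \<and>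
        pmf (trans_prob P u) v = real (num u v) / real (den u v)) \<and>
     xs = [card (verts P), card (edges P)] @
          map (\<lambda>v. of_bool (v \<in> random_verts P)) [0..<card (verts P)] @
          concat (map (\<lambda>(u, v). if u \<in> random_verts P then [u, v, num u v, den u v] else [u, v]) es))"

definition set_code :: "nat set \<Rightarrow> nat list \<Rightarrow> bool" where
  "set_code T xs \<longleftrightarrow> (\<exists>ys. distinct ys \<and> set ys = T \<and> xs = length ys # ys)"

definition set_pair_code :: "nat set \<times> nat set \<Rightarrow> nat list \<Rightarrow> bool" where
  "set_pair_code T xs \<longleftrightarrow> (\<exists>a b. set_code (fst T) a \<and> set_code (snd T) b \<and> xs = a @ b)"

definition list_code :: "('o \<Rightarrow> nat list \<Rightarrow> bool) \<Rightarrow> 'o list \<Rightarrow> nat list \<Rightarrow> bool" where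
  "list_code code os xs \<longleftrightarrow> (\<exists>cs. list_all2 code os cs \<and> xs = length os # concat cs)"

text \<open>
  \<open>code\<close> and \<open>ok\<close> are the encoding and the admissibility condition of a single objective;
  the winning set \<open>win P os\<close> is output as its characteristic function on the vertices.
\<close>

definition mdp_problem ::
  "('o \<Rightarrow> nat list \<Rightarrow> bool) \<Rightarrow> (nat set \<Rightarrow> 'o \<Rightarrow> bool) \<Rightarrow> (nat mdp \<Rightarrow> 'o list \<Rightarrow> nat set) \<Rightarrow>
   (nat mdp \<times> 'o list) problem" where
  "mdp_problem code ok win = \<lparr>
     instances = {(P, os). is_mdp P \<and> (\<exists>n. verts P = {..<n}) \<and> os \<noteq> [] \<and>
                    (\<forall>t\<in>set os. ok (verts P) t)},
     codes = (\<lambda>(P, os) xs. \<exists>c1 c2. mdp_code P c1 \<and> list_code code os c2 \<and> xs = c1 @ c2),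
     correct = (\<lambda>(P, os) out. \<forall>v\<in>verts P. out v \<noteq> 0 \<longleftrightarrow> v \<in> win P os) \<rparr>"

definition buechi_query_problem :: "(nat mdp \<times> nat set list) problem" where
  "buechi_query_problem = mdp_problem set_code (\<lambda>V T. T \<subseteq> V) (disjunctive_query buechi)"

definition cobuechi_objective_problem :: "(nat mdp \<times> nat set list) problem" where
  "cobuechi_objective_problem =
     mdp_problem set_code (\<lambda>V T. T \<subseteq> V) (disjunctive_objective cobuechi)"

definition cobuechi_query_problem :: "(nat mdp \<times> nat set list) problem" where
  "cobuechi_query_problem =
     mdp_problem set_code (\<lambda>V T. T \<subseteq> V) (disjunctive_query cobuechi)"

definition singleton_cobuechi_objective_problem :: "(nat mdp \<times> nat set list) problem" where
  "singleton_cobuechi_objective_problem =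
     mdp_problem set_code (\<lambda>V T. T \<subseteq> V \<and> card T = 1) (disjunctive_objective cobuechi)"

definition singleton_cobuechi_query_problem :: "(nat mdp \<times> nat set list) problem" where
  "singleton_cobuechi_query_problem =
     mdp_problem set_code (\<lambda>V T. T \<subseteq> V \<and> card T = 1) (disjunctive_query cobuechi)"

definition rabin_problem :: "(nat mdp \<times> (nat set \<times> nat set) list) problem" where
  "rabin_problem =
     mdp_problem set_pair_code (\<lambda>V (L, U). L \<subseteq> V \<and> U \<subseteq> V) (\<lambda>P ps. almost_sure_win P (rabin ps))"

definition num_edges :: "nat mdp \<times> 'o list \<Rightarrow> real" where
  "num_edges x = real (card (edges (fst x)))"

definition num_objectives :: "nat mdp \<times> 'o list \<Rightarrow> real" where
  "num_objectives x = real (length (snd x))"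

text \<open>
  Time linear in the input size is granted on top of \<open>m powr (2 - \<epsilon>)\<close> and
  \<open>(k * m) powr (1 - \<epsilon>)\<close>. Without it both bounds would fail unconditionally, merely because the
  input cannot be read in that time (for \<open>k\<close> much larger than \<open>m\<close>, respectively for \<open>k = 1\<close>).
  The statements without this term follow, as shown below.
\<close>

definition no_fast_algorithm :: "real \<Rightarrow> (nat mdp \<times> 'o list) problem \<Rightarrow> bool" where
  "no_fast_algorithm \<epsilon> Pb \<longleftrightarrow>
     \<not> (\<exists>p. solves_in_O p Pb
          (\<lambda>x xs. real (input_size xs) + num_edges x powr (2 - \<epsilon>))) \<and>
     \<not> (\<exists>p. solves_in_O p Pb
          (\<lambda>x xs. real (input_size xs) + (num_objectives x * num_edges x) powr (1 - \<epsilon>)))"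

lemma solves_in_O_mono:
  assumes "solves_in_O p Pb t" and "\<And>x xs. 0 \<le> t x xs" and "\<And>x xs. t x xs \<le> t' x xs"
  shows "solves_in_O p Pb t'"
proof -
  from assms(1) obtain C where C: "solves_within p Pb (\<lambda>x xs. C * t x xs)"
    by (auto simp: solves_in_O_def)
  have "C * t x xs \<le> \<bar>C\<bar> * t' x xs" for x xs
    using assms(2,3)[of x xs] by (intro mult_mono) auto
  with C have "solves_within p Pb (\<lambda>x xs. \<bar>C\<bar> * t' x xs)"
    unfolding solves_within_def by (meson order_trans)
  then show ?thesis
    by (auto simp: solves_in_O_def)
qed

lemma no_fast_algorithm_without_input_size:
  assumes "no_fast_algorithm \<epsilon> Pb"
  shows "\<not> (\<exists>p. solves_in_O p Pb (\<lambda>x xs. num_edges x powr (2 - \<epsilon>)))"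
    and "\<not> (\<exists>p. solves_in_O p Pb (\<lambda>x xs. (num_objectives x * num_edges x) powr (1 - \<epsilon>)))"
proof -
  have "solves_in_O p Pb (\<lambda>x xs. real (input_size xs) + f x)"
    if "solves_in_O p Pb (\<lambda>x xs. f x)" "\<And>x. 0 \<le> f x" for p f
    by (rule solves_in_O_mono[OF that(1)]) (auto simp: that(2))
  then show "\<not> (\<exists>p. solves_in_O p Pb (\<lambda>x xs. num_edges x powr (2 - \<epsilon>)))"
    and "\<not> (\<exists>p. solves_in_O p Pb (\<lambda>x xs. (num_objectives x * num_edges x) powr (1 - \<epsilon>)))"
    using assms unfolding no_fast_algorithm_def by (meson powr_ge_zero)+
qed

end

theory Submission
  imports Defs
begin

text \<open>
  Write two lists of 0-1 vectors as \<open>u\<^sub>i\<close> and \<open>v\<^sub>l\<close>. In one round of the MDP player 1 picks some \<open>u\<^sub>i\<close>,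
  chance picks a coordinate \<open>j\<close>, and then some \<open>v\<^sub>l\<close> is picked; the round ends in a vertex that tells
  whether \<open>u\<^sub>i\<close> and \<open>v\<^sub>l\<close> are both 1 at \<open>j\<close>. If chance also picks \<open>v\<^sub>l\<close> and rounds repeat for ever,
  then without an orthogonal pair every strategy hits every ``collision at \<open>l\<close>'' vertex infinitely often
  almost surely, whereas sticking to a \<open>u\<^sub>i\<close> orthogonal to \<open>v\<^sub>l\<close> never hits the one of \<open>l\<close>. This settles
  coBuechi (even with singleton targets, as objective and as query) and Rabin. For Buechi queries
  player 1 picks \<open>v\<^sub>l\<close> and the play stops there; to reach the ``no collision at \<open>l\<close>'' vertex of a fixed \<open>l\<close>
  almost surely, \<open>u\<^sub>i\<close> must be orthogonal to \<open>v\<^sub>l\<close>.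

  The MDP has \<open>O(N d)\<close> edges and \<open>O(N)\<close> targets, so a fast algorithm would find orthogonal pairs in
  time \<open>(N d) powr (2 - \<epsilon>)\<close>. As this is polynomial in the dimension \<open>d\<close>, splitting the variables of
  a CNF into two halves (one vector per partial assignment, one coordinate per clause) contradicts
  the exponential time hypothesis directly, without a sparsification lemma.
\<close>

section \<open>Unit-cost execution and its logarithmic cost\<close>

text \<open>The layer \<open>C j b\<close> forgets which \<open>u\<close> was chosen and keeps one
  bit per coordinate; this makes the number of edges \<open>O(N d)\<close> instead of quadratic in
  \<open>N\<close>. As \<open>k\<close> and \<open>m\<close> are both \<open>O(N d)\<close>, the
  hypothetical running times \<open>m powr (2 - \<epsilon>)\<close> and
  \<open>(k * m) powr (1 - \<epsilon>)\<close> lead to the same bound, and the rest goes through one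
  predicate, \<open>ov_solver\<close>.

  The reductions have to be actual programs charged by bit lengths. They are analysed with unit
  cost, and logarithms are absorbed by \<open>bit_length n \<le> 3 * sqrt n\<close>: linear time
  turns into exponent \<open>3/2\<close>, harmless once \<epsilon> is lowered to at most
  \<open>1/4\<close>.

  The hypothetical solver is an arbitrary program that expects blank memory. It is shifted to the
  registers and arrays from 50 on, and the reduction writes straight into array 50, which the
  shifted solver takes for its input.

  Refuting \<open>OVC\<close> takes one program for all dimension functions, so the dimension is
  read from the input; being \<open>O(N powr (\<epsilon>/4))\<close>, it consumes only half of the
  saving.\<close>

inductive sexec :: "com \<Rightarrow> ram_state \<Rightarrow> nat \<Rightarrow> ram_state \<Rightarrow> bool" where
  "sexec Skip s 1 s"
| "sexec (Const r c) (R, M) 1 (R(r := c), M)"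
| "sexec (Add r a b) (R, M) 1 (R(r := R a + R b), M)"
| "sexec (Sub r a b) (R, M) 1 (R(r := R a - R b), M)"
| "sexec (Load r A i) (R, M) 1 (R(r := M A (R i)), M)"
| "sexec (Store A i r) (R, M) 1 (R, M(A := (M A)(R i := R r)))"
| "sexec p s c s' \<Longrightarrow> sexec q s' d s'' \<Longrightarrow> sexec (Seq p q) s (c + d) s''"
| "sexec (if R a < R b then p else q) (R, M) c s' \<Longrightarrow> sexec (If a b p q) (R, M) (Suc c) s'"
| "\<not> R a < R b \<Longrightarrow> sexec (While a b p) (R, M) 1 (R, M)"
| "R a < R b \<Longrightarrow> sexec p (R, M) c s' \<Longrightarrow> sexec (While a b p) s' d s'' \<Longrightarrow>
     sexec (While a b p) (R, M) (Suc (c + d)) s''"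

text \<open>Register 1 is meant to hold the constant 1 throughout, so that in a tame program every
  single step increases the largest value in memory by at most 1. Hence \<open>t\<close> steps cost
  only \<open>O(t log t)\<close>.\<close>

fun tame :: "com \<Rightarrow> bool" where
  "tame Skip = True"
| "tame (Const r c) = (r \<noteq> 1 \<and> c \<le> 1)"
| "tame (Add r a b) = (r \<noteq> 1 \<and> b = 1)"
| "tame (Sub r a b) = (r \<noteq> 1)"
| "tame (Load r A i) = (r \<noteq> 1)"
| "tame (Store A i r) = True"
| "tame (Seq p q) = (tame p \<and> tame q)"
| "tame (If a b p q) = (tame p \<and> tame q)"
| "tame (While a b p) = tame p"

definition bounded_by :: "nat \<Rightarrow> ram_state \<Rightarrow> bool" where
  "bounded_by B s \<longleftrightarrow> (\<forall>r. fst s r \<le> B) \<and> (\<forall>A i. snd s A i \<le> B)"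

lemma bit_length_mono: "a \<le> b \<Longrightarrow> bit_length a \<le> bit_length b"
  by (simp add: bit_length_def floor_log_le_iff)

lemma bit_length_pos: "1 \<le> bit_length a"
  by (simp add: bit_length_def)

lemma bit_length_small [simp]: "bit_length 0 = 1" "bit_length 1 = 1" "bit_length (Suc 0) = 1"
  by (simp_all add: bit_length_def)

lemma bounded_by_mono: "bounded_by B s \<Longrightarrow> B \<le> B' \<Longrightarrow> bounded_by B' s"
  by (auto simp: bounded_by_def intro: order_trans)

lemma bit_length_two:
  "a \<le> B \<Longrightarrow> b \<le> B \<Longrightarrow> B \<le> B' \<Longrightarrow> bit_length a + bit_length b \<le> 2 * bit_length B'"
  using bit_length_mono[of a B'] bit_length_mono[of b B'] by simp

text \<open>Consecutive phases of a run come with different bounds on the values in memory; charging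
  all of them to the largest bound \<open>B\<close> makes cost additive in the number of steps. The
  \<open>Suc\<close> pays for the comparison that guards a branch or a loop.\<close>

lemma cost_compose:
  assumes "x \<le> c * (2 * bit_length B1)" "y \<le> d * (2 * bit_length B2)"
    "z \<le> 2 * bit_length B3" "B1 \<le> B" "B2 \<le> B" "B3 \<le> B" "Suc (c + d) \<le> t"
  shows "z + x + y \<le> t * (2 * bit_length B)"
proof -
  have "x \<le> c * (2 * bit_length B)" "y \<le> d * (2 * bit_length B)" "z \<le> 2 * bit_length B"
    using assms bit_length_mono[of _ B] by (meson mult_le_mono2 order_trans)+
  then have "z + x + y \<le> Suc (c + d) * (2 * bit_length B)"
    by (simp add: algebra_simps)
  also have "\<dots> \<le> t * (2 * bit_length B)"
    using assms(7) by (rule mult_le_mono1)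
  finally show ?thesis .
qed

lemma exec_If:
  "exec (if R a < R b then p else q) (R, M) c s' \<Longrightarrow>
    exec (If a b p q) (R, M) (bit_length (R a) + bit_length (R b) + c) s'"
  by (cases "R a < R b") (auto intro: exec.IfTrue[of R a b] exec.IfFalse[of R a b])

text \<open>\<open>B\<close> stays general in the induction because it drifts: a phase of
  \<open>c\<close> steps turns \<open>B\<close> into \<open>B + c\<close>, and the hypothesis for
  the next phase is used there. A step handles at most two numbers, hence the factor 2.
  \<open>1 \<le> B\<close> covers the constants that a tame program may load.\<close>

lemma exec_of_sexec:
  assumes "sexec p s t s'" "tame p" "fst s 1 = 1" "bounded_by B s" "1 \<le> B"
  shows "fst s' 1 = 1 \<and> bounded_by (B + t) s' \<and>
    (\<exists>c. exec p s c s' \<and> c \<le> t * (2 * bit_length (B + t)))"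
  using assms
proof (induction arbitrary: B rule: sexec.induct)
  case (1 s)
  have "1 \<le> 2 * bit_length (B + 1)" using bit_length_pos[of "B + 1"] by linarith
  then show ?case using 1 by (auto intro: exec.Skip bounded_by_mono)
next
  case (2 r c R M)
  have "bit_length c \<le> 2 * bit_length (B + 1)" using 2 bit_length_mono[of c "B + 1"] by simp
  then show ?case using 2 exec.Const[of r c R M]
    by (auto simp: bounded_by_def le_SucI)
next
  case (3 r a b R M)
  have "bit_length (R a) + bit_length (R b) \<le> 2 * bit_length (B + 1)"
    by (rule bit_length_two[of _ B]) (use 3 in \<open>auto simp: bounded_by_def\<close>)
  then show ?case using 3 exec.Add[of r a b R M]
    by (auto simp: bounded_by_def le_SucI)
next
  case (4 r a b R M)
  have "R a \<le> B" "R b \<le> B" using 4 by (auto simp: bounded_by_def)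
  then have "bit_length (R a) + bit_length (R b) \<le> 2 * bit_length (B + 1)" "R a - R b \<le> B"
    using bit_length_mono[of "R a" "B + 1"] bit_length_mono[of "R b" "B + 1"] by auto
  then show ?case using 4 exec.Sub[of r a b R M]
    by (auto simp: bounded_by_def le_SucI)
next
  case (5 r A i R M)
  have "bit_length (R i) + bit_length (M A (R i)) \<le> 2 * bit_length (B + 1)"
    by (rule bit_length_two[of _ B]) (use 5 in \<open>auto simp: bounded_by_def\<close>)
  then show ?case using 5 exec.Load[of r A i R M]
    by (auto simp: bounded_by_def le_SucI)
next
  case (6 A i r R M)
  have "bit_length (R i) + bit_length (R r) \<le> 2 * bit_length (B + 1)"
    by (rule bit_length_two[of _ B]) (use 6 in \<open>auto simp: bounded_by_def\<close>)
  then show ?case using 6 exec.Store[of A i r R M]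
    by (auto simp: bounded_by_def le_SucI)
next
  case (7 p s c s' q d s'')
  from 7(3)[of B] 7(5-) obtain x where 1: "fst s' 1 = 1" "bounded_by (B + c) s'"
    "exec p s x s'" "x \<le> c * (2 * bit_length (B + c))" by auto
  from 7(4)[of "B + c"] 1 7(5-) obtain y where 2: "fst s'' 1 = 1" "bounded_by (B + c + d) s''"
    "exec q s' y s''" "y \<le> d * (2 * bit_length (B + c + d))" by auto
  have "x \<le> c * (2 * bit_length (B + c + d))"
    using 1(4) bit_length_mono[of "B + c" "B + c + d"]
    by (meson le_add1 mult_le_mono2 order_trans)
  with 2(4) have "x + y \<le> (c + d) * (2 * bit_length (B + c + d))"
    by (simp add: algebra_simps)
  with 1 2 show ?case using exec.Seq[OF 1(3) 2(3)] by (auto simp: add.assoc)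
next
  case (8 R a b p q M c s')
  have "tame (if R a < R b then p else q)" using 8 by simp
  from 8(2)[OF this, of B] 8(4-) obtain x where 1: "fst s' 1 = 1" "bounded_by (B + c) s'"
    "exec (if R a < R b then p else q) (R, M) x s'" "x \<le> c * (2 * bit_length (B + c))"
    by auto
  have "bit_length (R a) + bit_length (R b) \<le> 2 * bit_length B"
    by (rule bit_length_two[of _ B]) (use 8 in \<open>auto simp: bounded_by_def\<close>)
  from cost_compose[OF 1(4) _ this, of 0 0 B "B + Suc c" "Suc c"]
  have "bit_length (R a) + bit_length (R b) + x \<le> Suc c * (2 * bit_length (B + Suc c))" by simp
  with 1 show ?case using exec_If[OF 1(3)]
    by (meson add_le_cancel_left bounded_by_mono le_SucI order_refl)
next
  case (9 R a b p M)
  have "bit_length (R a) + bit_length (R b) \<le> 2 * bit_length (B + 1)"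
    by (rule bit_length_two[of _ B]) (use 9 in \<open>auto simp: bounded_by_def\<close>)
  then show ?case using 9 exec.WhileFalse[of R a b p M]
    by (auto intro: bounded_by_mono)
next
  case (10 R a b p M c s' d s'')
  from 10(4)[of B] 10(6-) obtain x where 1: "fst s' 1 = 1" "bounded_by (B + c) s'"
    "exec p (R, M) x s'" "x \<le> c * (2 * bit_length (B + c))" by auto
  from 10(5)[of "B + c"] 1 10(6-) obtain y where 2: "fst s'' 1 = 1" "bounded_by (B + c + d) s''"
    "exec (While a b p) s' y s''" "y \<le> d * (2 * bit_length (B + c + d))" by auto
  have "bit_length (R a) + bit_length (R b) \<le> 2 * bit_length B"
    by (rule bit_length_two[of _ B]) (use 10 in \<open>auto simp: bounded_by_def\<close>)
  from cost_compose[OF 1(4) 2(4) this, of "B + Suc (c + d)" "Suc (c + d)"]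
  have "bit_length (R a) + bit_length (R b) + x + y
      \<le> Suc (c + d) * (2 * bit_length (B + Suc (c + d)))" by simp
  moreover have "bounded_by (B + Suc (c + d)) s''"
    using 2(2) by (rule bounded_by_mono) simp
  ultimately show ?case using 2(1) exec.WhileTrue[of R a b p M, OF 10(1) 1(3) 2(3)] by blast
qed

lemma bit_length_add: "bit_length (a + b) \<le> bit_length a + bit_length b"
proof -
  have "bit_length (a + b) \<le> Suc (bit_length (max a b))"
  proof (cases "max a b = 0")
    case False
    have "bit_length (a + b) \<le> bit_length (2 * max a b)"
      by (rule bit_length_mono) auto
    also have "\<dots> = Suc (bit_length (max a b))"
      using False by (simp add: bit_length_def floor_log_twice)
    finally show ?thesis .
  qed (simp add: max_def split: if_splits)
  also have "\<dots> \<le> bit_length a + bit_length b"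
    using bit_length_pos[of a] bit_length_pos[of b] by (auto simp: max_def)
  finally show ?thesis .
qed

text \<open>This holds for arbitrary programs, not only tame ones: whoever produces a value longer
  than its operands pays for the operands, whose lengths add up to at least that of the result. It
  limits the answer left behind by the hypothetical solver, and so the cost of copying it.\<close>

lemma exec_bit_length:
  assumes "exec p s c s'" "\<forall>r. bit_length (fst s r) \<le> L" "\<forall>A i. bit_length (snd s A i) \<le> L"
  shows "(\<forall>r. bit_length (fst s' r) \<le> L + c) \<and> (\<forall>A i. bit_length (snd s' A i) \<le> L + c)"
  using assms
proof (induction arbitrary: L rule: exec.induct)
  case (Add r a b R M)
  then show ?case using bit_length_add[of "R a" "R b"] by (auto intro: trans_le_add1 trans_le_add2)
next
  case (Sub r a b R M)
  have "bit_length (R a - R b) \<le> bit_length (R a)" by (rule bit_length_mono) simp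
  with Sub show ?case by (auto intro: trans_le_add1 trans_le_add2)
next
  case (Seq p s c s' q d s'')
  from Seq.IH(1)[OF Seq.prems] Seq.IH(2)[of "L + c"] show ?case by (simp add: add.assoc)
next
  case (WhileTrue R a b p M c s' d s'')
  from WhileTrue.IH(1)[OF WhileTrue.prems] WhileTrue.IH(2)[of "L + c"]
  have "(\<forall>r. bit_length (fst s'' r) \<le> L + c + d) \<and> (\<forall>A i. bit_length (snd s'' A i) \<le> L + c + d)"
    by simp
  moreover have "x \<le> L + (bit_length (R a) + bit_length (R b) + c + d)" if "x \<le> L + c + d" for x
    using that by linarith
  ultimately show ?case by blast
next
  case (IfTrue R a b p M c s' q)
  have "x \<le> L + (bit_length (R a) + bit_length (R b) + c)" if "x \<le> L + c" for x
    using that by linarith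
  with IfTrue.IH[OF IfTrue.prems] show ?case by blast
next
  case (IfFalse R a b q M c s' p)
  have "x \<le> L + (bit_length (R a) + bit_length (R b) + c)" if "x \<le> L + c" for x
    using that by linarith
  with IfFalse.IH[OF IfFalse.prems] show ?case by blast
qed (simp_all add: trans_le_add1 trans_le_add2 le_SucI)

section \<open>Relocation of programs\<close>

fun relocate :: "nat \<Rightarrow> com \<Rightarrow> com" where
  "relocate K Skip = Skip"
| "relocate K (Const r c) = Const (r + K) c"
| "relocate K (Add r a b) = Add (r + K) (a + K) (b + K)"
| "relocate K (Sub r a b) = Sub (r + K) (a + K) (b + K)"
| "relocate K (Load r A i) = Load (r + K) (A + K) (i + K)"
| "relocate K (Store A i r) = Store (A + K) (i + K) (r + K)"
| "relocate K (Seq p q) = Seq (relocate K p) (relocate K q)"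
| "relocate K (If a b p q) = If (a + K) (b + K) (relocate K p) (relocate K q)"
| "relocate K (While a b p) = While (a + K) (b + K) (relocate K p)"

text \<open>Registers and arrays below \<open>K\<close> are left open: the surrounding program keeps
  its own data there.\<close>

definition shifted :: "nat \<Rightarrow> ram_state \<Rightarrow> ram_state \<Rightarrow> bool" where
  "shifted K s s' \<longleftrightarrow> (\<forall>r. fst s' (r + K) = fst s r) \<and> (\<forall>A. snd s' (A + K) = snd s A)"

text \<open>Only the names in the program text move; indices within arrays and all values stay the
  same, so even the cost is preserved exactly.\<close>

lemma exec_relocate:
  assumes "exec p s c s'" "shifted K s t"
  shows "\<exists>t'. exec (relocate K p) t c t' \<and> shifted K s' t'"
  using assms
proof (induction arbitrary: t rule: exec.induct)
  case (Skip s)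
  then show ?case using exec.Skip[of t] by (intro exI[of _ t]) simp
next
  case (Const r c R M)
  then show ?case using exec.Const[of "r + K" c "fst t" "snd t"]
    by (fastforce simp: shifted_def)
next
  case (Add r a b R M)
  then show ?case using exec.Add[of "r + K" "a + K" "b + K" "fst t" "snd t"]
    by (fastforce simp: shifted_def)
next
  case (Sub r a b R M)
  then show ?case using exec.Sub[of "r + K" "a + K" "b + K" "fst t" "snd t"]
    by (fastforce simp: shifted_def)
next
  case (Load r A i R M)
  then show ?case using exec.Load[of "r + K" "A + K" "i + K" "fst t" "snd t"]
    by (fastforce simp: shifted_def)
next
  case (Store A i r R M)
  then show ?case using exec.Store[of "A + K" "i + K" "r + K" "fst t" "snd t"]
    by (fastforce simp: shifted_def)
next
  case (Seq p s c s' q d s'')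
  from Seq.IH(1)[OF Seq.prems] obtain t' where
    1: "exec (relocate K p) t c t'" "shifted K s' t'" by blast
  from Seq.IH(2)[OF 1(2)] obtain t'' where
    2: "exec (relocate K q) t' d t''" "shifted K s'' t''" by blast
  from exec.Seq[OF 1(1) 2(1)] 2(2) show ?case unfolding relocate.simps by blast
next
  case (IfTrue R a b p M c s' q)
  obtain R2 M2 where t: "t = (R2, M2)" by (cases t)
  have e: "R2 (a + K) = R a" "R2 (b + K) = R b" using IfTrue t by (auto simp: shifted_def)
  from IfTrue(3)[OF IfTrue(4)] obtain t' where "exec (relocate K p) t c t'" "shifted K s' t'" by blast
  then show ?case using exec.IfTrue[of R2 "a + K" "b + K" "relocate K p" M2 c t'] IfTrue(1) e t
    by (intro exI[of _ t']) simp
next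
  case (IfFalse R a b q M c s' p)
  obtain R2 M2 where t: "t = (R2, M2)" by (cases t)
  have e: "R2 (a + K) = R a" "R2 (b + K) = R b" using IfFalse t by (auto simp: shifted_def)
  from IfFalse(3)[OF IfFalse(4)] obtain t' where "exec (relocate K q) t c t'" "shifted K s' t'" by blast
  then show ?case using exec.IfFalse[of R2 "a + K" "b + K" "relocate K q" M2 c t'] IfFalse(1) e t
    by (intro exI[of _ t']) simp
next
  case (WhileFalse R a b p M)
  obtain R2 M2 where t: "t = (R2, M2)" by (cases t)
  have e: "R2 (a + K) = R a" "R2 (b + K) = R b" using WhileFalse t by (auto simp: shifted_def)
  then show ?case using exec.WhileFalse[of R2 "a + K" "b + K" "relocate K p" M2] WhileFalse t
    by (intro exI[of _ t]) simp
next
  case (WhileTrue R a b p M c s' d s'')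
  obtain R2 M2 where t: "t = (R2, M2)" by (cases t)
  have e: "R2 (a + K) = R a" "R2 (b + K) = R b" using WhileTrue t by (auto simp: shifted_def)
  from WhileTrue(4)[OF WhileTrue(6)] obtain t' where
    1: "exec (relocate K p) t c t'" "shifted K s' t'" by blast
  from WhileTrue(5)[OF 1(2)] obtain t'' where
    2: "exec (relocate K (While a b p)) t' d t''" "shifted K s'' t''" by blast
  then show ?case using exec.WhileTrue[of R2 "a + K" "b + K" "relocate K p" M2 c t' d t''] WhileTrue(1) e t 1
    by (intro exI[of _ t'']) simp
qed

text \<open>The bound is strict for registers but not for arrays: array \<open>K\<close> is where
  the input of a program relocated by \<open>K\<close> gets written. With \<open>K = 49\<close>,
  array 50 is protected as well.\<close>

fun writes_below :: "nat \<Rightarrow> com \<Rightarrow> bool" where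
  "writes_below K Skip = True"
| "writes_below K (Const r c) = (r < K)"
| "writes_below K (Add r a b) = (r < K)"
| "writes_below K (Sub r a b) = (r < K)"
| "writes_below K (Load r A i) = (r < K)"
| "writes_below K (Store A i r) = (A \<le> K)"
| "writes_below K (Seq p q) = (writes_below K p \<and> writes_below K q)"
| "writes_below K (If a b p q) = (writes_below K p \<and> writes_below K q)"
| "writes_below K (While a b p) = writes_below K p"

lemma sexec_frame:
  assumes "sexec p s t s'" "writes_below K p"
  shows "(\<forall>r\<ge>K. fst s' r = fst s r) \<and> (\<forall>A>K. snd s' A = snd s A)"
  using assms by (induction rule: sexec.induct) auto

section \<open>Hoare triples with a bound on the number of steps\<close>

definition hoare :: "((nat \<Rightarrow> nat) \<Rightarrow> (nat \<Rightarrow> nat \<Rightarrow> nat) \<Rightarrow> bool) \<Rightarrow> com \<Rightarrow> nat \<Rightarrow>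
    ((nat \<Rightarrow> nat) \<Rightarrow> (nat \<Rightarrow> nat \<Rightarrow> nat) \<Rightarrow> bool) \<Rightarrow> bool" where
  "hoare P p t Q \<longleftrightarrow> (\<forall>R M. P R M \<longrightarrow>
     (\<exists>c R' M'. sexec p (R, M) c (R', M') \<and> c \<le> t \<and> Q R' M'))"

lemma hoare_Seq:
  assumes "hoare P p t Q" "hoare Q q t' S"
  shows "hoare P (Seq p q) (t + t') S"
  unfolding hoare_def
proof (intro allI impI)
  fix R M assume "P R M"
  with assms(1) obtain c R' M' where 1: "sexec p (R, M) c (R', M')" "c \<le> t" "Q R' M'"
    unfolding hoare_def by blast
  with assms(2) obtain d R'' M'' where 2: "sexec q (R', M') d (R'', M'')" "d \<le> t'" "S R'' M''"
    unfolding hoare_def by blast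
  from 1 2 show "\<exists>c R' M'. sexec (Seq p q) (R, M) c (R', M') \<and> c \<le> t + t' \<and> S R' M'"
    using sexec.intros(7)[OF 1(1) 2(1)] by (intro exI[of _ "c + d"] exI[of _ R''] exI[of _ M'']) auto
qed

lemma hoare_conseq:
  assumes "hoare P p t Q" "\<And>R M. P' R M \<Longrightarrow> P R M" "\<And>R M. Q R M \<Longrightarrow> Q' R M" "t \<le> t'"
  shows "hoare P' p t' Q'"
  unfolding hoare_def
proof (intro allI impI)
  fix R M assume "P' R M"
  with assms(1,2) obtain c R' M' where "sexec p (R, M) c (R', M')" "c \<le> t" "Q R' M'"
    unfolding hoare_def by blast
  with assms(3,4) show "\<exists>c R' M'. sexec p (R, M) c (R', M') \<and> c \<le> t' \<and> Q' R' M'"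
    by (intro exI[of _ c] exI[of _ R'] exI[of _ M']) auto
qed

lemma hoare_If:
  assumes "hoare (\<lambda>R M. P R M \<and> R a < R b) p t Q" "hoare (\<lambda>R M. P R M \<and> \<not> R a < R b) q t Q"
  shows "hoare P (If a b p q) (Suc t) Q"
  unfolding hoare_def
proof (intro allI impI)
  fix R M assume "P R M"
  with assms have "\<exists>c R' M'. sexec (if R a < R b then p else q) (R, M) c (R', M') \<and> c \<le> t \<and> Q R' M'"
    unfolding hoare_def by (cases "R a < R b") (simp_all only: if_True if_False if_P if_not_P, blast+)
  then obtain c R' M' where 1: "sexec (if R a < R b then p else q) (R, M) c (R', M')" "c \<le> t" "Q R' M'"
    by blast
  show "\<exists>c R' M'. sexec (If a b p q) (R, M) c (R', M') \<and> c \<le> Suc t \<and> Q R' M'"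
    using sexec.intros(8)[OF 1(1)] 1(2,3) by (intro exI[of _ "Suc c"] exI[of _ R'] exI[of _ M']) auto
qed

text \<open>The invariant is indexed by the number of completed passes and \<open>n\<close> is fixed
  in advance, so termination needs no separate measure. The induction counts the passes that
  remain.\<close>

lemma hoare_While:
  assumes body: "\<And>i. i < n \<Longrightarrow> hoare (I i) p t (I (Suc i))"
    and guard: "\<And>i R M. i < n \<Longrightarrow> I i R M \<Longrightarrow> R a < R b"
    and exit: "\<And>R M. I n R M \<Longrightarrow> \<not> R a < R b"
  shows "hoare (I 0) (While a b p) (Suc (n * Suc t)) (I n)"
proof -
  have "hoare (I (n - k)) (While a b p) (Suc (k * Suc t)) (I n)" if "k \<le> n" for k
    using that
  proof (induction k)
    case 0
    show ?case unfolding hoare_def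
    proof (intro allI impI)
      fix R M assume "I (n - 0) R M"
      with exit sexec.intros(9)[of R a b p M]
      show "\<exists>c R' M'. sexec (While a b p) (R, M) c (R', M') \<and> c \<le> Suc (0 * Suc t) \<and> I n R' M'"
        by (intro exI[of _ 1] exI[of _ R] exI[of _ M]) auto
    qed
  next
    case (Suc k)
    have lt: "n - Suc k < n" and eq: "Suc (n - Suc k) = n - k" using Suc by auto
    show ?case unfolding hoare_def
    proof (intro allI impI)
      fix R M assume I: "I (n - Suc k) R M"
      from body[OF lt] I eq obtain c R' M' where
        1: "sexec p (R, M) c (R', M')" "c \<le> t" "I (n - k) R' M'" unfolding hoare_def by metis
      from Suc 1(3) obtain d R'' M'' where
        2: "sexec (While a b p) (R', M') d (R'', M'')" "d \<le> Suc (k * Suc t)" "I n R'' M''"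
        unfolding hoare_def by (metis Suc_leD)
      show "\<exists>c R' M'. sexec (While a b p) (R, M) c (R', M') \<and> c \<le> Suc (Suc k * Suc t) \<and> I n R' M'"
        using sexec.intros(10)[of R a b p M, OF guard[OF lt I] 1(1) 2(1)] 1(2) 2(2,3)
        by (intro exI[of _ "Suc (c + d)"] exI[of _ R''] exI[of _ M'']) auto
    qed
  qed
  from this[of n] show ?thesis by simp
qed

section \<open>Symbolic execution of straight-line code, and counted loops\<close>

fun while_free :: "com \<Rightarrow> bool" where
  "while_free (Seq p q) = (while_free p \<and> while_free q)"
| "while_free (If a b p q) = (while_free p \<and> while_free q)"
| "while_free (While a b p) = False"
| "while_free p = True"

fun eval_com :: "com \<Rightarrow> ram_state \<Rightarrow> ram_state" where
  "eval_com (Const r c) (R, M) = (R(r := c), M)"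
| "eval_com (Add r a b) (R, M) = (R(r := R a + R b), M)"
| "eval_com (Sub r a b) (R, M) = (R(r := R a - R b), M)"
| "eval_com (Load r A i) (R, M) = (R(r := M A (R i)), M)"
| "eval_com (Store A i r) (R, M) = (R, M(A := (M A)(R i := R r)))"
| "eval_com (Seq p q) s = eval_com q (eval_com p s)"
| "eval_com (If a b p q) (R, M) = (if R a < R b then eval_com p (R, M) else eval_com q (R, M))"
| "eval_com p s = s"

text \<open>Both branches of an \<open>If\<close> are added up instead of taking the larger one;
  this loses only a constant factor.\<close>

fun com_size :: "com \<Rightarrow> nat" where
  "com_size (Seq p q) = com_size p + com_size q"
| "com_size (If a b p q) = Suc (com_size p + com_size q)"
| "com_size p = 1"

lemma sexec_eval_com:
  assumes "while_free p"
  shows "\<exists>c\<le>com_size p. sexec p s c (eval_com p s)"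
  using assms
proof (induction p arbitrary: s)
  case (Seq p q)
  from Seq.IH(1)[of s] Seq.prems obtain c where 1: "c \<le> com_size p" "sexec p s c (eval_com p s)"
    by auto
  from Seq.IH(2)[of "eval_com p s"] Seq.prems obtain d where
    2: "d \<le> com_size q" "sexec q (eval_com p s) d (eval_com q (eval_com p s))" by auto
  show ?case using 1(1) 2(1) sexec.intros(7)[OF 1(2) 2(2)] by (intro exI[of _ "c + d"]) simp
next
  case (If a b p q)
  obtain R M where s: "s = (R, M)" by (cases s)
  have "\<exists>c\<le>com_size p + com_size q. sexec (if R a < R b then p else q) s c
      (eval_com (if R a < R b then p else q) s)"
    using If.IH[of s] If.prems by (auto intro: trans_le_add1 trans_le_add2)
  then obtain c where c: "c \<le> com_size p + com_size q" "sexec (if R a < R b then p else q) (R, M) c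
      (eval_com (if R a < R b then p else q) (R, M))" unfolding s by blast
  show ?case using sexec.intros(8)[OF c(2)] c(1) by (intro exI[of _ "Suc c"]) (auto simp: s)
qed (cases s; force intro!: exI[of _ 1] sexec.intros(1-6)[simplified])+

text \<open>Loop-free code is executed by rewriting with \<open>eval_com\<close>, which turns the
  triples for loop bodies below into goals for \<open>auto\<close>.\<close>

lemma hoare_while_free:
  assumes "while_free p" "com_size p \<le> t"
    "\<And>R M. P R M \<Longrightarrow> (\<lambda>(R', M'). Q R' M') (eval_com p (R, M))"
  shows "hoare P p t Q"
  unfolding hoare_def
proof (intro allI impI)
  fix R M assume "P R M"
  from sexec_eval_com[OF assms(1), of "(R, M)"] obtain c where
    "c \<le> com_size p" "sexec p (R, M) c (eval_com p (R, M))" by auto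
  moreover obtain R' M' where "eval_com p (R, M) = (R', M')" by fastforce
  ultimately show "\<exists>c R' M'. sexec p (R, M) c (R', M') \<and> c \<le> t \<and> Q R' M'"
    using assms(2) assms(3)[OF \<open>P R M\<close>]
    by (intro exI[of _ c] exI[of _ R'] exI[of _ M']) auto
qed

text \<open>A subtraction, because register 0 is kept at 0, whereas \<open>tame\<close> only allows
  register 1 as second summand of an addition.\<close>

definition copy :: "nat \<Rightarrow> nat \<Rightarrow> com" where "copy r a = Sub r a 0"
definition inc :: "nat \<Rightarrow> com" where "inc r = Add r r 1"

fun block :: "com list \<Rightarrow> com" where
  "block [] = Skip"
| "block [p] = p"
| "block (p # q # ps) = Seq p (block (q # ps))"

definition for_loop :: "nat \<Rightarrow> nat \<Rightarrow> com \<Rightarrow> com" where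
  "for_loop r b p = Seq (Const r 0) (While r b (Seq p (inc r)))"

text \<open>Premise \<open>upd\<close> keeps the loop counter out of the invariant, which is why its
  value is carried separately as \<open>R r = i\<close>. A pass costs \<open>t\<close> plus the test
  and the increment; the remaining 2 are the initialisation and the last test.\<close>

lemma hoare_for_loop:
  assumes body: "\<And>i. i < n \<Longrightarrow> hoare (\<lambda>R M. I i R M \<and> R r = i) p t
      (\<lambda>R M. I (Suc i) R M \<and> R r = i)"
    and upd: "\<And>i x R M. I i R M \<Longrightarrow> I i (R(r := x)) M"
    and bnd: "\<And>i R M. I i R M \<Longrightarrow> R b = n"
    and one: "\<And>i R M. I i R M \<Longrightarrow> R 1 = 1"
    and ne: "r \<noteq> b"
  shows "hoare (I 0) (for_loop r b p) (2 + n * (t + 2)) (I n)"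
proof -
  have "hoare (I 0) (Const r 0) 1 (\<lambda>R M. I 0 R M \<and> R r = 0)"
    by (rule hoare_while_free) (auto intro: upd)
  moreover have "hoare (\<lambda>R M. I 0 R M \<and> R r = 0) (While r b (Seq p (inc r)))
      (Suc (n * Suc (t + 1))) (\<lambda>R M. I n R M \<and> R r = n)"
  proof (rule hoare_While)
    fix i assume "i < n"
    have "hoare (\<lambda>R M. I (Suc i) R M \<and> R r = i) (inc r) 1 (\<lambda>R M. I (Suc i) R M \<and> R r = Suc i)"
      by (rule hoare_while_free) (use one in \<open>auto simp: inc_def intro: upd\<close>)
    with body[OF \<open>i < n\<close>] show "hoare (\<lambda>R M. I i R M \<and> R r = i) (Seq p (inc r)) (t + 1)
        (\<lambda>R M. I (Suc i) R M \<and> R r = Suc i)"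
      by (rule hoare_Seq)
  qed (use bnd in auto)
  ultimately have "hoare (I 0) (for_loop r b p) (1 + Suc (n * Suc (t + 1)))
      (\<lambda>R M. I n R M \<and> R r = n)"
    unfolding for_loop_def by (rule hoare_Seq)
  then show ?thesis by (rule hoare_conseq) auto
qed

text \<open>Padding with 0, as in \<open>initial_state\<close>, allows memory contents to be stated
  as equations between functions.\<close>

definition arr :: "nat list \<Rightarrow> nat \<Rightarrow> nat" where
  "arr xs i = (if i < length xs then xs ! i else 0)"

lemma arr_snoc [simp]: "n = length xs \<Longrightarrow> (arr xs)(n := v) = arr (xs @ [v])"
  by (auto simp: arr_def nth_append fun_eq_iff)

section \<open>Finite prefixes of random plays\<close>

text \<open>The empty history yields the start vertex, so that the first step is treated like all
  others, as in \<open>play_kernel\<close>.\<close>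

definition history_step :: "'v mdp \<Rightarrow> ('v list \<Rightarrow> 'v) \<Rightarrow> 'v \<Rightarrow> 'v list \<Rightarrow> 'v pmf" where
  "history_step P \<sigma> v h = (if h = [] then return_pmf v else next_vertex P \<sigma> h)"

primrec extend_history :: "'v mdp \<Rightarrow> ('v list \<Rightarrow> 'v) \<Rightarrow> 'v \<Rightarrow> nat \<Rightarrow> 'v list \<Rightarrow> 'v list pmf" where
  "extend_history P \<sigma> v 0 h = return_pmf h"
| "extend_history P \<sigma> v (Suc k) h = bind_pmf (history_step P \<sigma> v h) (\<lambda>x. extend_history P \<sigma> v k (h @ [x]))"

definition history_pmf :: "'v mdp \<Rightarrow> ('v list \<Rightarrow> 'v) \<Rightarrow> 'v \<Rightarrow> nat \<Rightarrow> 'v list pmf" where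
  "history_pmf P \<sigma> v t = extend_history P \<sigma> v t []"

lemma extend_history_add: "extend_history P \<sigma> v (a + b) h = bind_pmf (extend_history P \<sigma> v a h) (extend_history P \<sigma> v b)"
  by (induction a arbitrary: h) (simp_all add: bind_return_pmf bind_assoc_pmf)

lemma history_pmf_add:
  "history_pmf P \<sigma> v (a + b) = bind_pmf (history_pmf P \<sigma> v a) (extend_history P \<sigma> v b)"
  by (simp add: history_pmf_def extend_history_add)

lemma history_pmf_Suc: "history_pmf P \<sigma> v (Suc t) =
    bind_pmf (history_pmf P \<sigma> v t) (\<lambda>h. map_pmf (\<lambda>x. h @ [x]) (history_step P \<sigma> v h))"
proof -
  have "extend_history P \<sigma> v 1 = (\<lambda>h. map_pmf (\<lambda>x. h @ [x]) (history_step P \<sigma> v h))"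
    by (simp add: fun_eq_iff map_pmf_def)
  then show ?thesis using history_pmf_add[of P \<sigma> v t 1] by simp
qed

lemma play_kernel_eq:
  "play_kernel P \<sigma> v t \<omega> = measure_pmf (history_step P \<sigma> v (map \<omega> [0..<t]))"
  by (auto simp: play_kernel_def history_step_def)

lemma length_extend: "h' \<in> set_pmf (extend_history P \<sigma> v k h) \<Longrightarrow> length h' = length h + k \<and> take (length h) h' = h"
proof (induction k arbitrary: h)
  case (Suc k)
  then obtain x where "h' \<in> set_pmf (extend_history P \<sigma> v k (h @ [x]))" by auto
  from Suc.IH[OF this] have 1: "length h' = Suc (length h + k)" "take (Suc (length h)) h' = h @ [x]"
    by auto
  have "take (length h) (take (Suc (length h)) h') = h" by (simp only: 1) simp
  moreover have "take (length h) (take (Suc (length h)) h') = take (length h) h'"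
    by (simp add: min_def)
  ultimately show ?case using 1(1) by simp
qed simp

lemma length_history: "h \<in> set_pmf (history_pmf P \<sigma> v t) \<Longrightarrow> length h = t"
  unfolding history_pmf_def using length_extend by fastforce

text \<open>The bridge from the Ionescu-Tulcea construction to discrete probability. Finite products
  of a countable discrete space are discrete again, so every set of prefixes is measurable and a
  kernel step amounts to a \<open>bind_pmf\<close> that appends one vertex.\<close>

lemma distr_C_history:
  fixes P :: "('v::countable) mdp"
  shows "distr (Ionescu_Tulcea.C (play_kernel P \<sigma> v) (\<lambda>_. count_space UNIV) 0 t (\<lambda>_. undefined))
      (count_space UNIV) (\<lambda>\<omega>. map \<omega> [0..<t]) = measure_pmf (history_pmf P \<sigma> v t)"
proof -
  interpret Ionescu_Tulcea "play_kernel P \<sigma> v" "\<lambda>_. count_space UNIV"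
    by (rule Ionescu_Tulcea_play_kernel)
  let ?M = "\<lambda>t. PiM {0..<t} (\<lambda>_::nat. count_space (UNIV :: 'v set))"
  let ?C = "\<lambda>t. C 0 t (\<lambda>_. undefined)"
  have cnt: "?M t = count_space (PiE {0..<t} (\<lambda>_. UNIV))" for t
    by (rule count_space_PiM_finite) auto
  have und: "(\<lambda>_. undefined) \<in> space (?M 0)" by (simp add: space_PiM)
  have sets_C': "sets (?C t) = Pow (PiE {0..<t} (\<lambda>_. UNIV))" for t
    using sets_C[OF und, of t] cnt[of t] by simp
  have space_C': "space (?C t) = PiE {0..<t} (\<lambda>_. UNIV)" for t
    using space_C[OF und, of t] by (simp add: space_PiM)
  have meas: "f \<in> measurable (?C t) (count_space UNIV)" for t and f :: "_ \<Rightarrow> 'v list"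
    unfolding measurable_def by (auto simp: sets_C' space_C')
  show ?thesis
  proof (induction t)
    case 0
    show ?case
    proof (rule measure_eqI)
      fix A assume "A \<in> sets (distr (?C 0) (count_space UNIV) (\<lambda>\<omega>. map \<omega> [0..<0]))"
      show "emeasure (distr (?C 0) (count_space UNIV) (\<lambda>\<omega>. map \<omega> [0..<0])) A
          = emeasure (measure_pmf (history_pmf P \<sigma> v 0)) A"
        by (subst emeasure_distr[OF meas]) (auto simp: history_pmf_def indicator_def space_PiM emeasure_return[OF _] sets_PiM_single PiM_empty)
    qed simp
  next
    case (Suc t)
    show ?case
    proof (rule measure_eqI)
      fix A assume "A \<in> sets (distr (?C (Suc t)) (count_space UNIV) (\<lambda>\<omega>. map \<omega> [0..<Suc t]))"
      let ?Y = "(\<lambda>\<omega>. map \<omega> [0..<Suc t]) -` A \<inter> PiE {0..<Suc t} (\<lambda>_. UNIV)"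
      let ?g = "\<lambda>h. emeasure (measure_pmf (history_step P \<sigma> v h)) {x. h @ [x] \<in> A}"
      have Y: "?Y \<in> sets (?M (Suc t))" by (simp add: cnt)
      have "emeasure (distr (?C (Suc t)) (count_space UNIV) (\<lambda>\<omega>. map \<omega> [0..<Suc t])) A
          = emeasure (?C (Suc t)) ?Y"
        by (subst emeasure_distr[OF meas]) (simp_all only: space_C' sets_count_space Pow_UNIV UNIV_I)
      also have "\<dots> = (\<integral>\<^sup>+\<omega>. emeasure (eP t \<omega>) ?Y \<partial>?C t)"
        unfolding C.simps(2) add_0
      proof (rule emeasure_bind)
        show "space (?C t) \<noteq> {}" by (simp add: space_C' PiE_eq_empty_iff)
        show "eP t \<in> measurable (?C t) (subprob_algebra (?M (Suc t)))"
          using measurable_eP[of t] sets_C[OF und, of t]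
          by (subst measurable_cong_sets[OF _ refl]) auto
      qed (rule Y)
      also have "\<dots> = (\<integral>\<^sup>+\<omega>. ?g (map \<omega> [0..<t]) \<partial>?C t)"
      proof (rule nn_integral_cong)
        fix \<omega> assume "\<omega> \<in> space (?C t)"
        then have \<omega>: "\<omega> \<in> space (?M t)" by (simp add: space_C' space_PiM)
        have *: "map (fun_upd \<omega> t x) [0..<Suc t] = map \<omega> [0..<t] @ [x]" for x by simp
        have "(\<lambda>x. fun_upd \<omega> t x) -` ?Y \<inter> space (count_space UNIV) = {x. map \<omega> [0..<t] @ [x] \<in> A}"
          using \<omega> * by (auto simp: space_PiM PiE_iff extensional_def)
        then show "emeasure (eP t \<omega>) ?Y = ?g (map \<omega> [0..<t])"
          by (subst emeasure_eP[OF \<omega> Y]) (simp add: play_kernel_eq)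
      qed
      also have "\<dots> = (\<integral>\<^sup>+h. ?g h \<partial>distr (?C t) (count_space UNIV) (\<lambda>\<omega>. map \<omega> [0..<t]))"
        by (rule nn_integral_distr[symmetric, OF meas]) simp
      also have "\<dots> = (\<integral>\<^sup>+h. ?g h \<partial>measure_pmf (history_pmf P \<sigma> v t))"
        by (simp only: Suc)
      also have "\<dots> = emeasure (measure_pmf (history_pmf P \<sigma> v (Suc t))) A"
        by (simp add: history_pmf_Suc emeasure_bind_pmf vimage_def)
      finally show "emeasure (distr (?C (Suc t)) (count_space UNIV) (\<lambda>\<omega>. map \<omega> [0..<Suc t])) A
          = emeasure (measure_pmf (history_pmf P \<sigma> v (Suc t))) A" .
    qed simp
  qed
qed

lemma sets_play_measure:
  fixes P :: "('v::countable) mdp"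
  shows "sets (play_measure P \<sigma> v) = sets (PiM UNIV (\<lambda>_. count_space UNIV))"
    and "space (play_measure P \<sigma> v) = UNIV"
proof -
  interpret Ionescu_Tulcea "play_kernel P \<sigma> v" "\<lambda>_. count_space UNIV"
    by (rule Ionescu_Tulcea_play_kernel)
  show "sets (play_measure P \<sigma> v) = sets (PiM UNIV (\<lambda>_. count_space UNIV))"
    unfolding play_measure_def by simp
  then show "space (play_measure P \<sigma> v) = UNIV"
    unfolding play_measure_def by (simp add: space_PiM)
qed

text \<open>An event about the first \<open>t\<close> vertices is a cylinder over
  \<open>{0..<t}\<close>, and the projective limit gives a cylinder the measure of its base.\<close>

lemma prefix_event:
  fixes P :: "('v::countable) mdp"
    and t :: nat
  shows "{\<omega>. map \<omega> [0..<t] \<in> X} \<in> sets (play_measure P \<sigma> v)" (is ?A)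
    and "emeasure (play_measure P \<sigma> v) {\<omega>. map \<omega> [0..<t] \<in> X}
      = emeasure (measure_pmf (history_pmf P \<sigma> v t)) X" (is ?B)
proof -
  interpret Ionescu_Tulcea "play_kernel P \<sigma> v" "\<lambda>_. count_space UNIV"
    by (rule Ionescu_Tulcea_play_kernel)
  let ?M = "PiM {0..<t} (\<lambda>_::nat. count_space (UNIV :: 'v set))"
  let ?Y = "(\<lambda>\<omega>. map \<omega> [0..<t]) -` X \<inter> PiE {0..<t} (\<lambda>_. UNIV)"
  have cnt: "?M = count_space (PiE {0..<t} (\<lambda>_. UNIV))"
    by (rule count_space_PiM_finite) auto
  have Y: "?Y \<in> sets ?M" by (simp add: cnt)
  have und: "(\<lambda>_. undefined) \<in> space (PiM {0..<0} (\<lambda>_::nat. count_space (UNIV :: 'v set)))"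
    by (simp add: space_PiM)
  have sets_C': "sets (C 0 t (\<lambda>_. undefined)) = Pow (PiE {0..<t} (\<lambda>_. UNIV))"
    using sets_C[OF und, of t] cnt by simp
  have space_C': "space (C 0 t (\<lambda>_. undefined)) = PiE {0..<t} (\<lambda>_. UNIV)"
    using space_C[OF und, of t] by (simp add: space_PiM)
  have map_restrict: "map (restrict \<omega> {0..<t}) [0..<t] = map \<omega> [0..<t]" for \<omega> :: "nat \<Rightarrow> 'v"
    by (rule map_cong) auto
  have emb: "{\<omega>. map \<omega> [0..<t] \<in> X} = prod_emb UNIV (\<lambda>_. count_space UNIV) {0..<t} ?Y"
    by (auto simp: prod_emb_def map_restrict)
  have emb': "prod_emb {0..<t} (\<lambda>_. count_space UNIV) {0..<t} ?Y = ?Y"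
    by (rule prod_emb_id) auto
  have "prod_emb UNIV (\<lambda>_. count_space UNIV) {0..<t} ?Y \<in> sets (PiM UNIV (\<lambda>_. count_space UNIV))"
    using Y by (intro measurable_prod_emb) auto
  then show ?A by (simp add: emb sets_play_measure)
  have "emeasure (play_measure P \<sigma> v) {\<omega>. map \<omega> [0..<t] \<in> X} = emeasure (CI {0..<t}) ?Y"
    unfolding emb play_measure_def by (rule lim) (use Y in auto)
  also have "\<dots> = emeasure (C 0 t (\<lambda>_. undefined)) ?Y"
    using emeasure_CI[OF order_refl Y] emb' by simp
  also have "\<dots> = emeasure (distr (C 0 t (\<lambda>_. undefined)) (count_space UNIV) (\<lambda>\<omega>. map \<omega> [0..<t])) X"
    by (subst emeasure_distr) (auto simp: measurable_def sets_C' space_C')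
  also have "\<dots> = emeasure (measure_pmf (history_pmf P \<sigma> v t)) X"
    by (simp add: distr_C_history)
  finally show ?B .
qed

lemma prob_space_play_measure:
  fixes P :: "('v::countable) mdp"
  shows "prob_space (play_measure P \<sigma> v)"
proof
  show "emeasure (play_measure P \<sigma> v) (space (play_measure P \<sigma> v)) = 1"
    using prefix_event(2)[where t = 0 and X = UNIV and P = P and \<sigma> = \<sigma> and v = v] measure_pmf.emeasure_space_1[of "history_pmf P \<sigma> v 0"]
    by (simp add: sets_play_measure)
qed

lemma AE_prefix_iff:
  fixes P :: "('v::countable) mdp"
  shows "(AE \<omega> in play_measure P \<sigma> v. Q (map \<omega> [0..<t])) \<longleftrightarrow> (\<forall>h\<in>set_pmf (history_pmf P \<sigma> v t). Q h)"
proof -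
  have 1: "{\<omega>. map \<omega> [0..<t] \<in> {h. \<not> Q h}} = {\<omega> \<in> space (play_measure P \<sigma> v). \<not> Q (map \<omega> [0..<t])}"
    by (auto simp: sets_play_measure)
  have "(AE \<omega> in play_measure P \<sigma> v. Q (map \<omega> [0..<t])) \<longleftrightarrow>
      emeasure (play_measure P \<sigma> v) {\<omega>. map \<omega> [0..<t] \<in> {h. \<not> Q h}} = 0"
    by (subst AE_iff_measurable[OF _ 1[symmetric]]) (use prefix_event(1)[where t = t and X = "{h. \<not> Q h}" and P = P and \<sigma> = \<sigma> and v = v] in simp_all)
  also have "\<dots> \<longleftrightarrow> emeasure (measure_pmf (history_pmf P \<sigma> v t)) {h. \<not> Q h} = 0"
    by (simp only: prefix_event(2))
  also have "\<dots> \<longleftrightarrow> (AE h in measure_pmf (history_pmf P \<sigma> v t). Q h)"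
    by (subst AE_iff_measurable[OF _ refl]) auto
  also have "\<dots> \<longleftrightarrow> (\<forall>h\<in>set_pmf (history_pmf P \<sigma> v t). Q h)"
    by (simp add: AE_measure_pmf_iff)
  finally show ?thesis .
qed

lemma AE_play_step:
  fixes P :: "('v::countable) mdp"
  shows "AE \<omega> in play_measure P \<sigma> v. \<omega> 0 = v \<and>
    (\<forall>t. \<omega> (Suc t) \<in> set_pmf (next_vertex P \<sigma> (map \<omega> [0..<Suc t])))"
proof -
  have *: "AE \<omega> in play_measure P \<sigma> v. \<omega> t \<in> set_pmf (history_step P \<sigma> v (map \<omega> [0..<t]))" for t
  proof -
    have "AE \<omega> in play_measure P \<sigma> v.
        (\<lambda>h. last h \<in> set_pmf (history_step P \<sigma> v (butlast h))) (map \<omega> [0..<Suc t])"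
      by (rule AE_prefix_iff[THEN iffD2]) (auto simp: history_pmf_Suc)
    then show ?thesis by (rule AE_mp) (rule AE_I2, simp)
  qed
  then have "AE \<omega> in play_measure P \<sigma> v. \<forall>t. \<omega> t \<in> set_pmf (history_step P \<sigma> v (map \<omega> [0..<t]))"
    by (simp add: AE_all_countable)
  then show ?thesis
  proof (rule AE_mp, intro AE_I2 impI conjI allI)
    fix \<omega> assume *: "\<forall>t. \<omega> t \<in> set_pmf (history_step P \<sigma> v (map \<omega> [0..<t]))"
    show "\<omega> 0 = v" using *[rule_format, of 0] by (simp add: history_step_def)
    show "\<omega> (Suc t) \<in> set_pmf (next_vertex P \<sigma> (map \<omega> [0..<Suc t]))" for t
      using *[rule_format, of "Suc t"] by (simp add: history_step_def)
  qed
qed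

text \<open>An almost sure property cannot miss a history of positive probability. This transports
  facts about infinite plays back to finite histories.\<close>

lemma AE_realises_history:
  fixes P :: "('v::countable) mdp"
  assumes "h \<in> set_pmf (history_pmf P \<sigma> v t)" and "AE \<omega> in play_measure P \<sigma> v. Q \<omega>"
  shows "\<exists>\<omega>. map \<omega> [0..<t] = h \<and> Q \<omega>"
proof (rule ccontr)
  assume "\<nexists>\<omega>. map \<omega> [0..<t] = h \<and> Q \<omega>"
  then have "AE \<omega> in play_measure P \<sigma> v. map \<omega> [0..<t] \<noteq> h"
    by (intro AE_mp[OF assms(2) AE_I2]) auto
  then have "\<forall>h'\<in>set_pmf (history_pmf P \<sigma> v t). h' \<noteq> h"
    using AE_prefix_iff[of "\<lambda>h'. h' \<noteq> h" t P \<sigma> v] by simp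
  then show False using assms(1) by auto
qed

lemma emeasure_bind_pmf_ge:
  "ennreal (pmf p x) * emeasure (measure_pmf (f x)) A \<le> emeasure (measure_pmf (bind_pmf p f)) A"
proof -
  have "ennreal (pmf p x) * emeasure (measure_pmf (f x)) A
      = (\<integral>\<^sup>+y. emeasure (measure_pmf (f x)) A * indicator {x} y \<partial>measure_pmf p)"
    by (subst nn_integral_cmult_indicator) (simp_all add: emeasure_pmf_single mult.commute)
  also have "\<dots> \<le> (\<integral>\<^sup>+y. emeasure (measure_pmf (f y)) A \<partial>measure_pmf p)"
    by (intro nn_integral_mono) (auto simp: indicator_def)
  finally show ?thesis by (simp add: emeasure_bind_pmf)
qed

text \<open>Time is cut into blocks of length \<open>b\<close>. Whatever the past, \<open>x\<close>
  ends the next block with probability at least \<open>r\<close>, so each further block multiplies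
  the probability of having missed it by at most \<open>1 - r\<close>. The first \<open>s\<close>
  blocks go unwatched, which later gives every starting time.\<close>

lemma emeasure_avoid_le:
  fixes P :: "('v::countable) mdp"
  assumes r: "0 \<le> r" "r \<le> 1" and b: "0 < b"
    and hit: "\<And>s h. h \<in> set_pmf (history_pmf P \<sigma> v (b * s)) \<Longrightarrow>
      ennreal r \<le> emeasure (measure_pmf (extend_history P \<sigma> v b h)) {h'. last h' = x}"
  shows "emeasure (measure_pmf (history_pmf P \<sigma> v (b * (s + k))))
      {h. \<forall>j<k. h ! (b * (s + j) + b - 1) \<noteq> x} \<le> ennreal ((1 - r) ^ k)"
proof (induction k)
  case 0
  show ?case by (simp add: measure_pmf.emeasure_le_1)
next
  case (Suc k)
  let ?ext = "extend_history P \<sigma> v b" and ?hist = "\<lambda>k. history_pmf P \<sigma> v (b * (s + k))"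
  let ?A = "\<lambda>k. {h. \<forall>j<k. h ! (b * (s + j) + b - 1) \<noteq> x}"
  have step: "emeasure (?ext h) (?A (Suc k))
      \<le> indicator (?A k) h * ennreal (1 - r)"
    if h: "h \<in> set_pmf (?hist k)" for h
  proof -
    have len: "length h = b * (s + k)" using length_history[OF h] .
    \<comment> \<open>Position \<open>b * (s + k) + b - 1\<close> is the last one of the new block;
      all smaller positions that are watched lie in the unchanged prefix \<open>h\<close>.\<close>
    have sub: "h' \<in> {h'. h \<in> ?A k \<and> last h' \<noteq> x}"
      if h': "h' \<in> set_pmf (?ext h)" "h' \<in> ?A (Suc k)" for h'
    proof -
      have l': "length h' = b * (s + k) + b" and tk: "take (length h) h' = h"
        using length_extend[OF h'(1)] len by auto
      have "last h' = h' ! (b * (s + k) + b - 1)"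
        using l' b by (subst last_conv_nth) auto
      then have "last h' \<noteq> x" using h'(2) by auto
      moreover have "h ! (b * (s + j) + b - 1) \<noteq> x" if "j < k" for j
      proof -
        have "b * (s + j) + b = b * (s + Suc j)" by (simp add: algebra_simps)
        also have "\<dots> \<le> b * (s + k)" using that by (intro mult_le_mono2) simp
        finally have "b * (s + j) + b \<le> b * (s + k)" .
        then have "b * (s + j) + b - 1 < length h" using b len by simp
        then have "h ! (b * (s + j) + b - 1) = h' ! (b * (s + j) + b - 1)"
          using tk by (metis nth_take)
        then show ?thesis using h'(2) that by auto
      qed
      ultimately show ?thesis by auto
    qed
    have "emeasure (?ext h) (?A (Suc k))
        \<le> emeasure (?ext h) {h'. h \<in> ?A k \<and> last h' \<noteq> x}"
      using sub by (intro emeasure_mono_AE) (auto simp: AE_measure_pmf_iff)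
    also have "\<dots> = indicator (?A k) h * emeasure (?ext h) {h'. last h' \<noteq> x}"
    proof (cases "h \<in> ?A k")
      case True
      then have "{h'. h \<in> ?A k \<and> last h' \<noteq> x} = {h'. last h' \<noteq> x}" by blast
      with True show ?thesis by (simp only: indicator_simps mult_1)
    next
      case False
      then have "{h'. h \<in> ?A k \<and> last h' \<noteq> x} = {}" by blast
      moreover have "indicator (?A k) h = (0 :: ennreal)" using False by (rule indicator_simps)
      ultimately show ?thesis by (simp only: mult_zero_left emeasure_empty)
    qed
    also have "emeasure (?ext h) {h'. last h' \<noteq> x} \<le> ennreal (1 - r)"
    proof -
      have "r \<le> measure (?ext h) {h'. last h' = x}"
        using hit[OF h] by (simp add: measure_pmf.emeasure_eq_measure)
      moreover have "measure (?ext h) {h'. last h' \<noteq> x}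
          = 1 - measure (?ext h) {h'. last h' = x}"
        using measure_pmf.prob_compl[of "{h'. last h' = x}" "?ext h"]
        by (simp add: set_diff_eq)
      ultimately show ?thesis
        by (simp add: measure_pmf.emeasure_eq_measure ennreal_leI)
    qed
    finally show ?thesis by (simp add: mult_left_mono)
  qed
  have "history_pmf P \<sigma> v (b * (s + Suc k))
      = bind_pmf (?hist k) ?ext"
    using history_pmf_add[of P \<sigma> v "b * (s + k)" b] by (simp add: algebra_simps)
  then have "emeasure (measure_pmf (history_pmf P \<sigma> v (b * (s + Suc k)))) (?A (Suc k))
      = (\<integral>\<^sup>+h. emeasure (?ext h) (?A (Suc k))
          \<partial>measure_pmf (?hist k))"
    by (simp add: emeasure_bind_pmf)
  also have "\<dots> \<le> (\<integral>\<^sup>+h. ennreal (1 - r) * indicator (?A k) h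
          \<partial>measure_pmf (?hist k))"
    using step by (intro nn_integral_mono_AE) (auto simp: AE_measure_pmf_iff mult.commute)
  also have "\<dots> = ennreal (1 - r) * emeasure (?hist k) (?A k)"
    by (simp add: nn_integral_cmult_indicator)
  also have "\<dots> \<le> ennreal (1 - r) * ennreal ((1 - r) ^ k)"
    using Suc by (intro mult_left_mono) auto
  also have "\<dots> = ennreal ((1 - r) ^ Suc k)"
    using r by (simp add: ennreal_mult)
  finally show ?case .
qed

text \<open>A conditional second Borel-Cantelli lemma: missing \<open>x\<close> at the ends of all
  blocks from \<open>s\<close> on has probability at most \<open>(1 - r) ^ k\<close> for every
  \<open>k\<close>, hence 0, and the countably many \<open>s\<close> are then combined.\<close>

lemma AE_infinitely_often:
  fixes P :: "('v::countable) mdp"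
  assumes r: "0 < r" "r \<le> 1" and b: "0 < b"
    and hit: "\<And>s h. h \<in> set_pmf (history_pmf P \<sigma> v (b * s)) \<Longrightarrow>
      ennreal r \<le> emeasure (measure_pmf (extend_history P \<sigma> v b h)) {h'. last h' = x}"
  shows "AE \<omega> in play_measure P \<sigma> v. x \<in> inf_verts \<omega>"
proof -
  have ae: "AE \<omega> in play_measure P \<sigma> v. \<exists>j. \<omega> (b * (s + j) + b - 1) = x" for s
  proof -
    let ?A = "\<lambda>k. {h. \<forall>j<k. h ! (b * (s + j) + b - 1) \<noteq> x}"
    let ?E = "\<lambda>k. {\<omega>. map \<omega> [0..<b * (s + k)] \<in> ?A k}"
    let ?N = "\<Inter>k. ?E k"
    have nth: "map \<omega> [0..<b * (s + k)] ! (b * (s + j) + b - 1) = \<omega> (b * (s + j) + b - 1)"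
      if "j < k" for \<omega> :: "nat \<Rightarrow> 'v" and j k
    proof -
      have "b * (s + j) + b = b * (s + Suc j)" by (simp add: algebra_simps)
      also have "\<dots> \<le> b * (s + k)" using that by (intro mult_le_mono2) simp
      finally have "b * (s + j) + b - 1 < b * (s + k)" using b by simp
      then show ?thesis by simp
    qed
    have N: "?N \<in> sets (play_measure P \<sigma> v)"
      by (rule sets.countable_INT) (use prefix_event(1) in blast)+
    have "emeasure (play_measure P \<sigma> v) ?N \<le> ennreal ((1 - r) ^ k)" for k
    proof -
      have "emeasure (play_measure P \<sigma> v) ?N \<le> emeasure (play_measure P \<sigma> v) (?E k)"
        by (intro emeasure_mono prefix_event(1)) auto
      also have "\<dots> \<le> ennreal ((1 - r) ^ k)"
        unfolding prefix_event(2) by (rule emeasure_avoid_le) (use r b hit in auto)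
      finally show ?thesis .
    qed
    moreover have "(\<lambda>k. ennreal ((1 - r) ^ k)) \<longlonglongrightarrow> ennreal 0"
      using r by (intro tendsto_ennrealI LIMSEQ_realpow_zero) auto
    ultimately have "emeasure (play_measure P \<sigma> v) ?N \<le> 0"
      by (intro LIMSEQ_le_const[of "\<lambda>k. ennreal ((1 - r) ^ k)"]) auto
    then have "?N \<in> null_sets (play_measure P \<sigma> v)" using N by (simp add: null_sets_def)
    then have "AE \<omega> in play_measure P \<sigma> v. \<omega> \<notin> ?N" by (rule AE_not_in)
    then show ?thesis
    proof (rule AE_mp, intro AE_I2 impI)
      fix \<omega> :: "nat \<Rightarrow> 'v" assume "\<omega> \<notin> ?N"
      then obtain k j where "j < k" "map \<omega> [0..<b * (s + k)] ! (b * (s + j) + b - 1) = x" by blast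
      then show "\<exists>j. \<omega> (b * (s + j) + b - 1) = x" using nth by metis
    qed
  qed
  have "AE \<omega> in play_measure P \<sigma> v. \<forall>s. \<exists>j. \<omega> (b * (s + j) + b - 1) = x"
    using ae by (simp add: AE_all_countable)
  then show ?thesis
  proof (rule AE_mp, intro AE_I2 impI)
    fix \<omega> :: "nat \<Rightarrow> 'v" assume *: "\<forall>s. \<exists>j. \<omega> (b * (s + j) + b - 1) = x"
    have "\<exists>i\<ge>s. \<omega> i = x" for s
    proof -
      obtain j where j: "\<omega> (b * (s + j) + b - 1) = x" using * by blast
      have "s + j \<le> b * (s + j)" using b by simp
      then have "s \<le> b * (s + j) + b - 1" using b by linarith
      with j show ?thesis by blast
    qed
    then show "x \<in> inf_verts \<omega>"
      by (simp add: inf_verts_def infinite_nat_iff_unbounded_le)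
  qed
qed

section \<open>The MDP of an orthogonal vectors instance\<close>

text \<open>Rows of \<open>ub\<close> and \<open>vb\<close> are vectors. \<open>U i\<close>: vector \<open>i\<close> was chosen; \<open>C j b\<close>: coordinate \<open>j\<close> was
  drawn and \<open>b = ub i j\<close>; \<open>V l b\<close>: then \<open>l\<close> was chosen, and \<open>b\<close> tells whether \<open>i\<close> and \<open>l\<close> collide in \<open>j\<close>.
  \<open>z\<close> is \<open>False\<close> for Buechi, \<open>True\<close> for coBuechi and Rabin.\<close>

locale ov_instance =
  fixes d n1 n2 :: nat and ub vb :: "nat \<Rightarrow> nat \<Rightarrow> bool"
  assumes pos: "0 < d" "0 < n1" "0 < n2"
begin

text \<open>Vertices are numbered layer by layer, and the two vertices of one coordinate or of one
  \<open>l\<close> are neighbours that differ by the bit. A program can thus walk through a layer by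
  increments alone.\<close>

definition U :: "nat \<Rightarrow> nat" where "U i = Suc i"
definition C :: "nat \<Rightarrow> bool \<Rightarrow> nat" where "C j b = Suc n1 + 2 * j + of_bool b"
definition V :: "nat \<Rightarrow> bool \<Rightarrow> nat" where "V l b = Suc n1 + 2 * d + 2 * l + of_bool b"

definition orthogonal_pair :: bool where
  "orthogonal_pair \<longleftrightarrow> (\<exists>i<n1. \<exists>l<n2. \<forall>j<d. \<not> (ub i j \<and> vb l j))"

text \<open>A list in the order in which the program writes the edges. Since \<open>C j b\<close>
  keeps only a coordinate and a bit, a vector contributes just \<open>d\<close> edges from its
  \<open>U\<close> vertex, or \<open>2 * d\<close> edges into its \<open>V\<close> vertices.\<close>

definition edge_list :: "bool \<Rightarrow> (nat \<times> nat) list" where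
  "edge_list z =
     map (\<lambda>i. (0, U i)) [0..<n1] @
     concat (map (\<lambda>i. map (\<lambda>j. (U i, C j (ub i j))) [0..<d]) [0..<n1]) @
     concat (map (\<lambda>l. concat (map (\<lambda>j. [(C j False, V l False), (C j True, V l (vb l j))]) [0..<d])) [0..<n2]) @
     concat (map (\<lambda>l. [(V l False, if z then 0 else V l False), (V l True, if z then 0 else V l True)]) [0..<n2])"

text \<open>Each \<open>V l b\<close> has one successor; as a player-1 vertex it leaves by an edge
  that carries no probability in the code.\<close>

definition ov_mdp :: "bool \<Rightarrow> nat mdp" where
  "ov_mdp z = \<lparr>verts = {..<Suc n1 + 2 * d + 2 * n2},
     edges = set (edge_list z),
     player1 = {0} \<union> (if z then {} else {Suc n1..<Suc n1 + 2 * d}) \<union>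
       {Suc n1 + 2 * d..<Suc n1 + 2 * d + 2 * n2},
     random_verts = {1..<Suc n1} \<union> (if z then {Suc n1..<Suc n1 + 2 * d} else {}),
     trans_prob = (\<lambda>v. pmf_of_set {w. (v, w) \<in> set (edge_list z)})\<rparr>"

lemma vert_eq [simp]:
  "U i = U i' \<longleftrightarrow> i = i'" "C j b = C j' b' \<longleftrightarrow> j = j' \<and> b = b'" "V l b = V l' b' \<longleftrightarrow> l = l' \<and> b = b'"
  "U i \<noteq> 0" "C j b \<noteq> 0" "V l b \<noteq> 0"
  by (auto simp: U_def C_def V_def of_bool_def split: if_splits) presburger+

lemma vert_neq:
  "i < n1 \<Longrightarrow> U i \<noteq> C j b" "i < n1 \<Longrightarrow> U i \<noteq> V l b" "j < d \<Longrightarrow> C j b \<noteq> V l b'"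
  by (auto simp: U_def C_def V_def of_bool_def split: if_splits)

declare vert_neq [simp] vert_neq[symmetric, simp]

lemma edge_iff: "(x, y) \<in> set (edge_list z) \<longleftrightarrow>
    (\<exists>i<n1. x = 0 \<and> y = U i) \<or> (\<exists>i<n1. \<exists>j<d. x = U i \<and> y = C j (ub i j)) \<or>
    (\<exists>l<n2. \<exists>j<d. \<exists>b. x = C j b \<and> y = V l (b \<and> vb l j)) \<or>
    (\<exists>l<n2. \<exists>b. x = V l b \<and> y = (if z then 0 else x))"
  unfolding edge_list_def by (auto simp: Bex_def ex_bool_eq)

lemma edge_start: "(0, y) \<in> set (edge_list z) \<longleftrightarrow> (\<exists>i<n1. y = U i)"
  by (auto simp: edge_iff)

lemma edge_U: "i < n1 \<Longrightarrow> (U i, y) \<in> set (edge_list z) \<longleftrightarrow> (\<exists>j<d. y = C j (ub i j))"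
  by (auto simp: edge_iff)

lemma edge_C: "j < d \<Longrightarrow> (C j b, y) \<in> set (edge_list z) \<longleftrightarrow> (\<exists>l<n2. y = V l (b \<and> vb l j))"
  by (auto simp: edge_iff dest: vert_neq(1))

lemma edge_V: "l < n2 \<Longrightarrow> (V l b, y) \<in> set (edge_list z) \<longleftrightarrow> y = (if z then 0 else V l b)"
  by (auto simp: edge_iff)

lemma vert_cases:
  assumes "v < Suc n1 + 2 * d + 2 * n2"
  obtains "v = 0" | i where "i < n1" "v = U i" | j b where "j < d" "v = C j b" | l b where "l < n2" "v = V l b"
proof -
  consider "v = 0" | "1 \<le> v" "v < Suc n1" | "Suc n1 \<le> v" "v < Suc n1 + 2 * d" | "Suc n1 + 2 * d \<le> v"
    by linarith
  then show thesis
  proof cases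
    case 1 with that(1) show ?thesis .
  next
    case 2 then show ?thesis using that(2)[of "v - 1"] by (simp add: U_def)
  next
    case 3
    define k where "k = v - Suc n1"
    have "v = C (k div 2) (odd k)" using 3
      by (simp add: C_def k_def of_bool_def) presburger
    moreover have "k div 2 < d" using 3 by (simp add: k_def less_mult_imp_div_less)
    ultimately show ?thesis using that(3) by blast
  next
    case 4
    define k where "k = v - (Suc n1 + 2 * d)"
    have "v = V (k div 2) (odd k)" using 4
      by (simp add: V_def k_def of_bool_def) presburger
    moreover have "k div 2 < n2" using 4 assms by (simp add: k_def less_mult_imp_div_less)
    ultimately show ?thesis using that(4) by blast
  qed
qed

lemma player1_iff:
  "0 \<in> player1 (ov_mdp z)" "i < n1 \<Longrightarrow> U i \<notin> player1 (ov_mdp z)"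
  "j < d \<Longrightarrow> C j b \<in> player1 (ov_mdp z) \<longleftrightarrow> \<not> z" "l < n2 \<Longrightarrow> V l b \<in> player1 (ov_mdp z)"
  by (auto simp: ov_mdp_def U_def C_def V_def)

lemma random_iff:
  "0 \<notin> random_verts (ov_mdp z)" "i < n1 \<Longrightarrow> U i \<in> random_verts (ov_mdp z)"
  "j < d \<Longrightarrow> C j b \<in> random_verts (ov_mdp z) \<longleftrightarrow> z" "l < n2 \<Longrightarrow> V l b \<notin> random_verts (ov_mdp z)"
  by (auto simp: ov_mdp_def U_def C_def V_def)

lemma in_verts:
  "0 \<in> verts (ov_mdp z)" "i < n1 \<Longrightarrow> U i \<in> verts (ov_mdp z)"
  "j < d \<Longrightarrow> C j b \<in> verts (ov_mdp z)" "l < n2 \<Longrightarrow> V l b \<in> verts (ov_mdp z)"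
  by (auto simp: ov_mdp_def U_def C_def V_def of_bool_def)

lemma edges_ov_mdp [simp]: "edges (ov_mdp z) = set (edge_list z)"
  by (simp add: ov_mdp_def)

lemma finite_succ: "finite {w. (v, w) \<in> set (edge_list z)}"
  by (rule finite_subset[of _ "snd ` set (edge_list z)"]) force+

lemma succ_exists:
  assumes "v \<in> verts (ov_mdp z)" shows "\<exists>w. (v, w) \<in> set (edge_list z)"
proof -
  from assms have "v < Suc n1 + 2 * d + 2 * n2" by (simp add: ov_mdp_def)
  then show ?thesis
    using pos by (cases rule: vert_cases) (auto simp: edge_start edge_U edge_C edge_V)
qed

lemma is_mdp_ov: "is_mdp (ov_mdp z)"
  unfolding is_mdp_def
proof (intro conjI ballI)
  show "edges (ov_mdp z) \<subseteq> verts (ov_mdp z) \<times> verts (ov_mdp z)"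
    using in_verts by (auto simp: edge_iff split: if_splits)
  show "\<exists>w. (v, w) \<in> edges (ov_mdp z)" if "v \<in> verts (ov_mdp z)" for v
    using succ_exists[OF that] by simp
  show "set_pmf (trans_prob (ov_mdp z) v) = {w. (v, w) \<in> edges (ov_mdp z)}"
    if "v \<in> random_verts (ov_mdp z)" for v
  proof -
    have "v \<in> verts (ov_mdp z)" using that by (auto simp: ov_mdp_def split: if_splits)
    from succ_exists[OF this] finite_succ[of v z] show ?thesis
      by (simp add: ov_mdp_def set_pmf_of_set Collect_empty_eq)
  qed
qed (auto simp: ov_mdp_def)

lemma trans_prob_U: "i < n1 \<Longrightarrow> j < d \<Longrightarrow> pmf (trans_prob (ov_mdp z) (U i)) (C j (ub i j)) = 1 / real d"
proof -
  assume i: "i < n1" and j: "j < d"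
  have eq: "{w. (U i, w) \<in> set (edge_list z)} = (\<lambda>j. C j (ub i j)) ` {..<d}"
    using edge_U[OF i] by auto
  have "card ((\<lambda>j. C j (ub i j)) ` {..<d}) = d"
    by (subst card_image) (auto simp: inj_on_def)
  then show ?thesis using j pos by (simp add: ov_mdp_def eq pmf_of_set lessThan_empty_iff indicator_def)
qed

lemma trans_prob_C: "j < d \<Longrightarrow> l < n2 \<Longrightarrow>
    pmf (trans_prob (ov_mdp z) (C j b)) (V l (b \<and> vb l j)) = 1 / real n2"
proof -
  assume j: "j < d" and l: "l < n2"
  have eq: "{w. (C j b, w) \<in> set (edge_list z)} = (\<lambda>l. V l (b \<and> vb l j)) ` {..<n2}"
    using edge_C[OF j] by auto
  have "card ((\<lambda>l. V l (b \<and> vb l j)) ` {..<n2}) = n2"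
    by (subst card_image) (auto simp: inj_on_def)
  then show ?thesis using l pos by (simp add: ov_mdp_def eq pmf_of_set lessThan_empty_iff indicator_def)
qed

end

lemma AE_play_edges:
  fixes P :: "('v::countable) mdp"
  assumes "is_mdp P" "strategy P \<sigma>" "v \<in> verts P"
  shows "AE \<omega> in play_measure P \<sigma> v. \<omega> 0 = v \<and> (\<forall>t. (\<omega> t, \<omega> (Suc t)) \<in> edges P) \<and>
    (\<forall>t. \<omega> t \<in> player1 P \<longrightarrow> \<omega> (Suc t) = \<sigma> (map \<omega> [0..<Suc t]))"
proof (rule AE_mp[OF AE_play_step], intro AE_I2 impI)
  fix \<omega> :: "nat \<Rightarrow> 'v"
  assume *: "\<omega> 0 = v \<and> (\<forall>t. \<omega> (Suc t) \<in> set_pmf (next_vertex P \<sigma> (map \<omega> [0..<Suc t])))"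
  then have next_in: "\<omega> (Suc t) \<in> set_pmf (next_vertex P \<sigma> (map \<omega> [0..<Suc t]))" for t by blast
  have pl: "\<omega> (Suc t) = \<sigma> (map \<omega> [0..<Suc t])" if "\<omega> t \<in> player1 P" for t
    using next_in[of t] that by (simp add: next_vertex_def)
  \<comment> \<open>\<open>strategy\<close> restricts only histories inside \<open>verts P\<close>,
    so an edge is first obtained under that condition; \<open>verts\<close> below discharges it by
    induction along the play.\<close>
  have edge: "(\<omega> t, \<omega> (Suc t)) \<in> edges P" if "set (map \<omega> [0..<Suc t]) \<subseteq> verts P" for t
  proof (cases "\<omega> t \<in> player1 P")
    case True
    have "(\<omega> t, \<sigma> (map \<omega> [0..<t] @ [\<omega> t])) \<in> edges P"
      using assms(2) True that unfolding strategy_def by auto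
    then show ?thesis using pl[OF True] by simp
  next
    case False
    have "\<omega> t \<in> verts P" using that by auto
    with False assms(1) have "\<omega> t \<in> random_verts P" by (auto simp: is_mdp_def)
    then have "set_pmf (trans_prob P (\<omega> t)) = {w. (\<omega> t, w) \<in> edges P}"
      using assms(1) by (simp add: is_mdp_def)
    then show ?thesis using next_in[of t] False by (simp add: next_vertex_def)
  qed
  have verts: "set (map \<omega> [0..<Suc t]) \<subseteq> verts P" for t
  proof (induction t)
    case 0
    show ?case using * assms(3) by simp
  next
    case (Suc t)
    have "\<omega> (Suc t) \<in> verts P" using edge[OF Suc] assms(1) by (auto simp: is_mdp_def)
    with Suc show ?case by simp
  qed
  show "\<omega> 0 = v \<and> (\<forall>t. (\<omega> t, \<omega> (Suc t)) \<in> edges P) \<and>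
    (\<forall>t. \<omega> t \<in> player1 P \<longrightarrow> \<omega> (Suc t) = \<sigma> (map \<omega> [0..<Suc t]))"
    using * pl edge[OF verts] by blast
qed

lemma almost_sure_win_mono: "\<psi> \<subseteq> \<psi>' \<Longrightarrow> almost_sure_win P \<psi> \<subseteq> almost_sure_win P \<psi>'"
  by (auto simp: almost_sure_win_def intro!: exI conjI elim!: eventually_mono)

section \<open>Orthogonal pairs and almost-sure winning from the start vertex\<close>

context ov_instance
begin

abbreviation plays :: "bool \<Rightarrow> (nat list \<Rightarrow> nat) \<Rightarrow> (nat \<Rightarrow> nat) measure" where
  "plays z \<sigma> \<equiv> play_measure (ov_mdp z) \<sigma> 0"

text \<open>For \<open>z = True\<close> the layers \<open>0\<close>, \<open>U\<close>,
  \<open>C\<close>, \<open>V\<close> are passed cyclically, so a round has length 4.\<close>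

lemma round_trip:
  assumes "\<omega> 0 = 0" "\<And>t. (\<omega> t, \<omega> (Suc t)) \<in> set (edge_list True)"
  shows "\<omega> (4 * s) = 0 \<and> (\<exists>l<n2. \<exists>b. \<omega> (4 * s + 3) = V l b)"
proof -
  have step: "\<omega> (t + 4) = 0 \<and> (\<exists>l<n2. \<exists>b. \<omega> (t + 3) = V l b)" if "\<omega> t = 0" for t
  proof -
    have e: "(\<omega> t, \<omega> (t + 1)) \<in> set (edge_list True)" "(\<omega> (t + 1), \<omega> (t + 2)) \<in> set (edge_list True)"
      "(\<omega> (t + 2), \<omega> (t + 3)) \<in> set (edge_list True)" "(\<omega> (t + 3), \<omega> (t + 4)) \<in> set (edge_list True)"
      using assms(2)[of t] assms(2)[of "t + 1"] assms(2)[of "t + 2"] assms(2)[of "t + 3"]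
      by (simp_all add: eval_nat_numeral)
    from e(1) that obtain i where "i < n1" "\<omega> (t + 1) = U i" by (auto simp: edge_start)
    with e(2) obtain j b where "j < d" "\<omega> (t + 2) = C j b" by (auto simp: edge_U)
    with e(3) obtain l b' where "l < n2" "\<omega> (t + 3) = V l b'" by (auto simp: edge_C)
    with e(4) show ?thesis by (auto simp: edge_V)
  qed
  have "\<omega> (4 * s) = 0"
  proof (induction s)
    case (Suc s) then show ?case using step[of "4 * s"] by (simp add: algebra_simps)
  qed (simp add: assms)
  then show ?thesis using step by blast
qed

text \<open>Whatever \<open>U i\<close> the strategy picks in a round, without an orthogonal pair
  some coordinate \<open>j\<close> makes \<open>u\<close> number \<open>i\<close> collide with
  \<open>v\<close> number \<open>l\<close>. Chance draws this \<open>j\<close> and then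
  \<open>l\<close> with probability \<open>1 / d * (1 / n2)\<close>, a bound that does not depend on
  the past.\<close>

lemma hits_all_targets:
  assumes no: "\<not> orthogonal_pair" and \<sigma>: "strategy (ov_mdp True) \<sigma>" and l: "l < n2"
  shows "AE \<omega> in plays True \<sigma>. V l True \<in> inf_verts \<omega>"
proof (rule AE_infinitely_often[where b = 4 and r = "1 / real d * (1 / real n2)"])
  show "0 < 1 / real d * (1 / real n2)" using pos by simp
  have "1 / real d * (1 / real n2) \<le> 1 * 1" using pos by (intro mult_mono) auto
  then show "1 / real d * (1 / real n2) \<le> 1" by simp
  fix s h assume h: "h \<in> set_pmf (history_pmf (ov_mdp True) \<sigma> 0 (4 * s))"
  \<comment> \<open>A play through \<open>h\<close> shows that \<open>h\<close> stays among the
    vertices and, unless empty, ends in the layer \<open>V\<close>, so that the next vertex is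
    0.\<close>
  from AE_realises_history[OF h AE_play_edges[OF is_mdp_ov \<sigma> in_verts(1)]]
  obtain \<omega> where \<omega>: "map \<omega> [0..<4 * s] = h" "\<omega> 0 = 0" "\<And>t. (\<omega> t, \<omega> (Suc t)) \<in> set (edge_list True)"
    by auto
  have verts: "\<omega> t \<in> verts (ov_mdp True)" for t
    using \<omega>(3)[of t] is_mdp_ov[of True] by (auto simp: is_mdp_def)
  then have h_verts: "set h \<subseteq> verts (ov_mdp True)" using \<omega>(1) by auto
  let ?step = "history_step (ov_mdp True) \<sigma> 0"
  have s0: "?step h = return_pmf 0"
  proof (cases s)
    case 0 then show ?thesis using \<omega>(1) by (auto simp: history_step_def)
  next
    case (Suc s')
    from round_trip[OF \<omega>(2,3), of s'] obtain l' b where l': "l' < n2" "\<omega> (4 * s' + 3) = V l' b" by auto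
    have h_eq: "h = map \<omega> [0..<4 * s' + 3] @ [V l' b]"
      using \<omega>(1) Suc l'(2) by (auto simp: eval_nat_numeral)
    have "(V l' b, \<sigma> (map \<omega> [0..<4 * s' + 3] @ [V l' b])) \<in> edges (ov_mdp True)"
    proof -
      have "set (map \<omega> [0..<4 * s' + 3]) \<subseteq> verts (ov_mdp True)" using verts by auto
      with \<sigma> player1_iff(4)[OF l'(1), of b True] show ?thesis unfolding strategy_def by blast
    qed
    then have "\<sigma> h = 0" using edge_V[OF l'(1)] h_eq by simp
    then show ?thesis using h_eq player1_iff(4)[OF l'(1), of b True]
      by (simp add: history_step_def next_vertex_def)
  qed
  have "(0, \<sigma> (h @ [0])) \<in> edges (ov_mdp True)"
    using \<sigma> player1_iff(1) h_verts unfolding strategy_def by auto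
  then obtain i where i: "i < n1" "\<sigma> (h @ [0]) = U i" by (auto simp: edge_start)
  have s1: "?step (h @ [0]) = return_pmf (U i)"
    using i player1_iff(1) by (simp add: history_step_def next_vertex_def)
  have s2: "?step (h @ [0, U i]) = trans_prob (ov_mdp True) (U i)"
    using player1_iff(2)[OF i(1)] by (simp add: history_step_def next_vertex_def)
  \<comment> \<open>The coordinate may change with \<open>i\<close>, hence with the strategy and the
    history; its probability does not.\<close>
  from no i l obtain j where j: "j < d" "ub i j" "vb l j" by (auto simp: orthogonal_pair_def)
  have s3: "?step (h @ [0, U i, C j True]) = trans_prob (ov_mdp True) (C j True)"
    using player1_iff(3)[OF j(1)] by (simp add: history_step_def next_vertex_def)
  have p2: "pmf (trans_prob (ov_mdp True) (U i)) (C j True) = 1 / real d"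
    using trans_prob_U[OF i(1) j(1)] j by simp
  have p3: "pmf (trans_prob (ov_mdp True) (C j True)) (V l True) = 1 / real n2"
    using trans_prob_C[OF j(1) l, of True True] j by simp
  let ?A = "{h'. last h' = V l True}"
  let ?ext = "extend_history (ov_mdp True) \<sigma> 0"
  have e3: "emeasure (measure_pmf (?ext 1 (h @ [0, U i, C j True]))) ?A \<ge> ennreal (1 / real n2)"
    using emeasure_bind_pmf_ge[of "trans_prob (ov_mdp True) (C j True)" "V l True"
        "\<lambda>x. return_pmf (h @ [0, U i, C j True, x])" ?A]
    by (simp add: s3 p3)
  have e2: "emeasure (measure_pmf (?ext 2 (h @ [0, U i]))) ?A
      \<ge> ennreal (1 / real d) * emeasure (measure_pmf (?ext 1 (h @ [0, U i, C j True]))) ?A"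
    using emeasure_bind_pmf_ge[of "trans_prob (ov_mdp True) (U i)" "C j True"
        "\<lambda>x. ?ext 1 (h @ [0, U i, x])" ?A]
    by (simp add: s2 p2 numeral_2_eq_2)
  have "?ext 4 h = ?ext 2 (h @ [0, U i])"
    using s1 by (simp add: s0 eval_nat_numeral bind_return_pmf)
  then have "emeasure (measure_pmf (?ext 4 h)) ?A
      \<ge> ennreal (1 / real d) * emeasure (measure_pmf (?ext 1 (h @ [0, U i, C j True]))) ?A"
    using e2 by simp
  moreover have "ennreal (1 / real d) * ennreal (1 / real n2)
      \<le> ennreal (1 / real d) * emeasure (measure_pmf (?ext 1 (h @ [0, U i, C j True]))) ?A"
    by (rule mult_left_mono[OF e3]) simp
  ultimately show "ennreal (1 / real d * (1 / real n2)) \<le> emeasure (measure_pmf (?ext 4 h)) ?A"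
    by (subst ennreal_mult) auto
qed simp

lemma not_all_targets:
  assumes no: "\<not> orthogonal_pair" and \<sigma>: "strategy (ov_mdp True) \<sigma>"
    and win: "AE \<omega> in plays True \<sigma>. \<exists>l<n2. V l True \<notin> inf_verts \<omega>"
  shows False
proof -
  interpret prob_space "plays True \<sigma>" by (rule prob_space_play_measure)
  have "AE \<omega> in plays True \<sigma>. \<forall>l\<in>{..<n2}. V l True \<in> inf_verts \<omega>"
    using hits_all_targets[OF no \<sigma>] by (intro AE_finite_allI) auto
  with win have "AE \<omega> in plays True \<sigma>. False"
    by eventually_elim auto
  then show False by simp
qed

text \<open>The memoryless strategy always picks \<open>U i\<close>. The visits to 0 are recorded
  because 0 is the set \<open>L\<close> of every Rabin pair used below.\<close>

lemma avoid_target: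
  assumes i: "i < n1" and l: "l < n2" and orth: "\<And>j. j < d \<Longrightarrow> \<not> (ub i j \<and> vb l j)"
  shows "\<exists>\<sigma>. strategy (ov_mdp True) \<sigma> \<and>
    (AE \<omega> in plays True \<sigma>. V l True \<notin> inf_verts \<omega> \<and> 0 \<in> inf_verts \<omega>)"
proof -
  define \<sigma> where "\<sigma> h = (if last h = 0 then U i else 0)" for h :: "nat list"
  have \<sigma>: "strategy (ov_mdp True) \<sigma>"
    unfolding strategy_def
  proof (intro allI impI ballI)
    fix h :: "nat list" and v assume v: "v \<in> player1 (ov_mdp True)"
    then have "v < Suc n1 + 2 * d + 2 * n2" by (auto simp: ov_mdp_def)
    then show "(v, \<sigma> (h @ [v])) \<in> edges (ov_mdp True)"
      using v i by (cases rule: vert_cases)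
        (auto simp: \<sigma>_def edge_start edge_V player1_iff)
  qed
  have "AE \<omega> in plays True \<sigma>. V l True \<notin> inf_verts \<omega> \<and> 0 \<in> inf_verts \<omega>"
  proof (rule AE_mp[OF AE_play_edges[OF is_mdp_ov \<sigma> in_verts(1)]], intro AE_I2 impI)
    fix \<omega> :: "nat \<Rightarrow> nat"
    assume "\<omega> 0 = 0 \<and> (\<forall>t. (\<omega> t, \<omega> (Suc t)) \<in> edges (ov_mdp True)) \<and>
      (\<forall>t. \<omega> t \<in> player1 (ov_mdp True) \<longrightarrow> \<omega> (Suc t) = \<sigma> (map \<omega> [0..<Suc t]))"
    then have \<omega>: "\<omega> 0 = 0" "\<And>t. (\<omega> t, \<omega> (Suc t)) \<in> set (edge_list True)"
      "\<And>t. \<omega> t = 0 \<Longrightarrow> \<omega> (Suc t) = U i"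
      using player1_iff(1) by (auto simp: \<sigma>_def)
    \<comment> \<open>A set closed under the moves of this strategy: \<open>V l True\<close> is
      entered only from some \<open>C j True\<close> with \<open>vb l j\<close>, and orthogonality
      excludes these \<open>j\<close>.\<close>
    define S where "S = {0, U i} \<union> {C j (ub i j) | j. j < d} \<union> {V l' b | l' b. l' < n2 \<and> (l', b) \<noteq> (l, True)}"
    have "\<omega> t \<in> S" for t
    proof (induction t)
      case 0 then show ?case using \<omega>(1) by (simp add: S_def)
    next
      case (Suc t)
      then consider "\<omega> t = 0" | "\<omega> t = U i" | j where "j < d" "\<omega> t = C j (ub i j)"
        | l' b where "l' < n2" "\<omega> t = V l' b"
        by (auto simp: S_def)
      then show ?case
      proof cases
        case 1 then show ?thesis using \<omega>(3) by (simp add: S_def)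
      next
        case 2 then show ?thesis using \<omega>(2)[of t] edge_U[OF i] by (auto simp: S_def)
      next
        case 3 then show ?thesis using \<omega>(2)[of t] edge_C[OF 3(1)] orth[OF 3(1)] by (auto simp: S_def)
      next
        case 4 then show ?thesis using \<omega>(2)[of t] edge_V[OF 4(1)] by (auto simp: S_def)
      qed
    qed
    moreover have "V l True \<notin> S" using i by (auto simp: S_def)
    ultimately have "\<omega> t \<noteq> V l True" for t by metis
    then have "{t. \<omega> t = V l True} = {}" by simp
    then have "V l True \<notin> inf_verts \<omega>" by (simp add: inf_verts_def)
    moreover have "\<exists>t\<ge>m. \<omega> t = 0" for m
      using round_trip[OF \<omega>(1,2), of m] by (intro exI[of _ "4 * m"]) simp
    then have "0 \<in> inf_verts \<omega>" by (simp add: inf_verts_def infinite_nat_iff_unbounded_le)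
    ultimately show "V l True \<notin> inf_verts \<omega> \<and> 0 \<in> inf_verts \<omega>" by blast
  qed
  with \<sigma> show ?thesis by blast
qed

text \<open>Singletons, so that the same instances serve the general and the singleton
  problems.\<close>

definition cobuechi_targets :: "nat set list" where
  "cobuechi_targets = map (\<lambda>l. {V l True}) [0..<n2]"

definition buechi_targets :: "nat set list" where
  "buechi_targets = map (\<lambda>l. {V l False}) [0..<n2]"

definition rabin_targets :: "(nat set \<times> nat set) list" where
  "rabin_targets = map (\<lambda>l. ({0}, {V l True})) [0..<n2]"

text \<open>The direction shared by the coBuechi objective, the coBuechi query and the Rabin
  objective: none of them holds on a play that visits every \<open>V l True\<close> infinitely
  often.\<close>

lemma orthogonal_pair_if_win:
  assumes "0 \<in> almost_sure_win (ov_mdp True) \<psi>" "\<And>\<omega>. \<omega> \<in> \<psi> \<Longrightarrow> \<exists>l<n2. V l True \<notin> inf_verts \<omega>"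
  shows orthogonal_pair
proof -
  from assms(1) obtain \<sigma> where \<sigma>: "strategy (ov_mdp True) \<sigma>"
    "AE \<omega> in plays True \<sigma>. \<omega> \<in> \<psi>" by (auto simp: almost_sure_win_def)
  have "AE \<omega> in plays True \<sigma>. \<exists>l<n2. V l True \<notin> inf_verts \<omega>"
    using \<sigma>(2) by eventually_elim (rule assms(2))
  with not_all_targets \<sigma>(1) show orthogonal_pair by blast
qed

lemma win_if_orthogonal_pair:
  assumes orthogonal_pair
  obtains l where "l < n2"
    "0 \<in> almost_sure_win (ov_mdp True) {\<omega>. V l True \<notin> inf_verts \<omega> \<and> 0 \<in> inf_verts \<omega>}"
proof -
  from assms obtain i l where il: "i < n1" "l < n2" "\<And>j. j < d \<Longrightarrow> \<not> (ub i j \<and> vb l j)"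
    by (auto simp: orthogonal_pair_def)
  from that[OF il(2)] avoid_target[OF il] in_verts(1) show thesis by (simp add: almost_sure_win_def)
qed

lemma cobuechi_objective_iff:
  "0 \<in> disjunctive_objective cobuechi (ov_mdp True) cobuechi_targets \<longleftrightarrow> orthogonal_pair"
proof
  assume "0 \<in> disjunctive_objective cobuechi (ov_mdp True) cobuechi_targets"
  then show orthogonal_pair unfolding disjunctive_objective_def
    by (rule orthogonal_pair_if_win) (auto simp: cobuechi_targets_def cobuechi_def)
next
  assume orthogonal_pair
  then obtain l where l: "l < n2"
    "0 \<in> almost_sure_win (ov_mdp True) {\<omega>. V l True \<notin> inf_verts \<omega> \<and> 0 \<in> inf_verts \<omega>}"
    by (rule win_if_orthogonal_pair)
  have "{\<omega>. V l True \<notin> inf_verts \<omega> \<and> 0 \<in> inf_verts \<omega>} \<subseteq> (\<Union>t\<in>set cobuechi_targets. cobuechi t)"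
    using l(1) by (auto simp: cobuechi_targets_def cobuechi_def)
  from almost_sure_win_mono[OF this] l(2)
  show "0 \<in> disjunctive_objective cobuechi (ov_mdp True) cobuechi_targets"
    unfolding disjunctive_objective_def by blast
qed

lemma cobuechi_query_iff:
  "0 \<in> disjunctive_query cobuechi (ov_mdp True) cobuechi_targets \<longleftrightarrow> orthogonal_pair"
proof
  assume "0 \<in> disjunctive_query cobuechi (ov_mdp True) cobuechi_targets"
  then obtain l where l: "l < n2" "0 \<in> almost_sure_win (ov_mdp True) (cobuechi {V l True})"
    by (auto simp: disjunctive_query_def cobuechi_targets_def)
  from l(2) show orthogonal_pair
    by (rule orthogonal_pair_if_win) (use l(1) in \<open>auto simp: cobuechi_def\<close>)
next
  assume orthogonal_pair
  then obtain l where l: "l < n2"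
    "0 \<in> almost_sure_win (ov_mdp True) {\<omega>. V l True \<notin> inf_verts \<omega> \<and> 0 \<in> inf_verts \<omega>}"
    by (rule win_if_orthogonal_pair)
  have "{\<omega>. V l True \<notin> inf_verts \<omega> \<and> 0 \<in> inf_verts \<omega>} \<subseteq> cobuechi {V l True}"
    by (auto simp: cobuechi_def)
  from almost_sure_win_mono[OF this] l(2)
  have "0 \<in> almost_sure_win (ov_mdp True) (cobuechi {V l True})" by blast
  with l(1) show "0 \<in> disjunctive_query cobuechi (ov_mdp True) cobuechi_targets"
    by (auto simp: disjunctive_query_def cobuechi_targets_def)
qed

lemma rabin_iff: "0 \<in> almost_sure_win (ov_mdp True) (rabin rabin_targets) \<longleftrightarrow> orthogonal_pair"
proof
  assume "0 \<in> almost_sure_win (ov_mdp True) (rabin rabin_targets)"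
  then show orthogonal_pair
    by (rule orthogonal_pair_if_win) (auto simp: rabin_targets_def rabin_def)
next
  assume orthogonal_pair
  then obtain l where l: "l < n2"
    "0 \<in> almost_sure_win (ov_mdp True) {\<omega>. V l True \<notin> inf_verts \<omega> \<and> 0 \<in> inf_verts \<omega>}"
    by (rule win_if_orthogonal_pair)
  have "{\<omega>. V l True \<notin> inf_verts \<omega> \<and> 0 \<in> inf_verts \<omega>} \<subseteq> rabin rabin_targets"
    using l(1) by (auto simp: rabin_targets_def rabin_def)
  from almost_sure_win_mono[OF this] l(2)
  show "0 \<in> almost_sure_win (ov_mdp True) (rabin rabin_targets)" by blast
qed

text \<open>With \<open>z = False\<close> a play has a single random step and then stays in some
  \<open>V l b\<close>. A query fixes \<open>l\<close> in advance, so player 1 cannot adapt it to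
  the drawn coordinate, and no coordinate that can follow the first choice \<open>U i\<close> may
  collide with \<open>l\<close>.\<close>

lemma buechi_query_iff:
  "0 \<in> disjunctive_query buechi (ov_mdp False) buechi_targets \<longleftrightarrow> orthogonal_pair"
proof
  assume "0 \<in> disjunctive_query buechi (ov_mdp False) buechi_targets"
  then obtain \<sigma> l where \<sigma>: "strategy (ov_mdp False) \<sigma>" "l < n2"
    "AE \<omega> in plays False \<sigma>. \<omega> \<in> buechi {V l False}"
    by (auto simp: disjunctive_query_def almost_sure_win_def buechi_targets_def)
  \<comment> \<open>The first move is made on the fixed history \<open>[0]\<close>, so a single
    \<open>i\<close> serves all plays of this strategy.\<close>
  have "(0, \<sigma> ([] @ [0])) \<in> edges (ov_mdp False)"
    using \<sigma>(1) player1_iff(1) unfolding strategy_def by (metis empty_set empty_subsetI)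
  then obtain i where i: "i < n1" "\<sigma> [0] = U i" by (auto simp: edge_start)
  have "\<not> (ub i j \<and> vb l j)" if j: "j < d" for j
  proof
    assume b: "ub i j \<and> vb l j"
    have "set_pmf (trans_prob (ov_mdp False) (U i)) = {w. (U i, w) \<in> edges (ov_mdp False)}"
      using is_mdp_ov[of False] random_iff(2)[OF i(1), of False] by (simp add: is_mdp_def)
    then have "C j True \<in> set_pmf (trans_prob (ov_mdp False) (U i))"
      using edge_U[OF i(1)] j b by auto
    then have h: "[0, U i, C j True] \<in> set_pmf (history_pmf (ov_mdp False) \<sigma> 0 3)"
      using i player1_iff(1,2)
      by (simp add: history_pmf_def eval_nat_numeral history_step_def next_vertex_def bind_return_pmf)
    from AE_realises_history[OF h AE_conjI[OF AE_play_edges[OF is_mdp_ov \<sigma>(1) in_verts(1)] \<sigma>(3)]]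
    obtain \<omega> where \<omega>: "map \<omega> [0..<3] = [0, U i, C j True]" "\<And>t. (\<omega> t, \<omega> (Suc t)) \<in> set (edge_list False)"
      "\<omega> \<in> buechi {V l False}" by auto
    have "\<omega> 2 = C j True" using \<omega>(1) by (simp add: eval_nat_numeral)
    with \<omega>(2)[of 2] edge_C[OF j] obtain l' where l': "l' < n2" "\<omega> 3 = V l' (vb l' j)"
      by (auto simp: eval_nat_numeral)
    \<comment> \<open>If \<open>l' = l\<close>, the play is trapped in \<open>V l True\<close>
      because of the collision; otherwise it is trapped in a vertex of another index. Either way
      \<open>V l False\<close> is not visited again.\<close>
    have const: "\<omega> (3 + t) = V l' (vb l' j)" for t
    proof (induction t)
      case (Suc t) then show ?case using \<omega>(2)[of "3 + t"] edge_V[OF l'(1)] by simp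
    qed (simp add: l')
    from \<omega>(3) have "infinite {t. \<omega> t = V l False}" by (auto simp: buechi_def inf_verts_def)
    then obtain t where "3 \<le> t" "\<omega> t = V l False"
      by (auto simp: infinite_nat_iff_unbounded_le)
    with const[of "t - 3"] b show False by auto
  qed
  with i(1) \<sigma>(2) show orthogonal_pair by (auto simp: orthogonal_pair_def)
next
  assume orthogonal_pair
  then obtain i l where i: "i < n1" and l: "l < n2" and orth: "\<And>j. j < d \<Longrightarrow> \<not> (ub i j \<and> vb l j)"
    by (auto simp: orthogonal_pair_def)
  \<comment> \<open>The number of a \<open>C\<close> vertex is decoded: its offset from
    \<open>Suc n1\<close> has the bit as parity and the coordinate as half. From there the strategy
    goes to the \<open>V\<close> vertex of the fixed \<open>l\<close>.\<close>
  define \<sigma> where "\<sigma> h = (let x = last h in if x = 0 then U i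
      else if x < Suc n1 + 2 * d then V l (odd (x - Suc n1) \<and> vb l ((x - Suc n1) div 2)) else x)"
    for h :: "nat list"
  have \<sigma>_C: "\<sigma> (h @ [C j b]) = V l (b \<and> vb l j)" if "j < d" for h j b
    using that by (cases b) (auto simp: \<sigma>_def C_def)
  have \<sigma>_V: "\<sigma> (h @ [V l' b]) = V l' b" for h l' b
    by (simp add: \<sigma>_def V_def)
  have \<sigma>: "strategy (ov_mdp False) \<sigma>"
    unfolding strategy_def
  proof (intro allI impI ballI)
    fix h :: "nat list" and v assume v: "v \<in> player1 (ov_mdp False)"
    then have "v < Suc n1 + 2 * d + 2 * n2" by (auto simp: ov_mdp_def)
    then show "(v, \<sigma> (h @ [v])) \<in> edges (ov_mdp False)"
    proof (cases rule: vert_cases)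
      case 1 then show ?thesis using i by (simp add: \<sigma>_def edge_start)
    next
      case (2 i') then show ?thesis using v player1_iff(2) by simp
    next
      case (3 j b) then show ?thesis using l by (auto simp: \<sigma>_C edge_C)
    next
      case (4 l' b) then show ?thesis by (simp add: \<sigma>_V edge_V)
    qed
  qed
  have "AE \<omega> in plays False \<sigma>. \<omega> \<in> buechi {V l False}"
  proof (rule AE_mp[OF AE_play_edges[OF is_mdp_ov \<sigma> in_verts(1)]], intro AE_I2 impI)
    fix \<omega> :: "nat \<Rightarrow> nat"
    assume "\<omega> 0 = 0 \<and> (\<forall>t. (\<omega> t, \<omega> (Suc t)) \<in> edges (ov_mdp False)) \<and>
      (\<forall>t. \<omega> t \<in> player1 (ov_mdp False) \<longrightarrow> \<omega> (Suc t) = \<sigma> (map \<omega> [0..<Suc t]))"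
    then have \<omega>: "\<omega> 0 = 0" "\<And>t. (\<omega> t, \<omega> (Suc t)) \<in> set (edge_list False)"
      "\<And>t. \<omega> t \<in> player1 (ov_mdp False) \<Longrightarrow> \<omega> (Suc t) = \<sigma> (map \<omega> [0..<t] @ [\<omega> t])"
      by auto
    have "\<omega> 1 = U i" using \<omega>(3)[of 0] \<omega>(1) player1_iff(1) by (simp add: \<sigma>_def)
    with \<omega>(2)[of 1] edge_U[OF i] obtain j where j: "j < d" "\<omega> 2 = C j (ub i j)"
      by (auto simp: eval_nat_numeral)
    have "\<omega> 3 = V l (ub i j \<and> vb l j)"
      using \<omega>(3)[of 2] j player1_iff(3)[OF j(1), of "ub i j" False]
        \<sigma>_C[OF j(1), of "map \<omega> [0..<2]" "ub i j"]
      by (simp add: numeral_3_eq_3 numeral_2_eq_2)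
    with orth[OF j(1)] have 3: "\<omega> 3 = V l False" by simp
    have "\<omega> (3 + t) = V l False" for t
    proof (induction t)
      case (Suc t) then show ?case using \<omega>(2)[of "3 + t"] edge_V[OF l] by simp
    qed (simp add: 3)
    then have "\<exists>t\<ge>m. \<omega> t = V l False" for m by (intro exI[of _ "3 + m"]) simp
    then show "\<omega> \<in> buechi {V l False}"
      by (simp add: buechi_def inf_verts_def infinite_nat_iff_unbounded_le)
  qed
  with \<sigma> in_verts(1) have "0 \<in> almost_sure_win (ov_mdp False) (buechi {V l False})"
    by (auto simp: almost_sure_win_def)
  with l show "0 \<in> disjunctive_query buechi (ov_mdp False) buechi_targets"
    by (auto simp: disjunctive_query_def buechi_targets_def)
qed

end

section \<open>The program that writes the MDP\<close>

definition emit :: "nat \<Rightarrow> com" where "emit r = Seq (Store 50 3 r) (inc 3)"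

text \<open>Register 0 holds 0, register 1 holds 1, register 2 is the reading position in array \<open>A\<close>,
  and register 3 the writing position in array 50.\<close>

definition header_prog :: "nat \<Rightarrow> com" where
  "header_prog A = block [
     block [Const 2 1, Load 4 A 2, inc 2, Load 5 A 2, inc 2, Const 16 0, Const 18 0],
     for_loop 9 5 (for_loop 10 4 (block [inc 2, inc 16])),
     Load 6 A 2]"

text \<open>The code starts with the numbers of vertices and edges, which must be known before
  anything is written. There is no multiplication, so loops count them up; registers 7 and 8 keep
  the numbers of \<open>C 0 False\<close> and \<open>V 0 False\<close>.\<close>

definition count_prog :: com where
  "count_prog = block [
     block [copy 7 5, inc 7, copy 8 7],
     for_loop 10 4 (block [inc 8, inc 8]),
     copy 17 8,
     for_loop 9 6 (Seq (block [inc 17, inc 17, inc 16, inc 16]) (for_loop 10 4 (block [inc 16, inc 16]))),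
     for_loop 9 5 (inc 16)]"

definition owners_prog :: "bool \<Rightarrow> com" where
  "owners_prog z = block [
     block [Const 3 0, emit 17, emit 16, emit 0],
     for_loop 9 5 (emit 1),
     for_loop 9 4 (if z then Seq (emit 1) (emit 1) else Seq (emit 0) (emit 0)),
     for_loop 9 6 (Seq (emit 0) (emit 0))]"

text \<open>Registers 12, 13 and 15 hold the numbers of \<open>U i\<close>, \<open>C j False\<close>
  and \<open>C j (ub i j)\<close>; emitting registers 1 and 4 writes the fraction
  \<open>1/d\<close>.\<close>

definition edges_U_prog :: "nat \<Rightarrow> com" where
  "edges_U_prog A = block [
     Const 12 1,
     for_loop 9 5 (block [emit 0, emit 12, inc 12]),
     block [Const 12 1, Const 2 1, inc 2, inc 2],
     for_loop 9 5 (block [copy 13 7,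
       for_loop 10 4 (block [Load 11 A 2, inc 2, copy 15 13, If 0 11 (inc 15) Skip,
         emit 12, emit 15, emit 1, emit 4, inc 13, inc 13]),
       inc 12])]"

text \<open>The initial \<open>inc 2\<close> skips the cell with the length of the second list.
  Registers 14 and 15 hold \<open>V l False\<close> and \<open>V l (vb l j)\<close>, while register
  13 runs through the layer \<open>C\<close>.\<close>

definition edges_C_prog :: "nat \<Rightarrow> bool \<Rightarrow> com" where
  "edges_C_prog A z = block [
     block [inc 2, copy 14 8],
     for_loop 9 6 (block [copy 13 7,
       for_loop 10 4 (block [Load 11 A 2, inc 2, copy 15 14, If 0 11 (inc 15) Skip,
         emit 13, emit 14, if z then Seq (emit 1) (emit 6) else Skip, inc 13,
         emit 13, emit 15, if z then Seq (emit 1) (emit 6) else Skip, inc 13]),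
       block [inc 14, inc 14]])]"

definition edges_V_prog :: "bool \<Rightarrow> com" where
  "edges_V_prog z = block [
     copy 14 8,
     for_loop 9 6 (block [emit 14, emit (if z then 0 else 14), inc 14,
       emit 14, emit (if z then 0 else 14), inc 14])]"

definition targets_prog :: "bool \<Rightarrow> bool \<Rightarrow> com" where
  "targets_prog z r = block [
     block [emit 6, copy 14 8, if z then inc 14 else Skip],
     for_loop 9 6 (block [if r then Seq (emit 1) (emit 0) else Skip, emit 1, emit 14, inc 14, inc 14])]"

definition build_prog :: "nat \<Rightarrow> bool \<Rightarrow> bool \<Rightarrow> com" where
  "build_prog A z r = block [count_prog, owners_prog z, edges_U_prog A, edges_C_prog A z,
     edges_V_prog z, targets_prog z r, Const 18 1]"

text \<open>Instances with an empty list or with \<open>d = 0\<close> give no such MDP and are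
  answered at once: there is no pair in the former case, and with both lists nonempty every pair is
  orthogonal in the latter. Register 18 stays 0 then; it is 1 once an MDP has been written.\<close>

definition reduction_prog :: "nat \<Rightarrow> bool \<Rightarrow> bool \<Rightarrow> com" where
  "reduction_prog A z r = Seq (header_prog A)
     (If 0 5 (If 0 6 (If 0 4 (build_prog A z r) (Store 1 0 1)) (Store 1 0 0)) (Store 1 0 0))"

lemmas prog_defs = header_prog_def count_prog_def owners_prog_def edges_U_prog_def
  edges_C_prog_def edges_V_prog_def targets_prog_def build_prog_def reduction_prog_def
  for_loop_def emit_def inc_def copy_def

lemma tame_reduction: "tame (reduction_prog A z r)"
  by (simp add: prog_defs)

lemma writes_below_reduction: "writes_below 50 (reduction_prog A z r)"
  by (simp add: prog_defs)

text \<open>Cell 0 is left open, so that the code of an orthogonal vectors instance (with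
  \<open>N\<close> there) and the array computed from a CNF (with 0 there) both qualify.\<close>

definition ov_input :: "(nat \<Rightarrow> nat) \<Rightarrow> nat \<Rightarrow> nat \<Rightarrow> nat \<Rightarrow> (nat \<Rightarrow> nat \<Rightarrow> bool) \<Rightarrow>
    (nat \<Rightarrow> nat \<Rightarrow> bool) \<Rightarrow> bool" where
  "ov_input F d n1 n2 ub vb \<longleftrightarrow> F 1 = d \<and> F 2 = n1 \<and> F (3 + n1 * d) = n2 \<and>
     (\<forall>i<n1. \<forall>j<d. F (3 + i * d + j) = of_bool (ub i j)) \<and>
     (\<forall>l<n2. \<forall>j<d. F (4 + n1 * d + l * d + j) = of_bool (vb l j))"

text \<open>The length of the second list stands behind \<open>n1 * d\<close> entries; a double loop
  walks there by increments, and register 16 keeps the product for the number of edges.\<close>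

lemma hoare_header:
  assumes "ov_input F d n1 n2 ub vb"
  shows "hoare (\<lambda>R M. R 0 = 0 \<and> R 1 = 1 \<and> M A = F) (header_prog A) (10 + n1 * (4 + d * 4))
    (\<lambda>R M. R 0 = 0 \<and> R 1 = 1 \<and> M A = F \<and> R 4 = d \<and> R 5 = n1 \<and> R 6 = n2 \<and> R 16 = n1 * d \<and> R 18 = 0)"
proof -
  let ?I = "\<lambda>k R M. R 0 = 0 \<and> R 1 = 1 \<and> M A = F \<and> R 4 = d \<and> R 5 = n1 \<and> R 16 = k \<and> R 18 = 0 \<and> R 2 = 3 + k"
  have F: "F 1 = d" "F 2 = n1" "F (3 + n1 * d) = n2" using assms by (auto simp: ov_input_def)
  have a: "hoare (\<lambda>R M. R 0 = 0 \<and> R 1 = 1 \<and> M A = F)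
      (block [Const 2 1, Load 4 A 2, inc 2, Load 5 A 2, inc 2, Const 16 0, Const 18 0]) 7 (?I 0)"
    by (rule hoare_while_free) (use F in \<open>auto simp: inc_def numeral_2_eq_2 numeral_3_eq_3\<close>)
  have inner: "hoare (\<lambda>R M. ?I (i * d) R M \<and> R 9 = i) (for_loop 10 4 (block [inc 2, inc 16]))
      (2 + d * (2 + 2)) (\<lambda>R M. ?I (Suc i * d) R M \<and> R 9 = i)" for i
  proof -
    have "hoare (\<lambda>R M. ?I (i * d + 0) R M \<and> R 9 = i) (for_loop 10 4 (block [inc 2, inc 16]))
      (2 + d * (2 + 2)) (\<lambda>R M. ?I (i * d + d) R M \<and> R 9 = i)"
      by (rule hoare_for_loop[where I = "\<lambda>j R M. ?I (i * d + j) R M \<and> R 9 = i"])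
        (auto intro!: hoare_while_free simp: inc_def)
    then show ?thesis by (simp add: add.commute)
  qed
  have b: "hoare (?I (0 * d)) (for_loop 9 5 (for_loop 10 4 (block [inc 2, inc 16])))
      (2 + n1 * (2 + d * (2 + 2) + 2)) (?I (n1 * d))"
    by (rule hoare_for_loop[where I = "\<lambda>i. ?I (i * d)"]) (use inner in auto)
  have c: "hoare (?I (n1 * d)) (Load 6 A 2) 1
      (\<lambda>R M. R 0 = 0 \<and> R 1 = 1 \<and> M A = F \<and> R 4 = d \<and> R 5 = n1 \<and> R 6 = n2 \<and> R 16 = n1 * d \<and> R 18 = 0)"
    by (rule hoare_while_free) (use F in auto)
  from hoare_Seq[OF a hoare_Seq[OF b[simplified mult_0] c]] show ?thesis
    unfolding header_prog_def block.simps by (rule hoare_conseq) (auto simp: algebra_simps)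
qed

section \<open>The cells to be written, and triples for the program pieces that write them\<close>

context ov_instance
begin

definition num_verts :: nat where "num_verts = Suc n1 + 2 * d + 2 * n2"

definition edge_count :: nat where "edge_count = n1 + n1 * d + n2 * (2 * d) + 2 * n2"

definition owners_list :: "bool \<Rightarrow> nat list" where
  "owners_list z = [0] @ concat (map (\<lambda>i. [1]) [0..<n1]) @
     concat (map (\<lambda>j. [of_bool z, of_bool z]) [0..<d]) @ concat (map (\<lambda>l. [0, 0]) [0..<n2])"

definition edges_U_list :: "nat list" where
  "edges_U_list = concat (map (\<lambda>i. [0, U i]) [0..<n1]) @
     concat (map (\<lambda>i. concat (map (\<lambda>j. [U i, C j (ub i j), 1, d]) [0..<d])) [0..<n1])"

definition edges_C_list :: "bool \<Rightarrow> nat list" where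
  "edges_C_list z = concat (map (\<lambda>l. concat (map (\<lambda>j.
     [C j False, V l False] @ (if z then [1, n2] else []) @
     [C j True, V l (vb l j)] @ (if z then [1, n2] else [])) [0..<d])) [0..<n2])"

definition edges_V_list :: "bool \<Rightarrow> nat list" where
  "edges_V_list z = concat (map (\<lambda>l.
     [V l False, if z then 0 else V l False, V l True, if z then 0 else V l True]) [0..<n2])"

definition mdp_list :: "bool \<Rightarrow> nat list" where
  "mdp_list z = [num_verts, edge_count] @ owners_list z @ edges_U_list @ edges_C_list z @ edges_V_list z"

definition targets_list :: "bool \<Rightarrow> bool \<Rightarrow> nat list" where
  "targets_list z r = n2 # concat (map (\<lambda>l. (if r then [1, 0] else []) @ [1, V l z]) [0..<n2])"

definition ov_code :: "bool \<Rightarrow> bool \<Rightarrow> nat list" where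
  "ov_code z r = mdp_list z @ targets_list z r"

definition writing :: "nat \<Rightarrow> (nat \<Rightarrow> nat) \<Rightarrow> nat list \<Rightarrow> (nat \<Rightarrow> nat) \<Rightarrow> (nat \<Rightarrow> nat \<Rightarrow> nat) \<Rightarrow> bool" where
  "writing A F xs R M \<longleftrightarrow> R 0 = 0 \<and> R 1 = 1 \<and> R 4 = d \<and> R 5 = n1 \<and> R 6 = n2 \<and> R 7 = Suc n1 \<and>
     R 8 = Suc n1 + 2 * d \<and> M A = F \<and> M 50 = arr xs \<and> R 3 = length xs"

text \<open>\<open>f i\<close> is what pass \<open>i\<close> appends and \<open>J\<close> collects
  the registers special to the loop. Nested loops then yield nested \<open>concat\<close>s, in the
  shape of lists such as \<open>edges_U_list\<close>.\<close>

lemma hoare_emit_loop: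
  assumes body: "\<And>i ys. i < n \<Longrightarrow> hoare (\<lambda>R M. (writing A F ys R M \<and> J i R M) \<and> R r = i) p t
      (\<lambda>R M. (writing A F (ys @ f i) R M \<and> J (Suc i) R M) \<and> R r = i)"
    and J: "\<And>i x R M. J i R M \<Longrightarrow> J i (R(r := x)) M"
    and b: "\<And>ys R M. writing A F ys R M \<Longrightarrow> R b = n"
    and r: "r = 9 \<or> r = 10" "b < 9"
  shows "hoare (\<lambda>R M. writing A F xs R M \<and> J 0 R M) (for_loop r b p) (2 + n * (t + 2))
    (\<lambda>R M. writing A F (xs @ concat (map f [0..<n])) R M \<and> J n R M)"
proof -
  have "hoare (\<lambda>R M. writing A F (xs @ concat (map f [0..<0])) R M \<and> J 0 R M) (for_loop r b p)
      (2 + n * (t + 2)) (\<lambda>R M. writing A F (xs @ concat (map f [0..<n])) R M \<and> J n R M)"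
  proof (rule hoare_for_loop[where I = "\<lambda>i R M. writing A F (xs @ concat (map f [0..<i])) R M \<and> J i R M"])
    fix i assume "i < n"
    from body[OF this, of "xs @ concat (map f [0..<i])"]
    show "hoare (\<lambda>R M. (writing A F (xs @ concat (map f [0..<i])) R M \<and> J i R M) \<and> R r = i) p t
        (\<lambda>R M. (writing A F (xs @ concat (map f [0..<Suc i])) R M \<and> J (Suc i) R M) \<and> R r = i)"
      by simp
  next
    show "r \<noteq> b" using r by auto
    show "R b = n" if "writing A F (xs @ concat (map f [0..<i])) R M \<and> J i R M" for i R M
      using that b by blast
  qed (use r J in \<open>auto simp: writing_def\<close>)
  then show ?thesis by simp
qed

lemmas step_simps = writing_def emit_def inc_def copy_def

text \<open>The writing position is not yet initialised here; \<open>R(3 := 0)\<close> anticipates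
  the \<open>Const 3 0\<close> with which \<open>owners_prog\<close> begins.\<close>

lemma hoare_count:
  "hoare (\<lambda>R M. R 0 = 0 \<and> R 1 = 1 \<and> M A = F \<and> R 4 = d \<and> R 5 = n1 \<and> R 6 = n2 \<and> R 16 = n1 * d \<and>
      M 50 = (\<lambda>_. 0))
    count_prog (10 + d * 4 + n2 * (8 + d * 4) + n1 * 3)
    (\<lambda>R M. writing A F [] (R(3 := 0)) M \<and> R 16 = edge_count \<and> R 17 = num_verts)"
proof -
  let ?K = "\<lambda>R M. R 0 = 0 \<and> R 1 = 1 \<and> M A = F \<and> R 4 = d \<and> R 5 = n1 \<and> R 6 = n2 \<and> M 50 = (\<lambda>_. 0) \<and> R 7 = Suc n1"
  have a: "hoare (\<lambda>R M. R 0 = 0 \<and> R 1 = 1 \<and> M A = F \<and> R 4 = d \<and> R 5 = n1 \<and> R 6 = n2 \<and> R 16 = n1 * d \<and>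
      M 50 = (\<lambda>_. 0)) (block [copy 7 5, inc 7, copy 8 7]) 3
      (\<lambda>R M. ?K R M \<and> R 16 = n1 * d \<and> R 8 = Suc n1 + 2 * 0)"
    by (rule hoare_while_free) (auto simp: copy_def inc_def)
  have b: "hoare (\<lambda>R M. ?K R M \<and> R 16 = n1 * d \<and> R 8 = Suc n1 + 2 * 0) (for_loop 10 4 (block [inc 8, inc 8]))
      (2 + d * (2 + 2)) (\<lambda>R M. ?K R M \<and> R 16 = n1 * d \<and> R 8 = Suc n1 + 2 * d)"
    by (rule hoare_for_loop[where I = "\<lambda>j R M. ?K R M \<and> R 16 = n1 * d \<and> R 8 = Suc n1 + 2 * j"])
      (auto intro!: hoare_while_free simp: inc_def)
  let ?K' = "\<lambda>l m R M. ?K R M \<and> R 8 = Suc n1 + 2 * d \<and> R 17 = Suc n1 + 2 * d + 2 * l \<and> R 16 = n1 * d + m"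
  have c: "hoare (\<lambda>R M. ?K R M \<and> R 16 = n1 * d \<and> R 8 = Suc n1 + 2 * d) (copy 17 8) 1 (?K' 0 (0 * (2 + 2 * d)))"
    by (rule hoare_while_free) (auto simp: copy_def)
  have inner: "hoare (\<lambda>R M. ?K' l (l * (2 + 2 * d)) R M \<and> R 9 = l)
      (Seq (block [inc 17, inc 17, inc 16, inc 16]) (for_loop 10 4 (block [inc 16, inc 16])))
      (4 + (2 + d * (2 + 2))) (\<lambda>R M. ?K' (Suc l) (Suc l * (2 + 2 * d)) R M \<and> R 9 = l)" for l
  proof -
    have 1: "hoare (\<lambda>R M. ?K' l (l * (2 + 2 * d)) R M \<and> R 9 = l) (block [inc 17, inc 17, inc 16, inc 16]) 4
        (\<lambda>R M. ?K' (Suc l) (l * (2 + 2 * d) + 2 + 2 * 0) R M \<and> R 9 = l)"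
      by (rule hoare_while_free) (auto simp: inc_def)
    have 2: "hoare (\<lambda>R M. ?K' (Suc l) (l * (2 + 2 * d) + 2 + 2 * 0) R M \<and> R 9 = l)
        (for_loop 10 4 (block [inc 16, inc 16])) (2 + d * (2 + 2))
        (\<lambda>R M. ?K' (Suc l) (l * (2 + 2 * d) + 2 + 2 * d) R M \<and> R 9 = l)"
      by (rule hoare_for_loop[where I = "\<lambda>j R M. ?K' (Suc l) (l * (2 + 2 * d) + 2 + 2 * j) R M \<and> R 9 = l"])
        (auto intro!: hoare_while_free simp: inc_def)
    have eq: "l * (2 + 2 * d) + 2 + 2 * d = Suc l * (2 + 2 * d)" by simp
    show ?thesis using hoare_Seq[OF 1 2] unfolding eq .
  qed
  have e: "hoare (?K' 0 (0 * (2 + 2 * d)))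
      (for_loop 9 6 (Seq (block [inc 17, inc 17, inc 16, inc 16]) (for_loop 10 4 (block [inc 16, inc 16]))))
      (2 + n2 * (4 + (2 + d * (2 + 2)) + 2)) (?K' n2 (n2 * (2 + 2 * d)))"
    by (rule hoare_for_loop[where I = "\<lambda>l. ?K' l (l * (2 + 2 * d))"]) (use inner in auto)
  have f: "hoare (?K' n2 (n2 * (2 + 2 * d) + 0)) (for_loop 9 5 (inc 16)) (2 + n1 * (1 + 2))
      (?K' n2 (n2 * (2 + 2 * d) + n1))"
    by (rule hoare_for_loop[where I = "\<lambda>i. ?K' n2 (n2 * (2 + 2 * d) + i)"])
      (auto intro!: hoare_while_free simp: inc_def)
  from hoare_Seq[OF a hoare_Seq[OF b hoare_Seq[OF c hoare_Seq[OF e f[unfolded add_0_right]]]]]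
  show ?thesis unfolding count_prog_def block.simps
    by (rule hoare_conseq) (auto simp: writing_def arr_def num_verts_def edge_count_def algebra_simps fun_eq_iff)
qed

lemma hoare_owners:
  assumes A: "A < 50"
  shows "hoare (\<lambda>R M. writing A F [] (R(3 := 0)) M \<and> R 16 = edge_count \<and> R 17 = num_verts)
    (owners_prog z) (20 + n1 * 4 + d * 6 + n2 * 6)
    (writing A F ([num_verts, edge_count] @ owners_list z))"
proof -
  let ?T = "\<lambda>(i::nat) R M. True"
  have a: "hoare (\<lambda>R M. writing A F [] (R(3 := 0)) M \<and> R 16 = edge_count \<and> R 17 = num_verts)
      (block [Const 3 0, emit 17, emit 16, emit 0]) 7
      (\<lambda>R M. writing A F [num_verts, edge_count, 0] R M \<and> True)"
    by (rule hoare_while_free) (use A in \<open>auto simp: step_simps\<close>)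
  have b: "hoare (\<lambda>R M. writing A F xs R M \<and> True) (for_loop 9 5 (emit 1)) (2 + n1 * (2 + 2))
      (\<lambda>R M. writing A F (xs @ concat (map (\<lambda>i. [1]) [0..<n1])) R M \<and> True)" for xs
    by (rule hoare_emit_loop[where J = ?T])
      (use A in \<open>auto intro!: hoare_while_free simp: step_simps\<close>)
  have c: "hoare (\<lambda>R M. writing A F xs R M \<and> True)
      (for_loop 9 4 (if z then Seq (emit 1) (emit 1) else Seq (emit 0) (emit 0))) (2 + d * (4 + 2))
      (\<lambda>R M. writing A F (xs @ concat (map (\<lambda>j. [of_bool z, of_bool z]) [0..<d])) R M \<and> True)" for xs
    by (rule hoare_emit_loop[where J = ?T])
      (use A in \<open>auto intro!: hoare_while_free simp: step_simps\<close>)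
  have e: "hoare (\<lambda>R M. writing A F xs R M \<and> True) (for_loop 9 6 (Seq (emit 0) (emit 0))) (2 + n2 * (4 + 2))
      (\<lambda>R M. writing A F (xs @ concat (map (\<lambda>l. [0, 0]) [0..<n2])) R M \<and> True)" for xs
    by (rule hoare_emit_loop[where J = ?T])
      (use A in \<open>auto intro!: hoare_while_free simp: step_simps\<close>)
  from hoare_Seq[OF a hoare_Seq[OF b hoare_Seq[OF c e]]]
  show ?thesis unfolding owners_prog_def block.simps
    by (rule hoare_conseq) (auto simp: owners_list_def)
qed

lemma hoare_edges_U:
  assumes A: "A < 50" and F: "ov_input F d n1 n2 ub vb"
  shows "hoare (writing A F xs) (edges_U_prog A) (9 + n1 * 7 + n1 * (6 + d * 18))
    (\<lambda>R M. writing A F (xs @ edges_U_list) R M \<and> R 2 = 3 + n1 * d)"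
proof -
  let ?J = "\<lambda>i R (M :: nat \<Rightarrow> nat \<Rightarrow> nat). R (12::nat) = U i"
  let ?J' = "\<lambda>i R (M :: nat \<Rightarrow> nat \<Rightarrow> nat). R (12::nat) = U i \<and> R (2::nat) = 3 + i * d"
  let ?J'' = "\<lambda>i j R (M :: nat \<Rightarrow> nat \<Rightarrow> nat). R (12::nat) = U i \<and> R (2::nat) = 3 + i * d + j \<and>
    R (13::nat) = C j False \<and> R (9::nat) = i"
  have a: "hoare (writing A F xs) (Const 12 1) 1 (\<lambda>R M. writing A F xs R M \<and> ?J 0 R M)"
    by (rule hoare_while_free) (auto simp: writing_def U_def)
  have b: "hoare (\<lambda>R M. writing A F xs R M \<and> ?J 0 R M) (for_loop 9 5 (block [emit 0, emit 12, inc 12]))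
      (2 + n1 * (5 + 2)) (\<lambda>R M. writing A F (xs @ concat (map (\<lambda>i. [0, U i]) [0..<n1])) R M \<and> ?J n1 R M)"
    by (rule hoare_emit_loop) (use A in \<open>auto intro!: hoare_while_free simp: step_simps U_def\<close>)
  have c: "hoare (\<lambda>R M. writing A F ys R M \<and> ?J n1 R M) (block [Const 12 1, Const 2 1, inc 2, inc 2]) 4
      (\<lambda>R M. writing A F ys R M \<and> ?J' 0 R M)" for ys
    by (rule hoare_while_free) (auto simp: step_simps U_def)
  let ?body = "block [Load 11 A 2, inc 2, copy 15 13, If 0 11 (inc 15) Skip,
         emit 12, emit 15, emit 1, emit 4, inc 13, inc 13]"
  have inner: "hoare (\<lambda>R M. (writing A F ys R M \<and> ?J' i R M) \<and> R 9 = i)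
      (block [copy 13 7, for_loop 10 4 ?body, inc 12]) (1 + ((2 + d * (16 + 2)) + 1))
      (\<lambda>R M. (writing A F (ys @ concat (map (\<lambda>j. [U i, C j (ub i j), 1, d]) [0..<d])) R M \<and>
        ?J' (Suc i) R M) \<and> R 9 = i)" if i: "i < n1" for i ys
  proof -
    have 1: "hoare (\<lambda>R M. (writing A F ys R M \<and> ?J' i R M) \<and> R 9 = i) (copy 13 7) 1
        (\<lambda>R M. writing A F ys R M \<and> ?J'' i 0 R M)"
      by (rule hoare_while_free) (auto simp: step_simps C_def)
    have 2: "hoare (\<lambda>R M. writing A F ys R M \<and> ?J'' i 0 R M) (for_loop 10 4 ?body) (2 + d * (16 + 2))
        (\<lambda>R M. writing A F (ys @ concat (map (\<lambda>j. [U i, C j (ub i j), 1, d]) [0..<d])) R M \<and> ?J'' i d R M)"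
    proof (rule hoare_emit_loop[where J = "?J'' i"])
      fix j ys assume j: "j < d"
      then have Fj: "F (3 + i * d + j) = of_bool (ub i j)" using F i by (auto simp: ov_input_def)
      show "hoare (\<lambda>R M. (writing A F ys R M \<and> ?J'' i j R M) \<and> R 10 = j) ?body 16
        (\<lambda>R M. (writing A F (ys @ [U i, C j (ub i j), 1, d]) R M \<and> ?J'' i (Suc j) R M) \<and> R 10 = j)"
        by (rule hoare_while_free; cases "ub i j") (use A Fj in \<open>auto simp: step_simps C_def\<close>)
    qed (auto simp: writing_def)
    have 3: "hoare (\<lambda>R M. writing A F zs R M \<and> ?J'' i d R M) (inc 12) 1
        (\<lambda>R M. (writing A F zs R M \<and> ?J' (Suc i) R M) \<and> R 9 = i)" for zs
      by (rule hoare_while_free) (auto simp: step_simps U_def)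
    from hoare_Seq[OF 1 hoare_Seq[OF 2 3]] show ?thesis unfolding block.simps .
  qed
  have e: "hoare (\<lambda>R M. writing A F ys R M \<and> ?J' 0 R M)
      (for_loop 9 5 (block [copy 13 7, for_loop 10 4 ?body, inc 12]))
      (2 + n1 * ((1 + ((2 + d * (16 + 2)) + 1)) + 2))
      (\<lambda>R M. writing A F (ys @ concat (map (\<lambda>i. concat (map (\<lambda>j. [U i, C j (ub i j), 1, d]) [0..<d])) [0..<n1])) R M \<and> ?J' n1 R M)" for ys
    by (rule hoare_emit_loop[OF inner]) (auto simp: writing_def)
  from hoare_Seq[OF a hoare_Seq[OF b hoare_Seq[OF c e]]]
  show ?thesis unfolding edges_U_prog_def block.simps
    by (rule hoare_conseq) (auto simp: algebra_simps edges_U_list_def)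
qed

lemma hoare_edges_C:
  assumes A: "A < 50" and F: "ov_input F d n1 n2 ub vb"
  shows "hoare (\<lambda>R M. writing A F xs R M \<and> R 2 = 3 + n1 * d) (edges_C_prog A z) (4 + n2 * (7 + d * 26))
    (writing A F (xs @ edges_C_list z))"
proof -
  let ?J = "\<lambda>l R (M :: nat \<Rightarrow> nat \<Rightarrow> nat). R (14::nat) = V l False \<and> R (2::nat) = 4 + n1 * d + l * d"
  let ?J' = "\<lambda>l j R (M :: nat \<Rightarrow> nat \<Rightarrow> nat). R (14::nat) = V l False \<and> R (2::nat) = 4 + n1 * d + l * d + j \<and>
    R (13::nat) = C j False \<and> R (9::nat) = l"
  let ?f = "\<lambda>l j. [C j False, V l False] @ (if z then [1, n2] else []) @
       [C j True, V l (vb l j)] @ (if z then [1, n2] else [])"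
  have a: "hoare (\<lambda>R M. writing A F xs R M \<and> R 2 = 3 + n1 * d) (block [inc 2, copy 14 8]) 2
      (\<lambda>R M. writing A F xs R M \<and> ?J 0 R M)"
    by (rule hoare_while_free) (auto simp: step_simps V_def)
  let ?body = "block [Load 11 A 2, inc 2, copy 15 14, If 0 11 (inc 15) Skip,
         emit 13, emit 14, if z then Seq (emit 1) (emit 6) else Skip, inc 13,
         emit 13, emit 15, if z then Seq (emit 1) (emit 6) else Skip, inc 13]"
  have inner: "hoare (\<lambda>R M. (writing A F ys R M \<and> ?J l R M) \<and> R 9 = l)
      (block [copy 13 7, for_loop 10 4 ?body, block [inc 14, inc 14]]) (1 + ((2 + d * (24 + 2)) + 2))
      (\<lambda>R M. (writing A F (ys @ concat (map (?f l) [0..<d])) R M \<and> ?J (Suc l) R M) \<and> R 9 = l)"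
    if l: "l < n2" for l ys
  proof -
    have 1: "hoare (\<lambda>R M. (writing A F ys R M \<and> ?J l R M) \<and> R 9 = l) (copy 13 7) 1
        (\<lambda>R M. writing A F ys R M \<and> ?J' l 0 R M)"
      by (rule hoare_while_free) (auto simp: step_simps C_def)
    have 2: "hoare (\<lambda>R M. writing A F ys R M \<and> ?J' l 0 R M) (for_loop 10 4 ?body) (2 + d * (24 + 2))
        (\<lambda>R M. writing A F (ys @ concat (map (?f l) [0..<d])) R M \<and> ?J' l d R M)"
    proof (rule hoare_emit_loop[where J = "?J' l"])
      fix j ys assume j: "j < d"
      then have Fj: "F (4 + n1 * d + l * d + j) = of_bool (vb l j)" using F l by (auto simp: ov_input_def)
      show "hoare (\<lambda>R M. (writing A F ys R M \<and> ?J' l j R M) \<and> R 10 = j) ?body 24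
        (\<lambda>R M. (writing A F (ys @ ?f l j) R M \<and> ?J' l (Suc j) R M) \<and> R 10 = j)"
        by (rule hoare_while_free; cases "vb l j"; cases z)
          (use A Fj in \<open>auto simp: step_simps C_def V_def\<close>)
    qed (auto simp: writing_def)
    have 3: "hoare (\<lambda>R M. writing A F zs R M \<and> ?J' l d R M) (block [inc 14, inc 14]) 2
        (\<lambda>R M. (writing A F zs R M \<and> ?J (Suc l) R M) \<and> R 9 = l)" for zs
      by (rule hoare_while_free) (auto simp: step_simps V_def)
    from hoare_Seq[OF 1 hoare_Seq[OF 2 3]] show ?thesis unfolding block.simps .
  qed
  have e: "hoare (\<lambda>R M. writing A F xs R M \<and> ?J 0 R M)
      (for_loop 9 6 (block [copy 13 7, for_loop 10 4 ?body, block [inc 14, inc 14]]))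
      (2 + n2 * ((1 + ((2 + d * (24 + 2)) + 2)) + 2))
      (\<lambda>R M. writing A F (xs @ concat (map (\<lambda>l. concat (map (?f l) [0..<d])) [0..<n2])) R M \<and> ?J n2 R M)"
    by (rule hoare_emit_loop[OF inner]) (auto simp: writing_def)
  from hoare_Seq[OF a e] show ?thesis
    unfolding edges_C_prog_def block.simps
    by (rule hoare_conseq) (auto simp: algebra_simps edges_C_list_def)
qed

lemma hoare_edges_V:
  assumes A: "A < 50"
  shows "hoare (writing A F xs) (edges_V_prog z) (3 + n2 * 12)
    (writing A F (xs @ edges_V_list z))"
proof -
  let ?J = "\<lambda>l R (M :: nat \<Rightarrow> nat \<Rightarrow> nat). R (14::nat) = V l False"
  have a: "hoare (writing A F xs) (copy 14 8) 1 (\<lambda>R M. writing A F xs R M \<and> ?J 0 R M)"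
    by (rule hoare_while_free) (auto simp: step_simps V_def)
  have b: "hoare (\<lambda>R M. writing A F xs R M \<and> ?J 0 R M)
      (for_loop 9 6 (block [emit 14, emit (if z then 0 else 14), inc 14,
       emit 14, emit (if z then 0 else 14), inc 14])) (2 + n2 * (10 + 2))
      (\<lambda>R M. writing A F (xs @ edges_V_list z) R M \<and> ?J n2 R M)"
    unfolding edges_V_list_def
    by (rule hoare_emit_loop; cases z) (use A in \<open>auto intro!: hoare_while_free simp: step_simps V_def\<close>)
  from hoare_Seq[OF a b] show ?thesis
    unfolding edges_V_prog_def block.simps by (rule hoare_conseq) auto
qed

lemma hoare_targets:
  assumes A: "A < 50"
  shows "hoare (writing A F xs) (targets_prog z r) (6 + n2 * 12) (writing A F (xs @ targets_list z r))"
proof -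
  let ?J = "\<lambda>l R (M :: nat \<Rightarrow> nat \<Rightarrow> nat). R (14::nat) = V l z"
  have a: "hoare (writing A F xs) (block [emit 6, copy 14 8, if z then inc 14 else Skip]) 4
      (\<lambda>R M. writing A F (xs @ [n2]) R M \<and> ?J 0 R M)"
    by (rule hoare_while_free) (use A in \<open>auto simp: step_simps V_def\<close>)
  have b: "hoare (\<lambda>R M. writing A F (xs @ [n2]) R M \<and> ?J 0 R M)
      (for_loop 9 6 (block [if r then Seq (emit 1) (emit 0) else Skip, emit 1, emit 14, inc 14, inc 14]))
      (2 + n2 * (10 + 2))
      (\<lambda>R M. writing A F ((xs @ [n2]) @ concat (map (\<lambda>l. (if r then [1, 0] else []) @ [1, V l z]) [0..<n2])) R M \<and> ?J n2 R M)"
    by (rule hoare_emit_loop; cases r) (use A in \<open>auto intro!: hoare_while_free simp: step_simps V_def\<close>)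
  from hoare_Seq[OF a b] show ?thesis
    unfolding targets_prog_def block.simps
    by (rule hoare_conseq) (auto simp: targets_list_def)
qed

lemma hoare_build:
  assumes A: "A < 50" and F: "ov_input F d n1 n2 ub vb"
  shows "hoare (\<lambda>R M. R 0 = 0 \<and> R 1 = 1 \<and> M A = F \<and> R 4 = d \<and> R 5 = n1 \<and> R 6 = n2 \<and> R 16 = n1 * d \<and>
      M 50 = (\<lambda>_. 0)) (build_prog A z r) (100 * (n1 + n2 + 1) * (d + 1))
    (\<lambda>R M. R 18 = 1 \<and> M 50 = arr (ov_code z r))"
proof -
  have fin: "hoare (writing A F xs) (Const 18 1) 1 (\<lambda>R M. R 18 = 1 \<and> M 50 = arr xs)" for xs
    by (rule hoare_while_free) (auto simp: writing_def)
  note * = hoare_Seq[OF hoare_count hoare_Seq[OF hoare_owners[OF A, of F z] hoare_Seq[OF hoare_edges_U[OF A F]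
    hoare_Seq[OF hoare_edges_C[OF A F] hoare_Seq[OF hoare_edges_V[OF A, where z = z]
      hoare_Seq[OF hoare_targets[OF A, of F _ z r] fin]]]]]]
  show ?thesis
    unfolding build_prog_def block.simps
    by (rule hoare_conseq[OF *]) (auto simp: ov_code_def mdp_list_def algebra_simps)
qed

end

lemma hoare_reduction:
  assumes A: "A < 50" and F: "ov_input F d n1 n2 ub vb"
  shows "hoare (\<lambda>R M. R 0 = 0 \<and> R 1 = 1 \<and> M A = F \<and> M 50 = (\<lambda>_. 0)) (reduction_prog A z r)
    (200 * (n1 + n2 + 1) * (d + 1))
    (\<lambda>R M. if 0 < n1 \<and> 0 < n2 \<and> 0 < d
      then R 18 = 1 \<and> M 50 = arr (ov_instance.ov_code d n1 n2 ub vb z r)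
      else R 18 = 0 \<and> M 1 0 = of_bool (0 < n1 \<and> 0 < n2))"
    (is "hoare _ _ _ ?Q")
proof -
  let ?H = "\<lambda>R M. R 0 = 0 \<and> R 1 = 1 \<and> M A = F \<and> R 4 = d \<and> R 5 = n1 \<and> R 6 = n2 \<and> R 16 = n1 * d \<and> R 18 = 0 \<and> M 50 = (\<lambda>_. 0)"
  let ?t = "100 * (n1 + n2 + 1) * (d + 1)"
  have t: "1 \<le> ?t" by simp
  have hdr: "hoare (\<lambda>R M. R 0 = 0 \<and> R 1 = 1 \<and> M A = F \<and> M 50 = (\<lambda>_. 0)) (header_prog A) (10 + n1 * (4 + d * 4)) ?H"
    unfolding hoare_def
  proof (intro allI impI)
    fix R :: "nat \<Rightarrow> nat" and M :: "nat \<Rightarrow> nat \<Rightarrow> nat"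
    assume *: "R 0 = 0 \<and> R 1 = 1 \<and> M A = F \<and> M 50 = (\<lambda>_. 0)"
    from hoare_header[OF F, of A] * obtain c R' M' where
      1: "sexec (header_prog A) (R, M) c (R', M')" "c \<le> 10 + n1 * (4 + d * 4)"
      "R' 0 = 0" "R' 1 = 1" "M' A = F" "R' 4 = d" "R' 5 = n1" "R' 6 = n2" "R' 16 = n1 * d" "R' 18 = 0"
      unfolding hoare_def by blast
    \<comment> \<open>\<open>hoare_header\<close> is silent about array 50, which must still be
      blank when writing starts; the frame property supplies this.\<close>
    have "writes_below 49 (header_prog A)" by (simp add: prog_defs)
    from sexec_frame[OF 1(1) this] have "M' 50 = M 50" by simp
    with 1 * show "\<exists>c R' M'. sexec (header_prog A) (R, M) c (R', M') \<and> c \<le> 10 + n1 * (4 + d * 4) \<and> ?H R' M'"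
      by (intro exI[of _ c] exI[of _ R'] exI[of _ M']) auto
  qed
  have main: "hoare (\<lambda>R M. ((?H R M \<and> R 0 < R 5) \<and> R 0 < R 6) \<and> R 0 < R 4) (build_prog A z r) ?t ?Q"
  proof (cases "0 < n1 \<and> 0 < n2 \<and> 0 < d")
    case True
    interpret ov_instance d n1 n2 ub vb by standard (use True in auto)
    show ?thesis by (rule hoare_conseq[OF hoare_build[OF A F]]) (use True in auto)
  next
    case False
    \<comment> \<open>The three guards contradict this case, so the precondition is
      unsatisfiable.\<close>
    then show ?thesis by (auto simp: hoare_def)
  qed
  have "hoare ?H (If 0 5 (If 0 6 (If 0 4 (build_prog A z r) (Store 1 0 1)) (Store 1 0 0)) (Store 1 0 0))
      (Suc (Suc (Suc ?t))) ?Q"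
  proof (intro hoare_If)
    show "hoare (\<lambda>R M. ((?H R M \<and> R 0 < R 5) \<and> R 0 < R 6) \<and> R 0 < R 4) (build_prog A z r) ?t ?Q"
      by (rule main)
  qed (rule hoare_while_free, simp, (simp; fail), auto)+
  from hoare_Seq[OF hdr this] show ?thesis
    unfolding reduction_prog_def by (rule hoare_conseq) (auto simp: algebra_simps)
qed

section \<open>The written cells as a code of the MDP and of its targets\<close>

lemma concat_map_concat: "concat (map f (concat xss)) = concat (map (\<lambda>xs. concat (map f xs)) xss)"
  by (induction xss) auto

lemma distinct_concat_map_upt:
  assumes "\<And>i. i < n \<Longrightarrow> distinct (f i)"
    and "\<And>i k. i < k \<Longrightarrow> k < n \<Longrightarrow> set (f i) \<inter> set (f k) = {}"
  shows "distinct (concat (map f [0..<n]))"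
  using assms
proof (induction n)
  case (Suc n)
  have "set (concat (map f [0..<n])) \<inter> set (f n) = {}"
    using Suc.prems(2)[of _ n] by fastforce
  then show ?case using Suc by simp
qed simp

lemma upt_pairs: "[a..<a + 2 * k] = concat (map (\<lambda>j. [a + 2 * j, Suc (a + 2 * j)]) [0..<k])"
proof (induction k)
  case (Suc k)
  have "a + 2 * Suc k = Suc (Suc (a + 2 * k))" by simp
  then show ?case using Suc by (simp del: mult_Suc_right)
qed simp

context ov_instance
begin

lemma distinct_edge_list: "distinct (edge_list z)"
proof -
  have 1: "distinct (map (\<lambda>i. (0, U i)) [0..<n1])" by (simp add: distinct_map inj_on_def)
  have 2: "distinct (concat (map (\<lambda>i. map (\<lambda>j. (U i, C j (ub i j))) [0..<d]) [0..<n1]))"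
    by (rule distinct_concat_map_upt) (auto simp: distinct_map inj_on_def)
  have 3: "distinct (concat (map (\<lambda>l. concat (map (\<lambda>j. [(C j False, V l False), (C j True, V l (vb l j))]) [0..<d])) [0..<n2]))"
    by (intro distinct_concat_map_upt) auto
  have 4: "distinct (concat (map (\<lambda>l. [(V l False, if z then 0 else V l False), (V l True, if z then 0 else V l True)]) [0..<n2]))"
    by (rule distinct_concat_map_upt) auto
  show ?thesis unfolding edge_list_def distinct_append
    using 1 2 3 4 by (intro conjI) (auto split: if_splits)
qed

lemma length_edge_list: "length (edge_list z) = edge_count"
  by (simp add: edge_list_def edge_count_def length_concat comp_def sum_list_triv)

lemma card_edges: "card (edges (ov_mdp z)) = edge_count"
  using distinct_card[OF distinct_edge_list[of z]] length_edge_list[of z] by simp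

text \<open>Ordering the vertices by layer splits the list of owners into the blocks of
  \<open>owners_list\<close>.\<close>

lemma all_verts: "[0..<num_verts] = [0] @ map U [0..<n1] @
    concat (map (\<lambda>j. [C j False, C j True]) [0..<d]) @ concat (map (\<lambda>l. [V l False, V l True]) [0..<n2])"
proof -
  have "[0..<num_verts] = [0..<1] @ [1..<Suc n1] @ [Suc n1..<Suc n1 + 2 * d] @
      [Suc n1 + 2 * d..<Suc n1 + 2 * d + 2 * n2]"
    unfolding num_verts_def
    using upt_add_eq_append[of 0 1 "n1 + 2 * d + 2 * n2"] upt_add_eq_append[of 1 "Suc n1" "2 * d + 2 * n2"]
      upt_add_eq_append[of "Suc n1" "Suc n1 + 2 * d" "2 * n2"]
    by (simp add: add.assoc del: upt_Suc)
  moreover have "[1..<Suc n1] = map U [0..<n1]"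
    by (rule nth_equalityI) (auto simp: U_def simp del: upt_Suc)
  moreover have "[Suc n1..<Suc n1 + 2 * d] = concat (map (\<lambda>j. [C j False, C j True]) [0..<d])"
    unfolding upt_pairs by (simp add: C_def)
  moreover have "[Suc n1 + 2 * d..<Suc n1 + 2 * d + 2 * n2] = concat (map (\<lambda>l. [V l False, V l True]) [0..<n2])"
    unfolding upt_pairs by (simp add: V_def)
  ultimately show ?thesis by simp
qed

lemma mdp_code_ov: "mdp_code (ov_mdp z) (mdp_list z)"
proof -
  let ?rnd = "random_verts (ov_mdp z)"
  \<comment> \<open>All distributions are uniform: the numerator is always 1, which makes the
    fractions reduced, and the denominator is \<open>d\<close> at \<open>U i\<close> and
    \<open>n2\<close> at a random \<open>C j b\<close>.\<close>
  define den where "den u (v::nat) = (if u < Suc n1 then d else n2)" for u v :: nat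
  have den: "i < n1 \<Longrightarrow> den (U i) v = d" "den (C j b) v = n2" for i j b v
    by (auto simp: den_def U_def C_def)
  have prob: "coprime 1 (den u v) \<and> 0 < den u v \<and> pmf (trans_prob (ov_mdp z) u) v = real 1 / real (den u v)"
    if "(u, v) \<in> edges (ov_mdp z)" "u \<in> ?rnd" for u v
    using that pos trans_prob_U trans_prob_C random_iff
    by (auto simp: edge_iff den)
  have card: "card (verts (ov_mdp z)) = num_verts" by (simp add: ov_mdp_def num_verts_def)
  have owners: "map (\<lambda>v. of_bool (v \<in> ?rnd)) [0..<num_verts] = owners_list z"
    unfolding owners_list_def all_verts map_append map_concat map_map comp_def concat_map_singleton
    by (intro arg_cong2[of _ _ _ _ "(@)"] arg_cong[of _ _ concat] map_cong refl)
      (auto simp: random_iff)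
  let ?f = "\<lambda>(u, v). if u \<in> ?rnd then [u, v, 1, den u v] else [u, v]"
  have f0: "concat (map ?f (map (\<lambda>i. (0, U i)) [0..<n1])) = concat (map (\<lambda>i. [0, U i]) [0..<n1])"
    using random_iff(1) by (simp add: comp_def)
  have f1: "concat (map ?f (concat (map (\<lambda>i. map (\<lambda>j. (U i, C j (ub i j))) [0..<d]) [0..<n1])))
      = concat (map (\<lambda>i. concat (map (\<lambda>j. [U i, C j (ub i j), 1, d]) [0..<d])) [0..<n1])"
    unfolding concat_map_concat map_map comp_def
    by (intro arg_cong[of _ _ concat] map_cong refl) (auto simp: random_iff den)
  have f2: "concat (map ?f (concat (map (\<lambda>l. concat (map (\<lambda>j. [(C j False, V l False), (C j True, V l (vb l j))]) [0..<d])) [0..<n2])))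
      = edges_C_list z"
    unfolding edges_C_list_def concat_map_concat map_map comp_def
    by (intro arg_cong[of _ _ concat] map_cong refl) (auto simp: random_iff den)
  have f3: "concat (map ?f (concat (map (\<lambda>l. [(V l False, if z then 0 else V l False), (V l True, if z then 0 else V l True)]) [0..<n2])))
      = edges_V_list z"
    unfolding edges_V_list_def concat_map_concat map_map comp_def
    by (intro arg_cong[of _ _ concat] map_cong refl) (auto simp: random_iff)
  have edges: "concat (map ?f (edge_list z)) = edges_U_list @ edges_C_list z @ edges_V_list z"
    unfolding edge_list_def edges_U_list_def map_append concat_append f0 f1 f2 f3 append_assoc ..
  show ?thesis unfolding mdp_code_def
    by (rule exI[of _ "edge_list z"], rule exI[of _ "\<lambda>_ _. 1"], rule exI[of _ den])
      (use prob distinct_edge_list in \<open>auto simp: card card_edges owners edges mdp_list_def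
        simp del: edges_ov_mdp simp: edges_ov_mdp[symmetric]\<close>)
qed

lemma list_code_targets:
  "list_code set_code cobuechi_targets (targets_list True False)"
  "list_code set_code buechi_targets (targets_list False False)"
  "list_code set_pair_code rabin_targets (targets_list True True)"
proof -
  have sc: "set_code {x} [1, x]" for x
    unfolding set_code_def by (rule exI[of _ "[x]"]) simp
  have spc: "set_pair_code ({x}, {y}) ([1, x] @ [1, y])" for x y
    unfolding set_pair_code_def fst_conv snd_conv using sc by blast
  show "list_code set_code cobuechi_targets (targets_list True False)"
    unfolding list_code_def
    by (rule exI[of _ "map (\<lambda>l. [1, V l True]) [0..<n2]"])
      (use sc in \<open>auto simp: cobuechi_targets_def targets_list_def list_all2_map1 list_all2_map2
        intro: list_all2_refl\<close>)
  show "list_code set_code buechi_targets (targets_list False False)"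
    unfolding list_code_def
    by (rule exI[of _ "map (\<lambda>l. [1, V l False]) [0..<n2]"])
      (use sc in \<open>auto simp: buechi_targets_def targets_list_def list_all2_map1 list_all2_map2
        intro: list_all2_refl\<close>)
  show "list_code set_pair_code rabin_targets (targets_list True True)"
    unfolding list_code_def
    by (rule exI[of _ "map (\<lambda>l. [1, 0] @ [1, V l True]) [0..<n2]"])
      (use spc in \<open>auto simp: rabin_targets_def targets_list_def list_all2_map1 list_all2_map2
        intro: list_all2_refl\<close>)
qed

lemmas list_defs = ov_code_def mdp_list_def owners_list_def edges_U_list_def edges_C_list_def edges_V_list_def
  targets_list_def

text \<open>\<open>n1\<close>, \<open>n2\<close> and \<open>d\<close> are at least 1, so every
  lower-order term can be charged to \<open>N * d\<close>.\<close>

lemma size_bounds: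
  assumes "n1 \<le> N" "n2 \<le> N"
  shows "n1 * d \<le> N * d" "n2 * d \<le> N * d" "n1 \<le> N * d" "n2 \<le> N * d" "d \<le> N * d" "1 \<le> N * d"
  using assms pos mult_le_mono[of n1 N 1 d] mult_le_mono[of n2 N 1 d] mult_le_mono[of 1 N d d]
    mult_le_mono[of 1 N 1 d] by auto

lemma length_code_le:
  assumes "n1 \<le> N" "n2 \<le> N"
  shows "length (ov_code z r) \<le> 40 * (N * d)"
proof -
  have "length (ov_code z r) \<le> 4 + 3 * n1 + 2 * d + 10 * n2 + 4 * (n1 * d) + 8 * (n2 * d)"
    by (cases z; cases r) (simp_all add: list_defs length_concat comp_def sum_list_triv algebra_simps)
  then show ?thesis using size_bounds[OF assms(1,2)] by linarith
qed

lemma code_entries_le: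
  assumes "n1 \<le> N" "n2 \<le> N" "x \<in> set (ov_code z r)"
  shows "x \<le> 40 * (N * d)"
proof -
  have "x \<le> num_verts + edge_count"
    using assms(3) pos
    by (auto simp: list_defs num_verts_def edge_count_def U_def C_def V_def of_bool_def
        split: if_splits)
  then have "x \<le> 1 + 2 * n1 + 2 * d + 4 * n2 + n1 * d + 2 * (n2 * d)"
    by (simp add: num_verts_def edge_count_def algebra_simps)
  then show ?thesis using size_bounds[OF assms(1,2)] by linarith
qed

lemma edge_count_le:
  assumes "n1 \<le> N" "n2 \<le> N"
  shows "edge_count \<le> 6 * (N * d)"
proof -
  have "edge_count = n1 + n1 * d + 2 * (n2 * d) + 2 * n2"
    by (simp add: edge_count_def)
  then show ?thesis using size_bounds[OF assms] by linarith
qed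

end

text \<open>All that the complexity argument uses of a problem. Of the computed winning set only the
  entry of vertex 0 is consulted.\<close>

definition encodes_ov :: "(nat mdp \<times> 'o list) problem \<Rightarrow> bool \<Rightarrow> bool \<Rightarrow> bool" where
  "encodes_ov Pb z r \<longleftrightarrow> (\<forall>d n1 n2 ub vb. ov_instance d n1 n2 \<longrightarrow>
     (\<exists>x\<in>instances Pb. codes Pb x (ov_instance.ov_code d n1 n2 ub vb z r) \<and>
       (\<forall>out. correct Pb x out \<longrightarrow> (out 0 \<noteq> 0 \<longleftrightarrow> ov_instance.orthogonal_pair d n1 n2 ub vb)) \<and>
       num_edges x = real (ov_instance.edge_count d n1 n2) \<and> num_objectives x = real n2))"

lemma encodes_ovI:
  assumes "Pb = mdp_problem code ok win"
    and "\<And>d n1 n2. ov_instance d n1 n2 \<Longrightarrow> list_code code (ts d n1 n2) (ov_instance.targets_list d n1 n2 z r)"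
    and "\<And>d n1 n2. ov_instance d n1 n2 \<Longrightarrow> length (ts d n1 n2) = n2 \<and>
      (\<forall>t\<in>set (ts d n1 n2). ok {..<Suc n1 + 2 * d + 2 * n2} t)"
    and "\<And>d n1 n2 ub vb. ov_instance d n1 n2 \<Longrightarrow> 0 \<in> win (ov_instance.ov_mdp d n1 n2 ub vb z) (ts d n1 n2) \<longleftrightarrow>
      ov_instance.orthogonal_pair d n1 n2 ub vb"
  shows "encodes_ov Pb z r"
  unfolding encodes_ov_def
proof (intro allI impI)
  fix d n1 n2 ub vb assume ov: "ov_instance d n1 n2"
  interpret ov_instance d n1 n2 ub vb by (rule ov)
  let ?x = "(ov_mdp z, ts d n1 n2)"
  have v: "verts (ov_mdp z) = {..<Suc n1 + 2 * d + 2 * n2}" by (simp add: ov_mdp_def)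
  have "ts d n1 n2 \<noteq> []" using assms(3)[OF ov] pos by auto
  then have "?x \<in> instances Pb"
    using assms(3)[OF ov] is_mdp_ov by (auto simp: assms(1) mdp_problem_def v)
  moreover have "codes Pb ?x (ov_code z r)"
    using mdp_code_ov assms(2)[OF ov] by (auto simp: assms(1) mdp_problem_def ov_code_def)
  moreover have "\<forall>out. correct Pb ?x out \<longrightarrow> (out 0 \<noteq> 0 \<longleftrightarrow> orthogonal_pair)"
    using assms(4)[OF ov] in_verts(1) by (auto simp: assms(1) mdp_problem_def)
  moreover have "num_edges ?x = real edge_count" "num_objectives ?x = real n2"
    using assms(3)[OF ov] card_edges by (simp_all add: num_edges_def num_objectives_def)
  ultimately show "\<exists>x\<in>instances Pb. codes Pb x (ov_code z r) \<and>
       (\<forall>out. correct Pb x out \<longrightarrow> (out 0 \<noteq> 0 \<longleftrightarrow> orthogonal_pair)) \<and>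
       num_edges x = real edge_count \<and> num_objectives x = real n2"
    by blast
qed

lemma encodes_ov_problems:
  "encodes_ov buechi_query_problem False False"
  "encodes_ov cobuechi_objective_problem True False"
  "encodes_ov cobuechi_query_problem True False"
  "encodes_ov singleton_cobuechi_objective_problem True False"
  "encodes_ov singleton_cobuechi_query_problem True False"
  "encodes_ov rabin_problem True True"
proof -
  have ok: "ov_instance d n1 n2 \<Longrightarrow> length (ov_instance.buechi_targets d n1 n2) = n2 \<and>
      (\<forall>t\<in>set (ov_instance.buechi_targets d n1 n2). t \<subseteq> {..<Suc n1 + 2 * d + 2 * n2})"
    "ov_instance d n1 n2 \<Longrightarrow> length (ov_instance.cobuechi_targets d n1 n2) = n2 \<and>
      (\<forall>t\<in>set (ov_instance.cobuechi_targets d n1 n2). t \<subseteq> {..<Suc n1 + 2 * d + 2 * n2} \<and> card t = 1)"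
    "ov_instance d n1 n2 \<Longrightarrow> length (ov_instance.rabin_targets d n1 n2) = n2 \<and>
      (\<forall>(L, U)\<in>set (ov_instance.rabin_targets d n1 n2). L \<subseteq> {..<Suc n1 + 2 * d + 2 * n2} \<and>
        U \<subseteq> {..<Suc n1 + 2 * d + 2 * n2})" for d n1 n2
    by (auto simp: ov_instance.cobuechi_targets_def ov_instance.buechi_targets_def
      ov_instance.rabin_targets_def ov_instance.V_def)
  show "encodes_ov buechi_query_problem False False"
    by (rule encodes_ovI[OF buechi_query_problem_def, where ts = ov_instance.buechi_targets])
      (use ok in \<open>auto simp: ov_instance.list_code_targets ov_instance.buechi_query_iff\<close>)
  show "encodes_ov cobuechi_objective_problem True False"
    by (rule encodes_ovI[OF cobuechi_objective_problem_def, where ts = ov_instance.cobuechi_targets])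
      (use ok in \<open>auto simp: ov_instance.list_code_targets ov_instance.cobuechi_objective_iff\<close>)
  show "encodes_ov cobuechi_query_problem True False"
    by (rule encodes_ovI[OF cobuechi_query_problem_def, where ts = ov_instance.cobuechi_targets])
      (use ok in \<open>auto simp: ov_instance.list_code_targets ov_instance.cobuechi_query_iff\<close>)
  show "encodes_ov singleton_cobuechi_objective_problem True False"
    by (rule encodes_ovI[OF singleton_cobuechi_objective_problem_def, where ts = ov_instance.cobuechi_targets])
      (use ok in \<open>auto simp: ov_instance.list_code_targets ov_instance.cobuechi_objective_iff\<close>)
  show "encodes_ov singleton_cobuechi_query_problem True False"
    by (rule encodes_ovI[OF singleton_cobuechi_query_problem_def, where ts = ov_instance.cobuechi_targets])
      (use ok in \<open>auto simp: ov_instance.list_code_targets ov_instance.cobuechi_query_iff\<close>)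
  show "encodes_ov rabin_problem True True"
    by (rule encodes_ovI[OF rabin_problem_def, where ts = ov_instance.rabin_targets])
      (use ok in \<open>auto simp: ov_instance.list_code_targets ov_instance.rabin_iff\<close>)
qed

section \<open>Solving orthogonal vectors with a fast algorithm for MDPs\<close>

text \<open>A generous bound, but it suffices: \<open>T * bit_length T\<close> gets exponent
  \<open>3/2\<close>, below \<open>2 - \<epsilon>\<close>, and no polylogarithmic factor has to be
  tracked. The 3 is the root of the 9 in \<open>sq\<close>, used with
  \<open>k = floor_log n\<close>.\<close>

lemma bit_length_le_sqrt:
  assumes "1 \<le> n" shows "real (bit_length n) \<le> 3 * sqrt (real n)"
proof -
  have sq: "(k + 1)\<^sup>2 \<le> 9 * 2 ^ k" for k :: nat
  proof (induction k)
    case (Suc k)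
    show ?case
    proof (cases "k < 2")
      case True
      then have "k = 0 \<or> k = 1" by auto
      then show ?thesis by (auto simp: power2_eq_square)
    next
      case False
      then have "2 * 2 \<le> k * k" by (intro mult_le_mono) auto
      then have "(Suc k + 1)\<^sup>2 \<le> 2 * (k + 1)\<^sup>2" by (simp add: power2_eq_square algebra_simps)
      then show ?thesis using Suc by simp
    qed
  qed (simp add: power2_eq_square)
  have "(bit_length n)\<^sup>2 \<le> 9 * 2 ^ floor_log n" using sq[of "floor_log n"] by (simp add: bit_length_def)
  also have "\<dots> \<le> 9 * n" using floor_log_exp2_le[of n] assms by simp
  finally have "real ((bit_length n)\<^sup>2) \<le> real (9 * n)" by (rule of_nat_mono)
  then have "sqrt ((real (bit_length n))\<^sup>2) \<le> sqrt (9 * real n)" by (intro real_sqrt_le_mono) simp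
  then show ?thesis by (simp add: real_sqrt_mult)
qed

lemma mult_bit_length_le:
  assumes "1 \<le> X" "T \<le> X" shows "real (T * (2 * bit_length X)) \<le> 6 * real X powr (3/2)"
proof -
  have "real (T * (2 * bit_length X)) \<le> real X * (2 * (3 * sqrt (real X)))"
    using bit_length_le_sqrt[OF assms(1)] assms(2) by (simp add: mult_mono)
  also have "\<dots> = 6 * (real X powr 1 * real X powr (1/2))"
    using assms(1) by (simp add: powr_half_sqrt)
  also have "\<dots> = 6 * real X powr (3/2)" by (simp only: powr_add[symmetric]) simp
  finally show ?thesis .
qed

lemma input_size_le:
  assumes "length xs \<le> X" "\<And>x. x \<in> set xs \<Longrightarrow> x \<le> X" "1 \<le> X"
  shows "real (input_size xs) \<le> 6 * real X powr (3/2)"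
proof -
  have "input_size xs \<le> (\<Sum>i<length xs. 2 * bit_length X)"
    unfolding input_size_def
  proof (rule sum_mono)
    fix i assume i: "i \<in> {..<length xs}"
    then have "xs ! i \<le> X" "i \<le> X" using assms by auto
    then show "bit_length i + bit_length (xs ! i) \<le> 2 * bit_length X"
      using bit_length_mono[of i X] bit_length_mono[of "xs ! i" X] by simp
  qed
  also have "\<dots> = length xs * (2 * bit_length X)" by simp
  finally have "real (input_size xs) \<le> real (length xs * (2 * bit_length X))" by (rule of_nat_mono)
  also have "\<dots> \<le> 6 * real X powr (3/2)" by (rule mult_bit_length_le) (use assms in auto)
  finally show ?thesis .
qed

text \<open>The common consequence of the two hypothetical time bounds. It covers every dimension
  \<open>d\<close>, not only logarithmic ones, because for satisfiability \<open>d\<close> is the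
  number of clauses.\<close>

definition ov_solver :: "com \<Rightarrow> bool \<Rightarrow> bool \<Rightarrow> real \<Rightarrow> real \<Rightarrow> bool" where
  "ov_solver p z r \<epsilon> K \<longleftrightarrow> (\<forall>d n1 n2 ub vb N. ov_instance d n1 n2 \<longrightarrow> n1 \<le> N \<longrightarrow> n2 \<le> N \<longrightarrow>
     (\<exists>c s. exec p (initial_state (ov_instance.ov_code d n1 n2 ub vb z r)) c s \<and>
       (result_of s 0 \<noteq> 0 \<longleftrightarrow> ov_instance.orthogonal_pair d n1 n2 ub vb) \<and>
       real c \<le> K * real (N * d) powr (2 - \<epsilon>)))"

text \<open>\<open>G\<close> stands for either time bound. The granted linear term is harmless: the
  code has at most \<open>40 * (N * d)\<close> cells with entries up to that value, so its size is
  \<open>O((N * d) powr (3/2))\<close>, and \<open>3/2 \<le> 2 - \<epsilon>\<close>.\<close>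

lemma ov_solverI:
  assumes enc: "encodes_ov Pb z r" and eps: "\<epsilon> \<le> 1/4"
    and fast: "solves_in_O p Pb (\<lambda>x xs. real (input_size xs) + G x)"
    and G: "\<And>x. 0 \<le> G x"
    and G_le: "\<And>x m k Y. num_edges x = m \<Longrightarrow> num_objectives x = k \<Longrightarrow> 1 \<le> m \<Longrightarrow> 1 \<le> k \<Longrightarrow> 1 \<le> Y \<Longrightarrow>
       m \<le> 6 * Y \<Longrightarrow> k \<le> Y \<Longrightarrow> G x \<le> 36 * Y powr (2 - \<epsilon>)"
  shows "\<exists>K\<ge>0. ov_solver p z r \<epsilon> K"
proof -
  from fast obtain C0 where C0: "solves_within p Pb (\<lambda>x xs. C0 * (real (input_size xs) + G x))"
    by (auto simp: solves_in_O_def)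
  define K where "K = \<bar>C0\<bar> * (6 * 40 powr (3/2) + 36)"
  have "ov_solver p z r \<epsilon> K"
    unfolding ov_solver_def
  proof (intro allI impI)
    fix d n1 n2 ub vb N assume ov: "ov_instance d n1 n2" and N: "n1 \<le> N" "n2 \<le> N"
    interpret ov_instance d n1 n2 ub vb by (rule ov)
    let ?xs = "ov_code z r"
    from enc ov obtain x where x: "x \<in> instances Pb" "codes Pb x ?xs"
      "\<And>out. correct Pb x out \<Longrightarrow> (out 0 \<noteq> 0 \<longleftrightarrow> orthogonal_pair)"
      "num_edges x = real edge_count" "num_objectives x = real n2"
      unfolding encodes_ov_def by blast
    from C0 x(1,2) obtain c s where c: "exec p (initial_state ?xs) c s" "correct Pb x (result_of s)"
      "real c \<le> C0 * (real (input_size ?xs) + G x)"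
      unfolding solves_within_def by blast
    have Nd: "1 \<le> N * d" using N pos by simp
    have "real (input_size ?xs) \<le> 6 * real (40 * (N * d)) powr (3/2)"
      by (rule input_size_le) (use length_code_le[OF N] code_entries_le[OF N] Nd in auto)
    also have "\<dots> = 6 * 40 powr (3/2) * real (N * d) powr (3/2)" by (simp add: powr_mult)
    also have "\<dots> \<le> 6 * 40 powr (3/2) * real (N * d) powr (2 - \<epsilon>)"
      using Nd eps by (intro mult_left_mono powr_mono) (auto simp del: of_nat_mult)
    finally have i: "real (input_size ?xs) \<le> 6 * 40 powr (3/2) * real (N * d) powr (2 - \<epsilon>)" .
    have g: "G x \<le> 36 * real (N * d) powr (2 - \<epsilon>)"
      using x(4,5) edge_count_le[OF N] size_bounds(4)[OF N] pos Nd
      by (intro G_le[OF refl refl]) (simp_all add: edge_count_def flip: of_nat_mult)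
    have "real c \<le> \<bar>C0\<bar> * (real (input_size ?xs) + G x)"
      using c(3) G[of x] by (meson abs_ge_self add_nonneg_nonneg mult_right_mono of_nat_0_le_iff order_trans)
    also have "\<dots> \<le> \<bar>C0\<bar> * (6 * 40 powr (3/2) * real (N * d) powr (2 - \<epsilon>) + 36 * real (N * d) powr (2 - \<epsilon>))"
      using i g by (intro mult_left_mono add_mono) auto
    also have "\<dots> = K * real (N * d) powr (2 - \<epsilon>)" by (simp add: K_def algebra_simps)
    finally show "\<exists>c s. exec p (initial_state ?xs) c s \<and> (result_of s 0 \<noteq> 0 \<longleftrightarrow> orthogonal_pair) \<and>
       real c \<le> K * real (N * d) powr (2 - \<epsilon>)"
      using c(1) x(3)[OF c(2)] by blast
  qed
  moreover have "0 \<le> K" by (simp add: K_def)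
  ultimately show ?thesis by blast
qed

lemma ov_solver_of_fast:
  assumes enc: "encodes_ov Pb z r" and "\<epsilon>' > 0" and fast: "\<not> no_fast_algorithm \<epsilon>' Pb"
  shows "\<exists>p K \<epsilon>. 0 \<le> K \<and> 0 < \<epsilon> \<and> \<epsilon> \<le> 1/4 \<and> ov_solver p z r \<epsilon> K"
proof -
  \<comment> \<open>A smaller \<epsilon> only weakens the time bounds, since \<open>m\<close> and
    \<open>k * m\<close> are at least 1; the cap keeps \<open>3/2\<close> below
    \<open>2 - \<epsilon>\<close>.\<close>
  define \<epsilon> where "\<epsilon> = min \<epsilon>' (1/4)"
  have eps: "0 < \<epsilon>" "\<epsilon> \<le> 1/4" "\<epsilon> \<le> \<epsilon>'" using assms(2) by (auto simp: \<epsilon>_def)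
  have six: "6 powr (2 - \<epsilon>) \<le> (36::real)"
    using powr_mono[of "2 - \<epsilon>" 2 "6::real"] eps by simp
  have six': "6 powr (1 - \<epsilon>) \<le> (36::real)"
    using powr_mono[of "1 - \<epsilon>" 2 "6::real"] eps by simp
  from fast consider p where "solves_in_O p Pb (\<lambda>x xs. real (input_size xs) + num_edges x powr (2 - \<epsilon>'))"
    | p where "solves_in_O p Pb (\<lambda>x xs. real (input_size xs) + (num_objectives x * num_edges x) powr (1 - \<epsilon>'))"
    unfolding no_fast_algorithm_def by blast
  then have "\<exists>p. \<exists>K\<ge>0. ov_solver p z r \<epsilon> K"
  proof cases
    case 1
    have "\<exists>K\<ge>0. ov_solver p z r \<epsilon> K"
    proof (rule ov_solverI[OF enc eps(2) 1])
      fix x :: "nat mdp \<times> 'a list" and m k Y :: real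
      assume *: "num_edges x = m" "1 \<le> m" "1 \<le> Y" "m \<le> 6 * Y"
      have "m powr (2 - \<epsilon>') \<le> m powr (2 - \<epsilon>)" using * eps by (intro powr_mono) auto
      also have "\<dots> \<le> (6 * Y) powr (2 - \<epsilon>)" using * eps by (intro powr_mono2) auto
      also have "\<dots> = 6 powr (2 - \<epsilon>) * Y powr (2 - \<epsilon>)" using * by (simp add: powr_mult)
      also have "\<dots> \<le> 36 * Y powr (2 - \<epsilon>)" using six by (intro mult_right_mono) auto
      finally show "num_edges x powr (2 - \<epsilon>') \<le> 36 * Y powr (2 - \<epsilon>)" using * by simp
    qed simp
    then show ?thesis by blast
  next
    case 2
    have "\<exists>K\<ge>0. ov_solver p z r \<epsilon> K"
    proof (rule ov_solverI[OF enc eps(2) 2])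
      fix x :: "nat mdp \<times> 'a list" and m k Y :: real
      assume *: "num_edges x = m" "num_objectives x = k" "1 \<le> m" "1 \<le> k" "1 \<le> Y" "m \<le> 6 * Y" "k \<le> Y"
      have km: "1 \<le> k * m" using * mult_mono[of 1 k 1 m] by simp
      have "(k * m) powr (1 - \<epsilon>') \<le> (k * m) powr (1 - \<epsilon>)" using km eps by (intro powr_mono) auto
      also have "\<dots> \<le> (Y * (6 * Y)) powr (1 - \<epsilon>)" using * eps by (intro powr_mono2 mult_mono) auto
      also have "\<dots> = 6 powr (1 - \<epsilon>) * (Y powr (1 - \<epsilon>) * Y powr (1 - \<epsilon>))"
        using * by (simp add: powr_mult)
      also have "\<dots> = 6 powr (1 - \<epsilon>) * Y powr (2 - 2 * \<epsilon>)" by (simp add: powr_add[symmetric])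
      also have "\<dots> \<le> 36 * Y powr (2 - \<epsilon>)"
        using six' * eps by (intro mult_mono powr_mono) auto
      finally show "(num_objectives x * num_edges x) powr (1 - \<epsilon>') \<le> 36 * Y powr (2 - \<epsilon>)" using * by simp
    qed simp
    then show ?thesis by blast
  qed
  with eps show ?thesis by blast
qed

text \<open>\<open>pre\<close> leaves the vectors in array \<open>A\<close>: it is
  \<open>Skip\<close> with \<open>A = 0\<close> for orthogonal vectors and \<open>sat_prog\<close>
  with \<open>A = 2\<close> for satisfiability. Array 51 is the output array of the relocated
  solver; its cell 0, the verdict on the start vertex, is copied to the real output array 1.\<close>

definition total_prog :: "com \<Rightarrow> nat \<Rightarrow> bool \<Rightarrow> bool \<Rightarrow> com \<Rightarrow> com" where
  "total_prog pre A z r p = Seq (Const 1 1) (Seq (Seq pre (reduction_prog A z r)) (Seq (Const 0 0)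
     (If 0 18 (Seq (relocate 50 p) (Seq (Const 0 0) (Seq (Load 2 51 0) (Store 1 0 2)))) Skip)))"

text \<open>The steps of the tame part are converted into cost with one bound \<open>X\<close> on
  values. The solver's cost counts three times: once for its run, twice for loading and storing an
  answer whose length is bounded only through that cost.\<close>

lemma total_prog_correct:
  assumes solver: "ov_solver p z r \<epsilon> K" and K: "0 \<le> K"
    and pre: "tame pre" "writes_below 49 pre" and A: "A < 50"
    and run: "hoare (\<lambda>R M. R = (\<lambda>_. 0)(1 := 1) \<and> M = snd (initial_state xs)) pre t
      (\<lambda>R M. R 0 = 0 \<and> R 1 = 1 \<and> ov_input (M A) d n1 n2 ub vb)"
    and B: "\<And>x. x \<in> set xs \<Longrightarrow> x \<le> B" and N: "n1 \<le> N" "n2 \<le> N" "1 \<le> N"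
  shows "\<exists>c s. exec (total_prog pre A z r p) (initial_state xs) c s \<and>
    decides (\<exists>i<n1. \<exists>l<n2. \<forall>j<d. \<not> (ub i j \<and> vb l j)) (result_of s) \<and>
    real c \<le> 20 * real (B + t + 601 * (N * (d + 1))) powr (3/2) + 3 * (K * real (N * d) powr (2 - \<epsilon>))"
proof -
  let ?orth = "\<exists>i<n1. \<exists>l<n2. \<forall>j<d. \<not> (ub i j \<and> vb l j)"
  let ?tail = "Seq (relocate 50 p) (Seq (Const 0 0) (Seq (Load 2 51 0) (Store 1 0 2)))"
  let ?R0 = "(\<lambda>_. 0)(1 := 1) :: nat \<Rightarrow> nat" and ?M0 = "snd (initial_state xs)"
  from run obtain t1 R1 M1 where pre_run: "sexec pre (?R0, ?M0) t1 (R1, M1)" "t1 \<le> t"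
    "R1 0 = 0" "R1 1 = 1" "ov_input (M1 A) d n1 n2 ub vb"
    unfolding hoare_def by blast
  have "M1 50 = (\<lambda>_. 0)"
    using sexec_frame[OF pre_run(1) pre(2)] by (auto simp: initial_state_def)
  with hoare_reduction[OF A pre_run(5), of z r] pre_run obtain t2 R2 M2 where
    red: "sexec (reduction_prog A z r) (R1, M1) t2 (R2, M2)" "t2 \<le> 200 * (n1 + n2 + 1) * (d + 1)"
    "if 0 < n1 \<and> 0 < n2 \<and> 0 < d
      then R2 18 = 1 \<and> M2 50 = arr (ov_instance.ov_code d n1 n2 ub vb z r)
      else R2 18 = 0 \<and> M2 1 0 = of_bool (0 < n1 \<and> 0 < n2)"
    unfolding hoare_def by blast
  let ?q = "Seq pre (reduction_prog A z r)"
  have q: "sexec ?q (?R0, ?M0) (t1 + t2) (R2, M2)" using pre_run(1) red(1) by (rule sexec.intros)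
  have tame: "tame ?q" using pre(1) tame_reduction by simp
  \<comment> \<open>One more than \<open>B\<close>, because register 1 holds 1 even if the input
    consists of zeros.\<close>
  have bnd0: "bounded_by (B + 1) (?R0, ?M0)"
    using B by (auto simp: bounded_by_def initial_state_def le_SucI)
  \<comment> \<open>The reduction takes at most \<open>600 * (N * (d + 1))\<close> steps, as
    \<open>n1 + n2 + 1 \<le> 3 * N\<close>; the remaining unit of 601 absorbs the 1 in
    \<open>B + 1\<close>.\<close>
  define X where "X = B + t + 601 * (N * (d + 1))"
  have "200 * (n1 + n2 + 1) * (d + 1) \<le> 600 * N * (d + 1)"
    using N by (intro mult_le_mono1) simp
  then have "t2 \<le> 600 * (N * (d + 1))" using red(2) by simp
  moreover have "1 \<le> N * (d + 1)" using N(3) by simp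
  ultimately have T: "B + 1 + (t1 + t2) \<le> X" using pre_run(2) unfolding X_def by linarith
  from exec_of_sexec[OF q tame _ bnd0] obtain c1 where
    c1: "bounded_by (B + 1 + (t1 + t2)) (R2, M2)" "exec ?q (?R0, ?M0) c1 (R2, M2)"
    "c1 \<le> (t1 + t2) * (2 * bit_length (B + 1 + (t1 + t2)))" by auto
  have X1: "1 \<le> X" using T by simp
  have "c1 \<le> (t1 + t2) * (2 * bit_length X)"
    using c1(3) bit_length_mono[OF T] by (meson mult_le_mono2 order_trans)
  then have "real c1 \<le> real ((t1 + t2) * (2 * bit_length X))" by (rule of_nat_mono)
  also have "\<dots> \<le> 6 * real X powr (3/2)" by (rule mult_bit_length_le) (use T X1 in auto)
  finally have c1_le: "real c1 \<le> 6 * real X powr (3/2)" .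
  have Xp: "1 \<le> real X powr (3/2)" using X1 by (intro ge_one_powr_ge_zero) auto
  have L: "2 * real (bit_length X) \<le> 6 * real X powr (3/2)"
    using mult_bit_length_le[of X 1] X1 by simp
  have bl: "bit_length x \<le> bit_length X" if "x \<le> B + 1 + (t1 + t2)" for x
    using that T by (intro bit_length_mono) simp
  let ?R3 = "R2(0 := 0)"
  have start: "exec (Const 1 1) (initial_state xs) 1 (?R0, ?M0)"
    using exec.Const[of 1 1 "\<lambda>_. 0" ?M0] by (simp add: initial_state_def)
  have zero: "exec (Const 0 0) (R2, M2) 1 (?R3, M2)"
    using exec.Const[of 0 0 R2 M2] by simp
  show ?thesis
  proof (cases "0 < n1 \<and> 0 < n2 \<and> 0 < d")
    case False
    have "exec (If 0 18 ?tail Skip) (?R3, M2) (bit_length (?R3 0) + bit_length (?R3 18) + 1) (?R3, M2)"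
      by (rule exec.IfFalse) (use red(3) False in \<open>auto intro: exec.Skip simp del: One_nat_def\<close>)
    then have "exec (If 0 18 ?tail Skip) (?R3, M2) 3 (?R3, M2)"
      using red(3) False by (simp add: numeral_3_eq_3)
    from exec.Seq[OF start exec.Seq[OF c1(2) exec.Seq[OF zero this]]]
    have "exec (total_prog pre A z r p) (initial_state xs) (1 + (c1 + (1 + 3))) (?R3, M2)"
      unfolding total_prog_def .
    moreover have "decides ?orth (result_of (?R3, M2))"
      using red(3) False by (auto simp: decides_def result_of_def split: if_splits)
    moreover have "real (1 + (c1 + (1 + 3))) \<le> 20 * real X powr (3/2) + 3 * (K * real (N * d) powr (2 - \<epsilon>))"
      using c1_le Xp K by (simp add: add_increasing2)
    ultimately show ?thesis unfolding X_def by blast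
  next
    case True
    interpret ov_instance d n1 n2 ub vb by standard (use True in auto)
    let ?xs = "ov_code z r"
    have ov: "ov_instance d n1 n2" by (rule ov_instance_axioms)
    from solver ov N(1,2) obtain c s where s: "exec p (initial_state ?xs) c s"
      "result_of s 0 \<noteq> 0 \<longleftrightarrow> orthogonal_pair" "real c \<le> K * real (N * d) powr (2 - \<epsilon>)"
      unfolding ov_solver_def by blast
    have flag: "R2 18 = 1" and code: "M2 50 = arr ?xs" using red(3) True by auto
    \<comment> \<open>Registers from 50 on and arrays above 50 are untouched and array 50 holds
      exactly the code, so the relocated solver meets its initial state.\<close>
    have "shifted 50 (initial_state ?xs) (?R3, M2)"
      unfolding shifted_def
    proof (intro conjI allI)
      fix k
      show "fst (?R3, M2) (k + 50) = fst (initial_state ?xs) k"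
        using sexec_frame[OF pre_run(1) pre(2)] sexec_frame[OF red(1) writes_below_reduction]
        by (simp add: initial_state_def)
      show "snd (?R3, M2) (k + 50) = snd (initial_state ?xs) k"
      proof (cases "k = 0")
        case True then show ?thesis using code by (auto simp: initial_state_def arr_def fun_eq_iff)
      next
        case False
        then have "M2 (k + 50) = ?M0 (k + 50)"
          using sexec_frame[OF pre_run(1) pre(2)] sexec_frame[OF red(1) writes_below_reduction] by simp
        then show ?thesis using False by (auto simp: initial_state_def)
      qed
    qed
    from exec_relocate[OF s(1) this] obtain R4 M4 where
      r: "exec (relocate 50 p) (?R3, M2) c (R4, M4)" "shifted 50 s (R4, M4)" by auto
    define v where "v = M4 51 0"
    have "snd (R4, M4) (1 + 50) = snd s 1" using r(2) unfolding shifted_def by blast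
    then have v: "v = result_of s 0" by (simp add: v_def result_of_def)
    have "bit_length v \<le> bit_length X + c"
    proof -
      have "\<forall>k. bit_length (fst (?R3, M2) k) \<le> bit_length X" "\<forall>A i. bit_length (snd (?R3, M2) A i) \<le> bit_length X"
        using c1(1) bl by (auto simp: bounded_by_def)
      from exec_bit_length[OF r(1) this] show ?thesis by (simp add: v_def)
    qed
    let ?R5 = "R4(0 := 0)" and ?s = "(R4(0 := 0, 2 := v), M4(1 := (M4 1)(0 := v)))"
    have e1: "exec (Const 0 0) (R4, M4) 1 (?R5, M4)" using exec.Const[of 0 0 R4 M4] by simp
    have e2: "exec (Load 2 51 0) (?R5, M4) (1 + bit_length v) (R4(0 := 0, 2 := v), M4)"
      using exec.Load[of 2 51 0 ?R5 M4] by (simp add: v_def)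
    have e3: "exec (Store 1 0 2) (R4(0 := 0, 2 := v), M4) (1 + bit_length v) ?s"
      using exec.Store[of 1 0 2 "R4(0 := 0, 2 := v)" M4] by simp
    have lt: "?R3 0 < ?R3 18" using flag by simp
    from exec.IfTrue[of ?R3 0 18, OF lt exec.Seq[OF r(1) exec.Seq[OF e1 exec.Seq[OF e2 e3]]], of Skip]
    have "exec (If 0 18 ?tail Skip) (?R3, M2) (2 + (c + (1 + ((1 + bit_length v) + (1 + bit_length v))))) ?s"
      using flag by (simp add: numeral_2_eq_2)
    from exec.Seq[OF start exec.Seq[OF c1(2) exec.Seq[OF zero this]]]
    have "exec (total_prog pre A z r p) (initial_state xs)
        (1 + (c1 + (1 + (2 + (c + (1 + ((1 + bit_length v) + (1 + bit_length v)))))))) ?s"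
      unfolding total_prog_def .
    moreover have "decides ?orth (result_of ?s)"
      using s(2) v by (simp add: decides_def result_of_def orthogonal_pair_def)
    moreover have "real (1 + (c1 + (1 + (2 + (c + (1 + ((1 + bit_length v) + (1 + bit_length v))))))))
        \<le> 20 * real X powr (3/2) + 3 * (K * real (N * d) powr (2 - \<epsilon>))"
    proof -
      have "real (bit_length v) \<le> real (bit_length X) + real c"
        using \<open>bit_length v \<le> bit_length X + c\<close> by linarith
      then have "real (1 + (c1 + (1 + (2 + (c + (1 + ((1 + bit_length v) + (1 + bit_length v))))))))
          \<le> 7 + real c1 + 2 * real (bit_length X) + 3 * real c" by simp
      then show ?thesis using c1_le L Xp s(3) by linarith
    qed
    ultimately show ?thesis unfolding X_def by blast
  qed
qed

section \<open>From satisfiability to orthogonal vectors\<close>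

lemma nth_concat_uniform:
  assumes "\<And>i. i < N \<Longrightarrow> length (f i) = d" "i < N" "j < d"
  shows "concat (map f [0..<N]) ! (i * d + j) = f i ! j"
proof -
  have len: "length (concat (map f [0..<i])) = i * d" if "i \<le> N" for i
    using that assms(1) by (induction i) (auto simp: add.commute)
  have "[0..<N] = [0..<i] @ i # [Suc i..<N]"
    using assms(2) by (metis less_imp_add_positive upt_add_eq_append upt_conv_Cons le_add1 add_0)
  then have "concat (map f [0..<N]) = concat (map f [0..<i]) @ f i @ concat (map f [Suc i..<N])" by simp
  then show ?thesis using len[of i] assms by (simp add: nth_append)
qed

lemma length_concat_uniform:
  assumes "\<And>i. i < N \<Longrightarrow> length (f i) = d" shows "length (concat (map f [0..<N])) = N * d"
  using assms by (induction N) (auto simp: add.commute)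

lemma ov_input_arr:
  assumes "\<And>i. i < n1 \<Longrightarrow> length (us i) = d" "\<And>l. l < n2 \<Longrightarrow> length (vs l) = d"
    and "\<And>i j. i < n1 \<Longrightarrow> j < d \<Longrightarrow> us i ! j = of_bool (ub i j)"
    and "\<And>l j. l < n2 \<Longrightarrow> j < d \<Longrightarrow> vs l ! j = of_bool (vb l j)"
  shows "ov_input (arr ([x, d, n1] @ concat (map us [0..<n1]) @ [n2] @ concat (map vs [0..<n2]))) d n1 n2 ub vb"
proof -
  let ?U = "concat (map us [0..<n1])" and ?V = "concat (map vs [0..<n2])"
  have len: "length ?U = n1 * d" "length ?V = n2 * d"
    using assms(1,2) by (auto intro: length_concat_uniform)
  have lt: "i * d + j < n * d" if "i < n" "j < d" for i j n
  proof -
    have "i * d + j < Suc i * d" using that by simp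
    also have "\<dots> \<le> n * d" using that by (intro mult_le_mono1) simp
    finally show ?thesis .
  qed
  have U: "arr ([x, d, n1] @ ?U @ [n2] @ ?V) (3 + i * d + j) = of_bool (ub i j)" if "i < n1" "j < d" for i j
    using lt[OF that] len nth_concat_uniform[of n1 us d i j] assms(1,3) that
    by (simp add: arr_def nth_append add.assoc numeral_3_eq_3)
  have V: "arr ([x, d, n1] @ ?U @ [n2] @ ?V) (4 + n1 * d + l * d + j) = of_bool (vb l j)" if "l < n2" "j < d" for l j
  proof -
    have "4 + n1 * d + l * d + j = Suc (Suc (Suc (n1 * d + Suc (l * d + j))))" by simp
    then show ?thesis
      using lt[OF that] len nth_concat_uniform[of n2 vs d l j] assms(2,4) that
      by (simp add: arr_def nth_append del: add_Suc_right)
  qed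
  have "arr ([x, d, n1] @ ?U @ [n2] @ ?V) (3 + n1 * d) = n2"
    using len by (simp add: arr_def nth_append numeral_3_eq_3)
  then show ?thesis using U V by (simp add: ov_input_def arr_def numeral_2_eq_2)
qed

definition emit2 :: "nat \<Rightarrow> com" where "emit2 r = Seq (Store 2 3 r) (inc 3)"

text \<open>\<open>tame\<close> forbids adding a register to itself, so a value is doubled by two
  increments per unit; \<open>k\<close> doublings take \<open>O(k * 2 ^ k)\<close> steps.\<close>

definition power_prog :: "nat \<Rightarrow> com" where
  "power_prog cr = Seq (Const 8 1) (for_loop 9 cr (block [Const 11 0,
     for_loop 10 8 (block [inc 11, inc 11]), copy 8 11]))"

text \<open>Pass \<open>i\<close> fills cells \<open>2 * i\<close> and \<open>2 * i + 1\<close>,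
  which tabulates quotients and remainders modulo 2 without division.\<close>

definition table_prog :: com where
  "table_prog = Seq (Const 19 0) (for_loop 9 8 (block
     [Store 3 19 9, Store 4 19 0, inc 19, Store 3 19 9, Store 4 19 1, inc 19]))"

definition decode_prog :: "nat \<Rightarrow> nat \<Rightarrow> nat \<Rightarrow> com" where
  "decode_prog Bt bs cr = Seq (block [copy 12 9, copy 13 bs])
     (for_loop 10 cr (block [Load 14 4 12, inc 14, Store Bt 13 14, Load 12 3 12, inc 13]))"

text \<open>Register 14 is 1 plus the sign of the literal, register 15 the entry of its variable;
  the two nested \<open>If\<close>s test them for equality. Register 16 remains 1 as long as no
  literal is found true.\<close>

definition clause_prog :: "nat \<Rightarrow> com" where
  "clause_prog Bt = block [block [Load 17 0 2, inc 2, Const 16 1],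
     for_loop 18 17 (block [Load 13 0 2, inc 2, Load 14 0 2, inc 2, inc 14, Load 15 Bt 13,
       If 15 14 Skip (If 14 15 Skip (Const 16 0))]),
     emit2 16]"

definition half_prog :: "nat \<Rightarrow> nat \<Rightarrow> nat \<Rightarrow> com" where
  "half_prog Bt bs cr = block [power_prog cr, table_prog, emit2 8,
     for_loop 9 8 (block [decode_prog Bt bs cr, block [Const 2 1, inc 2], for_loop 10 5 (clause_prog Bt)])]"

text \<open>The variables are split at \<open>lo = \<lceil>n/2\<rceil>\<close>; the assignment \<open>a\<close> of one half is read off the binary
  digits of \<open>a\<close>, which arrays 3 and 4 (quotients and remainders modulo 2) provide. Array \<open>Bt\<close>
  stores 1 plus the value of a variable, and 0 for the variables of the other half.\<close>

definition sat_prog :: com where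
  "sat_prog = block [block [Const 2 0, Load 4 0 2, inc 2, Load 5 0 2, Const 6 0, copy 7 4],
     While 6 7 (Seq (inc 6) (Sub 7 7 1)),
     block [Const 3 0, emit2 0, emit2 5],
     half_prog 5 0 6, half_prog 6 6 7]"

lemma sat_prog_tame: "tame sat_prog" "writes_below 49 sat_prog"
  by (simp_all add: sat_prog_def half_prog_def power_prog_def table_prog_def decode_prog_def
      clause_prog_def emit2_def for_loop_def inc_def copy_def)

text \<open>Truth under the partial assignment given by the binary digits of \<open>a\<close>;
  literals over variables of the other half count as false.\<close>

definition lit_true :: "nat \<Rightarrow> nat \<Rightarrow> nat \<Rightarrow> nat \<times> bool \<Rightarrow> bool" where
  "lit_true bv k a l \<longleftrightarrow> bv \<le> fst l \<and> fst l < bv + k \<and> odd (a div 2 ^ (fst l - bv)) = snd l"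

text \<open>A clause's coordinate is 1 if this half leaves the clause unsatisfied, so two halves
  collide there exactly if neither satisfies it.\<close>

definition unsat_row :: "nat \<Rightarrow> nat \<Rightarrow> nat \<Rightarrow> (nat \<times> bool) list \<Rightarrow> bool" where
  "unsat_row bv k a cl \<longleftrightarrow> \<not> (\<exists>l\<in>set cl. lit_true bv k a l)"

lemma nth_literal_codes:
  "t < length cl \<Longrightarrow> concat (map (\<lambda>(v, b). [v, of_bool b]) cl) ! (2 * t) = fst (cl ! t)"
  "t < length cl \<Longrightarrow> concat (map (\<lambda>(v, b). [v, of_bool b]) cl) ! Suc (2 * t) = of_bool (snd (cl ! t))"
  by (induction cl arbitrary: t) (auto simp: nth_Cons split: nat.splits prod.splits)

lemma length_literal_codes: "length (concat (map (\<lambda>(v, b). [v, of_bool b :: nat]) cl)) = 2 * length cl"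
  by (induction cl) auto

lemma length_clause_code: "length (clause_code cl) = Suc (2 * length cl)"
  by (simp add: clause_code_def length_literal_codes)

section \<open>Correctness of the split of a CNF into two lists of vectors\<close>

locale sat_instance =
  fixes n :: nat and F :: cnf and w :: nat
  assumes len: "\<And>cl. cl \<in> set F \<Longrightarrow> length cl \<le> w"
    and vars: "\<And>cl v b. cl \<in> set F \<Longrightarrow> (v, b) \<in> set cl \<Longrightarrow> v < n"
begin

definition lo :: nat where "lo = n - n div 2"
definition hi :: nat where "hi = n div 2"
definition ys :: "nat list" where "ys = [n, length F] @ concat (map clause_code F)"
definition pos_of :: "nat \<Rightarrow> nat" where "pos_of j = 2 + length (concat (map clause_code (take j F)))"

lemma pos_of_0: "pos_of 0 = 2" by (simp add: pos_of_def)

lemma pos_of_Suc: "j < length F \<Longrightarrow> pos_of (Suc j) = pos_of j + 1 + 2 * length (F ! j)"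
  by (simp add: pos_of_def take_Suc_conv_app_nth length_clause_code)

lemma arr_ys:
  assumes j: "j < length F"
  shows "arr ys (pos_of j) = length (F ! j)"
    and "t < length (F ! j) \<Longrightarrow> arr ys (pos_of j + 1 + 2 * t) = fst (F ! j ! t)"
    and "t < length (F ! j) \<Longrightarrow> arr ys (Suc (pos_of j + 1 + 2 * t)) = of_bool (snd (F ! j ! t))"
proof -
  let ?P = "[n, length F] @ concat (map clause_code (take j F))"
  let ?S = "concat (map clause_code (drop (Suc j) F))"
  have "F = take j F @ F ! j # drop (Suc j) F" using j by (rule id_take_nth_drop)
  then have "concat (map clause_code F) = concat (map clause_code (take j F @ F ! j # drop (Suc j) F))" by simp
  then have ys: "ys = ?P @ clause_code (F ! j) @ ?S" by (simp add: ys_def)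
  have P: "length ?P = pos_of j" by (simp add: pos_of_def)
  have *: "arr ys (pos_of j + k) = clause_code (F ! j) ! k" if "k < length (clause_code (F ! j))" for k
  proof -
    have "(?P @ clause_code (F ! j) @ ?S) ! (length ?P + k) = clause_code (F ! j) ! k"
      using that by (simp only: nth_append_length_plus) (simp add: nth_append)
    moreover have "length ?P + k < length ys" using that unfolding ys by simp
    ultimately show ?thesis unfolding arr_def P[symmetric] ys[symmetric] by simp
  qed
  show "arr ys (pos_of j) = length (F ! j)"
    using *[of 0] by (simp add: clause_code_def)
  show "arr ys (pos_of j + 1 + 2 * t) = fst (F ! j ! t)" if "t < length (F ! j)"
    using *[of "Suc (2 * t)"] that nth_literal_codes(1)[OF that]
    by (simp add: length_clause_code) (simp add: clause_code_def)
  show "arr ys (Suc (pos_of j + 1 + 2 * t)) = of_bool (snd (F ! j ! t))" if "t < length (F ! j)"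
    using *[of "Suc (Suc (2 * t))"] that nth_literal_codes(2)[OF that]
    by (simp add: length_clause_code) (simp add: clause_code_def)
qed

text \<open>The last conjunct reserves array 6: while the first half works with array 5, the array
  of the second half must stay blank.\<close>

definition base :: "nat list \<Rightarrow> nat \<Rightarrow> (nat \<Rightarrow> nat) \<Rightarrow> (nat \<Rightarrow> nat \<Rightarrow> nat) \<Rightarrow> bool" where
  "base xs Bt R M \<longleftrightarrow> R 0 = 0 \<and> R 1 = 1 \<and> R 5 = length F \<and> R 6 = lo \<and> R 7 = hi \<and> M 0 = arr ys \<and>
     M 2 = arr xs \<and> R 3 = length xs \<and> (Bt = 5 \<longrightarrow> M 6 = (\<lambda>_. 0))"

definition rows :: "nat \<Rightarrow> nat \<Rightarrow> nat \<Rightarrow> nat list" where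
  "rows bv k a = map (\<lambda>cl. of_bool (unsat_row bv k a cl)) F"

text \<open>Both halves are verified at once. \<open>Bt\<close> is the array of values; registers
  \<open>bs\<close> and \<open>cr\<close> hold the first variable \<open>bv\<close> and the number
  \<open>k\<close> of variables. In the first half register 0 can serve as \<open>bs\<close>, since
  \<open>bv = 0\<close>.\<close>

context
  fixes Bt bs cr bv k :: nat
  assumes half: "Bt = 5 \<and> bs = 0 \<and> cr = 6 \<and> bv = 0 \<and> k = lo \<or> Bt = 6 \<and> bs = 6 \<and> cr = 7 \<and> bv = lo \<and> k = hi"
begin

lemma base_regs: "base xs Bt R M \<Longrightarrow> R bs = bv \<and> R cr = k"
  using half by (auto simp: base_def)

definition outside :: "(nat \<Rightarrow> nat \<Rightarrow> nat) \<Rightarrow> bool" where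
  "outside M \<longleftrightarrow> (\<forall>v. v < bv \<or> bv + k \<le> v \<longrightarrow> M Bt v = 0)"

definition table :: "nat \<Rightarrow> (nat \<Rightarrow> nat \<Rightarrow> nat) \<Rightarrow> bool" where
  "table y M \<longleftrightarrow> (\<forall>x<y. M 3 x = x div 2 \<and> M 4 x = x mod 2)"

lemma hoare_power: "hoare (\<lambda>R M. base xs Bt R M \<and> outside M) (power_prog cr) (3 + k * (6 + 2 ^ k * 4))
    (\<lambda>R M. base xs Bt R M \<and> outside M \<and> R 8 = 2 ^ k)"
proof -
  let ?I = "\<lambda>i R M. base xs Bt R M \<and> outside M \<and> R 8 = 2 ^ i"
  have a: "hoare (\<lambda>R M. base xs Bt R M \<and> outside M) (Const 8 1) 1 (?I 0)"
    by (rule hoare_while_free) (auto simp: base_def)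
  have b: "hoare (?I 0) (for_loop 9 cr (block [Const 11 0, for_loop 10 8 (block [inc 11, inc 11]), copy 8 11]))
      (2 + k * ((4 + 2 ^ k * 4) + 2)) (?I k)"
  proof (rule hoare_for_loop)
    fix i assume i: "i < k"
    have 1: "hoare (\<lambda>R M. ?I i R M \<and> R 9 = i) (Const 11 0) 1 (\<lambda>R M. ?I i R M \<and> R 9 = i \<and> R 11 = 2 * 0)"
      by (rule hoare_while_free) (auto simp: base_def)
    have 2: "hoare (\<lambda>R M. ?I i R M \<and> R 9 = i \<and> R 11 = 2 * 0) (for_loop 10 8 (block [inc 11, inc 11]))
        (2 + 2 ^ i * (2 + 2)) (\<lambda>R M. ?I i R M \<and> R 9 = i \<and> R 11 = 2 * 2 ^ i)"
      by (rule hoare_for_loop[where I = "\<lambda>j R M. ?I i R M \<and> R 9 = i \<and> R 11 = 2 * j"])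
        (auto simp: base_def inc_def intro!: hoare_while_free)
    have 3: "hoare (\<lambda>R M. ?I i R M \<and> R 9 = i \<and> R 11 = 2 * 2 ^ i) (copy 8 11) 1
        (\<lambda>R M. ?I (Suc i) R M \<and> R 9 = i)"
      by (rule hoare_while_free) (auto simp: base_def copy_def)
    have "(2::nat) ^ i \<le> 2 ^ k" using i by (intro power_increasing) auto
    then show "hoare (\<lambda>R M. ?I i R M \<and> R 9 = i)
        (block [Const 11 0, for_loop 10 8 (block [inc 11, inc 11]), copy 8 11]) (4 + 2 ^ k * 4)
        (\<lambda>R M. ?I (Suc i) R M \<and> R 9 = i)"
      unfolding block.simps by (intro hoare_conseq[OF hoare_Seq[OF 1 hoare_Seq[OF 2[unfolded block.simps] 3]]]) auto
  qed (use half base_regs in \<open>auto simp: base_def\<close>)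
  from hoare_Seq[OF a b] show ?thesis unfolding power_prog_def
    by (rule hoare_conseq) auto
qed

lemma hoare_table: "hoare (\<lambda>R M. base xs Bt R M \<and> outside M \<and> R 8 = 2 ^ k) table_prog (3 + 2 ^ k * 8)
    (\<lambda>R M. base xs Bt R M \<and> outside M \<and> R 8 = 2 ^ k \<and> table (2 * 2 ^ k) M)"
proof -
  let ?I = "\<lambda>i R M. base xs Bt R M \<and> outside M \<and> R 8 = 2 ^ k \<and> table (2 * i) M \<and> R 19 = 2 * i"
  have a: "hoare (\<lambda>R M. base xs Bt R M \<and> outside M \<and> R 8 = 2 ^ k) (Const 19 0) 1 (?I 0)"
    by (rule hoare_while_free) (auto simp: base_def table_def)
  have b: "hoare (?I 0) (for_loop 9 8 (block
     [Store 3 19 9, Store 4 19 0, inc 19, Store 3 19 9, Store 4 19 1, inc 19])) (2 + 2 ^ k * (6 + 2)) (?I (2 ^ k))"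
    by (rule hoare_for_loop)
      (use half in \<open>auto simp: base_def table_def inc_def outside_def less_Suc_eq intro!: hoare_while_free\<close>)
  from hoare_Seq[OF a b] show ?thesis unfolding table_prog_def
    by (rule hoare_conseq) auto
qed

definition assigned :: "nat \<Rightarrow> (nat \<Rightarrow> nat \<Rightarrow> nat) \<Rightarrow> bool" where
  "assigned a M \<longleftrightarrow> outside M \<and> (\<forall>i<k. M Bt (bv + i) = Suc (a div 2 ^ i mod 2))"

text \<open>Register 12 runs through \<open>a div 2 ^ i\<close> by table lookups. All
  \<open>k\<close> entries are written anew, so leftovers of the previous assignment do no harm and
  \<open>outside\<close> is a sufficient precondition.\<close>

lemma hoare_decode:
  assumes a: "a < 2 ^ k"
  shows "hoare (\<lambda>R M. (base xs Bt R M \<and> outside M \<and> R 8 = 2 ^ k \<and> table (2 * 2 ^ k) M) \<and> R 9 = a)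
    (decode_prog Bt bs cr) (4 + k * 7)
    (\<lambda>R M. base xs Bt R M \<and> assigned a M \<and> R 8 = 2 ^ k \<and> table (2 * 2 ^ k) M \<and> R 9 = a)"
proof -
  let ?I = "\<lambda>i R M. base xs Bt R M \<and> outside M \<and> R 8 = 2 ^ k \<and> table (2 * 2 ^ k) M \<and> R 9 = a \<and>
    R 12 = a div 2 ^ i \<and> R 13 = bv + i \<and> (\<forall>i'<i. M Bt (bv + i') = Suc (a div 2 ^ i' mod 2))"
  have 1: "hoare (\<lambda>R M. (base xs Bt R M \<and> outside M \<and> R 8 = 2 ^ k \<and> table (2 * 2 ^ k) M) \<and> R 9 = a)
      (block [copy 12 9, copy 13 bs]) 2 (?I 0)"
    by (rule hoare_while_free) (use half in \<open>auto simp: base_def copy_def\<close>)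
  have 2: "hoare (?I 0) (for_loop 10 cr (block [Load 14 4 12, inc 14, Store Bt 13 14, Load 12 3 12, inc 13]))
      (2 + k * (5 + 2)) (?I k)"
  proof (rule hoare_for_loop)
    fix i assume i: "i < k"
    have "a div 2 ^ i \<le> a" by simp
    then have lt: "a div 2 ^ i < 2 * 2 ^ k" using a by linarith
    have dd: "a div 2 ^ i div 2 = a div (2 * 2 ^ i)" by (simp add: div_mult2_eq[symmetric] mult.commute)
    show "hoare (\<lambda>R M. ?I i R M \<and> R 10 = i)
        (block [Load 14 4 12, inc 14, Store Bt 13 14, Load 12 3 12, inc 13]) 5
        (\<lambda>R M. ?I (Suc i) R M \<and> R 10 = i)"
      by (rule hoare_while_free)
        (use half i lt in \<open>auto simp: base_def table_def inc_def outside_def less_Suc_eq dd\<close>)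
  qed (use half base_regs in \<open>auto simp: base_def\<close>)
  from hoare_Seq[OF 1 2] show ?thesis unfolding decode_prog_def
    by (rule hoare_conseq) (auto simp: assigned_def)
qed

text \<open>Shifting the values by 1 distinguishes the value false from the absence of a
  value.\<close>

lemma assigned_iff:
  assumes "assigned a M"
  shows "M Bt (fst l) = Suc (of_bool (snd l)) \<longleftrightarrow> lit_true bv k a l"
proof (cases "bv \<le> fst l \<and> fst l < bv + k")
  case True
  then have "M Bt (bv + (fst l - bv)) = Suc (a div 2 ^ (fst l - bv) mod 2)"
    using assms unfolding assigned_def by (metis less_diff_conv2 add.commute)
  then show ?thesis using True by (auto simp: lit_true_def odd_iff_mod_2_eq_one)
next
  case False
  then have "M Bt (fst l) = 0" using assms by (auto simp: assigned_def outside_def)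
  then show ?thesis using False by (auto simp: lit_true_def)
qed

lemma hoare_clause:
  assumes j: "j < length F"
  shows "hoare (\<lambda>R M. base xs Bt R M \<and> assigned a M \<and> R 8 = 2 ^ k \<and> table (2 * 2 ^ k) M \<and> R 9 = a \<and>
      R 2 = pos_of j \<and> R 10 = j) (clause_prog Bt) (7 + w * 13)
    (\<lambda>R M. base (xs @ [of_bool (unsat_row bv k a (F ! j))]) Bt R M \<and> assigned a M \<and> R 8 = 2 ^ k \<and>
      table (2 * 2 ^ k) M \<and> R 9 = a \<and> R 2 = pos_of (Suc j) \<and> R 10 = j)"
proof -
  let ?cl = "F ! j"
  let ?body = "block [Load 13 0 2, inc 2, Load 14 0 2, inc 2, inc 14, Load 15 Bt 13,
       If 15 14 Skip (If 14 15 Skip (Const 16 0))]"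
  let ?K = "\<lambda>R M. base xs Bt R M \<and> assigned a M \<and> R 8 = 2 ^ k \<and> table (2 * 2 ^ k) M \<and> R 9 = a \<and> R 10 = j"
  let ?I = "\<lambda>t R M. ?K R M \<and> R 17 = length ?cl \<and> R 2 = pos_of j + 1 + 2 * t \<and>
    R 16 = of_bool (\<not> (\<exists>t'<t. lit_true bv k a (?cl ! t')))"
  have 1: "hoare (\<lambda>R M. base xs Bt R M \<and> assigned a M \<and> R 8 = 2 ^ k \<and> table (2 * 2 ^ k) M \<and> R 9 = a \<and>
      R 2 = pos_of j \<and> R 10 = j) (block [Load 17 0 2, inc 2, Const 16 1]) 3 (?I 0)"
    by (rule hoare_while_free) (use arr_ys(1)[OF j] in \<open>auto simp: base_def inc_def\<close>)
  have 2: "hoare (?I 0) (for_loop 18 17 ?body) (2 + length ?cl * (11 + 2)) (?I (length ?cl))"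
  proof (rule hoare_for_loop)
    fix t assume t: "t < length ?cl"
    show "hoare (\<lambda>R M. ?I t R M \<and> R 18 = t) ?body 11 (\<lambda>R M. ?I (Suc t) R M \<and> R 18 = t)"
    proof (rule hoare_while_free)
      fix R M assume I: "?I t R M \<and> R 18 = t"
      have ex: "(\<exists>t'<Suc t. lit_true bv k a (?cl ! t')) \<longleftrightarrow>
          (\<exists>t'<t. lit_true bv k a (?cl ! t')) \<or> M Bt (fst (?cl ! t)) = Suc (of_bool (snd (?cl ! t)))"
        using assigned_iff[of a M "?cl ! t"] I by (auto simp: less_Suc_eq)
      show "case eval_com ?body (R, M) of (R', M') \<Rightarrow> ?I (Suc t) R' M' \<and> R' 18 = t"
        using I arr_ys(2,3)[OF j t] unfolding ex by (auto simp: base_def inc_def)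
    qed (auto simp: inc_def)
  qed (auto simp: base_def)
  have 3: "hoare (?I (length ?cl)) (emit2 16) 2
    (\<lambda>R M. base (xs @ [of_bool (unsat_row bv k a ?cl)]) Bt R M \<and> assigned a M \<and> R 8 = 2 ^ k \<and>
      table (2 * 2 ^ k) M \<and> R 9 = a \<and> R 2 = pos_of (Suc j) \<and> R 10 = j)"
  proof -
    have "unsat_row bv k a ?cl \<longleftrightarrow> \<not> (\<exists>t'<length ?cl. lit_true bv k a (?cl ! t'))"
      unfolding unsat_row_def by (metis in_set_conv_nth)
    then show ?thesis
      by (intro hoare_while_free)
        (use half pos_of_Suc[OF j] in \<open>auto simp: base_def emit2_def inc_def assigned_def outside_def table_def\<close>)
  qed
  have "length ?cl \<le> w" using len j by simp
  then show ?thesis unfolding clause_prog_def block.simps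
    by (intro hoare_conseq[OF hoare_Seq[OF 1[unfolded block.simps] hoare_Seq[OF 2[unfolded block.simps] 3]]]) auto
qed

lemma hoare_half:
  "hoare (\<lambda>R M. base xs Bt R M \<and> outside M) (half_prog Bt bs cr)
    (100 * (2 ^ k * (k + 1) * (length F + 1) * (w + 1)))
    (base (xs @ 2 ^ k # concat (map (rows bv k) [0..<2 ^ k])) Bt)"
proof -
  let ?body = "block [decode_prog Bt bs cr, block [Const 2 1, inc 2], for_loop 10 5 (clause_prog Bt)]"
  let ?I = "\<lambda>zs R M. base zs Bt R M \<and> outside M \<and> R 8 = 2 ^ k \<and> table (2 * 2 ^ k) M"
  let ?J = "\<lambda>a zs R M. base zs Bt R M \<and> assigned a M \<and> R 8 = 2 ^ k \<and> table (2 * 2 ^ k) M \<and> R 9 = a"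
  have e: "hoare (?I zs) (emit2 8) 2 (?I (zs @ [2 ^ k]))" for zs
    by (rule hoare_while_free)
      (use half in \<open>auto simp: base_def emit2_def inc_def outside_def table_def\<close>)
  have body: "hoare (\<lambda>R M. ?I zs R M \<and> R 9 = a)
      ?body
      (4 + k * 7 + (2 + (2 + length F * (7 + w * 13 + 2)))) (\<lambda>R M. ?I (zs @ rows bv k a) R M \<and> R 9 = a)"
    if a: "a < 2 ^ k" for a zs
  proof -
    let ?C = "\<lambda>j R M. ?J a (zs @ map (\<lambda>cl. of_bool (unsat_row bv k a cl)) (take j F)) R M \<and> R 2 = pos_of j"
    have 1: "hoare (?J a zs) (block [Const 2 1, inc 2]) 2 (?C 0)"
      by (rule hoare_while_free) (auto simp: base_def inc_def pos_of_0)
    have 2: "hoare (?C 0) (for_loop 10 5 (clause_prog Bt)) (2 + length F * (7 + w * 13 + 2)) (?C (length F))"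
    proof (rule hoare_for_loop)
      fix j assume j: "j < length F"
      show "hoare (\<lambda>R M. ?C j R M \<and> R 10 = j) (clause_prog Bt) (7 + w * 13) (\<lambda>R M. ?C (Suc j) R M \<and> R 10 = j)"
        by (rule hoare_conseq[OF hoare_clause[OF j,
          of "zs @ map (\<lambda>cl. of_bool (unsat_row bv k a cl)) (take j F)" a]])
          (use j in \<open>auto simp: take_Suc_conv_app_nth\<close>)
    qed (auto simp: base_def)
    show ?thesis unfolding block.simps
      by (rule hoare_conseq[OF hoare_Seq[OF hoare_decode[OF a] hoare_Seq[OF 1[unfolded block.simps] 2]]])
        (auto simp: rows_def assigned_def)
  qed
  have loop: "hoare (?I (zs @ concat (map (rows bv k) [0..<0])))
      (for_loop 9 8 ?body)
      (2 + 2 ^ k * ((4 + k * 7 + (2 + (2 + length F * (7 + w * 13 + 2)))) + 2))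
      (?I (zs @ concat (map (rows bv k) [0..<2 ^ k])))" for zs
  proof (rule hoare_for_loop[where I = "\<lambda>a. ?I (zs @ concat (map (rows bv k) [0..<a]))"])
    fix a :: nat assume "a < 2 ^ k"
    from body[OF this, of "zs @ concat (map (rows bv k) [0..<a])"]
    show "hoare (\<lambda>R M. ?I (zs @ concat (map (rows bv k) [0..<a])) R M \<and> R 9 = a)
      ?body
      (4 + k * 7 + (2 + (2 + length F * (7 + w * 13 + 2))))
      (\<lambda>R M. ?I (zs @ concat (map (rows bv k) [0..<Suc a])) R M \<and> R 9 = a)" by simp
  qed (auto simp: base_def)
  define P :: nat where "P = 2 ^ k"
  have P: "1 \<le> P" "k \<le> P * k" by (auto simp: P_def)
  have time: "3 + k * (6 + P * 4) + (3 + P * 8 + (2 + (2 + P * ((4 + k * 7 + (2 + (2 + length F * (7 + w * 13 + 2)))) + 2))))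
      \<le> 100 * (P * (k + 1) * (length F + 1) * (w + 1))"
  proof -
    have "k * 6 \<le> P * (k * 89)" using mult_le_mono[OF P(1) order_refl[of "k * 89"]] by linarith
    then have "10 + k * 6 \<le> P * 82 + P * (k * 89)" using P(1) by linarith
    then show ?thesis by (simp add: algebra_simps)
  qed
  note * = hoare_Seq[OF hoare_power hoare_Seq[OF hoare_table hoare_Seq[OF e loop[unfolded upt_0 list.map concat.simps append_Nil2]]]]
  show ?thesis unfolding half_prog_def block.simps
    by (rule hoare_conseq[OF *[unfolded block.simps]]) (use time in \<open>auto simp: P_def\<close>)
qed

end

definition ub :: "nat \<Rightarrow> nat \<Rightarrow> bool" where "ub a j \<longleftrightarrow> unsat_row 0 lo a (F ! j)"
definition vb :: "nat \<Rightarrow> nat \<Rightarrow> bool" where "vb a j \<longleftrightarrow> unsat_row lo hi a (F ! j)"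

lemma lo_hi: "lo + hi = n" "hi \<le> lo"
  by (auto simp: lo_def hi_def)

lemma hoare_sat:
  "hoare (\<lambda>R M. R = (\<lambda>_. 0)(1 := 1) \<and> M = snd (initial_state ys)) sat_prog
    (300 * (2 ^ lo * (n + 1) * (length F + 1) * (w + 1)))
    (\<lambda>R M. R 0 = 0 \<and> R 1 = 1 \<and> ov_input (M 2) (length F) (2 ^ lo) (2 ^ hi) ub vb)"
proof -
  let ?K = "\<lambda>R M. R 0 = 0 \<and> R 1 = 1 \<and> R 5 = length F \<and> M 0 = arr ys \<and> M 2 = (\<lambda>_. 0) \<and> M 5 = (\<lambda>_. 0) \<and> M 6 = (\<lambda>_. 0)"
  let ?r1 = "rows 0 lo" and ?r2 = "rows lo hi"
  have a: "hoare (\<lambda>R M. R = (\<lambda>_. 0)(1 := 1) \<and> M = snd (initial_state ys))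
      (block [Const 2 0, Load 4 0 2, inc 2, Load 5 0 2, Const 6 0, copy 7 4]) 6
      (\<lambda>R M. ?K R M \<and> R 6 = 0 \<and> R 7 = n - 0)"
    by (rule hoare_while_free) (auto simp: inc_def copy_def initial_state_def arr_def ys_def fun_eq_iff)
  \<comment> \<open>One register goes up and the other down until the first is no longer smaller;
    \<open>i < n - i\<close> holds exactly for \<open>i < lo\<close>, so they end as
    \<open>lo\<close> and \<open>hi\<close>.\<close>
  have b: "hoare (\<lambda>R M. ?K R M \<and> R 6 = 0 \<and> R 7 = n - 0) (While 6 7 (Seq (inc 6) (Sub 7 7 1)))
      (Suc (lo * Suc 2)) (\<lambda>R M. ?K R M \<and> R 6 = lo \<and> R 7 = n - lo)"
    by (rule hoare_While[where I = "\<lambda>i R M. ?K R M \<and> R 6 = i \<and> R 7 = n - i"])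
      (auto intro!: hoare_while_free simp: inc_def lo_def)
  have c: "hoare (\<lambda>R M. ?K R M \<and> R 6 = lo \<and> R 7 = n - lo) (block [Const 3 0, emit2 0, emit2 5]) 5
      (\<lambda>R M. base [0, length F] 5 R M \<and> outside 5 0 lo M)"
    by (rule hoare_while_free)
      (auto simp: emit2_def inc_def base_def lo_def hi_def outside_def arr_def fun_eq_iff less_Suc_eq)
  have h1: "hoare (\<lambda>R M. base xs 5 R M \<and> outside 5 0 lo M) (half_prog 5 0 6)
      (100 * (2 ^ lo * (lo + 1) * (length F + 1) * (w + 1)))
      (base (xs @ 2 ^ lo # concat (map ?r1 [0..<2 ^ lo])) 5)" for xs
    by (rule hoare_half) simp
  have h2: "hoare (\<lambda>R M. base xs 6 R M \<and> outside 6 lo hi M) (half_prog 6 6 7)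
      (100 * (2 ^ hi * (hi + 1) * (length F + 1) * (w + 1)))
      (base (xs @ 2 ^ hi # concat (map ?r2 [0..<2 ^ hi])) 6)" for xs
    by (rule hoare_half) simp
  have h2': "hoare (base xs 5) (half_prog 6 6 7) (100 * (2 ^ hi * (hi + 1) * (length F + 1) * (w + 1)))
      (base (xs @ 2 ^ hi # concat (map ?r2 [0..<2 ^ hi])) 6)" for xs
    by (rule hoare_conseq[OF h2]) (auto simp: base_def outside_def)
  have inp: "ov_input (arr (([0, length F] @ 2 ^ lo # concat (map ?r1 [0..<2 ^ lo])) @ 2 ^ hi # concat (map ?r2 [0..<2 ^ hi])))
      (length F) (2 ^ lo) (2 ^ hi) ub vb"
    using ov_input_arr[of "2 ^ lo" ?r1 "length F" "2 ^ hi" ?r2 ub vb 0]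
    by (simp add: rows_def ub_def vb_def)
  define Y where "Y = 2 ^ lo * (n + 1) * (length F + 1) * (w + 1)"
  have "2 ^ lo * (lo + 1) * (length F + 1) * (w + 1) \<le> Y" "2 ^ hi * (hi + 1) * (length F + 1) * (w + 1) \<le> Y"
    unfolding Y_def using lo_hi by (intro mult_le_mono; simp)+
  moreover have "lo + 1 \<le> Y"
  proof -
    have "1 * (lo + 1) * 1 * 1 \<le> Y" unfolding Y_def using lo_hi by (intro mult_le_mono) auto
    then show ?thesis by simp
  qed
  moreover have "6 + (Suc (l * Suc 2) + (5 + (100 * p + 100 * q))) \<le> 300 * y"
    if "p \<le> y" "q \<le> y" "l + 1 \<le> y" for p q l y :: nat
    using that by simp
  ultimately have time: "6 + (Suc (lo * Suc 2) + (5 + (100 * (2 ^ lo * (lo + 1) * (length F + 1) * (w + 1)) +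
      100 * (2 ^ hi * (hi + 1) * (length F + 1) * (w + 1))))) \<le> 300 * Y" by blast
  show ?thesis unfolding sat_prog_def block.simps
    by (rule hoare_conseq[OF hoare_Seq[OF a[unfolded block.simps] hoare_Seq[OF b
      hoare_Seq[OF c[unfolded block.simps] hoare_Seq[OF h1 h2']]]]])
      (use time inp in \<open>auto simp: base_def Y_def\<close>)
qed

lemma exists_with_bits: "\<exists>a<(2 :: nat) ^ k. \<forall>i<k. odd (a div 2 ^ i) = f i"
proof (intro exI conjI allI impI)
  let ?a = "horner_sum of_bool 2 (map f [0..<k]) :: nat"
  show "?a < 2 ^ k" using horner_sum_of_bool_2_less[of "map f [0..<k]"] by simp
  show "odd (?a div 2 ^ i) = f i" if "i < k" for i
    using that bit_horner_sum_bit_iff[of "map f [0..<k]" i, where 'a = nat] by (simp add: bit_iff_odd)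
qed

text \<open>An assignment is a pair of half assignments, and it satisfies a clause iff one of the
  halves already makes a literal of it true.\<close>

lemma satisfiable_iff: "satisfiable F \<longleftrightarrow>
    (\<exists>i<2 ^ lo. \<exists>l<2 ^ hi. \<forall>j<length F. \<not> (ub i j \<and> vb l j))"
proof
  assume "satisfiable F"
  then obtain \<alpha> where \<alpha>: "\<And>cl. cl \<in> set F \<Longrightarrow> \<exists>(v, b)\<in>set cl. \<alpha> v = b" by (auto simp: satisfiable_def)
  obtain a :: nat where a: "a < 2 ^ lo" "\<And>i. i < lo \<Longrightarrow> odd (a div 2 ^ i) = \<alpha> i"
    using exists_with_bits[of lo \<alpha>] by blast
  obtain b :: nat where b: "b < 2 ^ hi" "\<And>i. i < hi \<Longrightarrow> odd (b div 2 ^ i) = \<alpha> (lo + i)"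
    using exists_with_bits[of hi "\<lambda>i. \<alpha> (lo + i)"] by blast
  have "\<not> (ub a j \<and> vb b j)" if "j < length F" for j
  proof -
    have cl: "F ! j \<in> set F" using that by simp
    from \<alpha>[OF this] obtain v where v: "(v, \<alpha> v) \<in> set (F ! j)" by auto
    have "v < n" using vars[OF cl v] .
    show ?thesis
    proof (cases "v < lo")
      case True
      then have "lit_true 0 lo a (v, \<alpha> v)" using a(2) by (simp add: lit_true_def)
      then show ?thesis using v by (auto simp: ub_def unsat_row_def)
    next
      case False
      then have "lit_true lo hi b (v, \<alpha> v)"
        using b(2)[of "v - lo"] \<open>v < n\<close> lo_hi by (simp add: lit_true_def)
      then show ?thesis using v by (auto simp: vb_def unsat_row_def)
    qed
  qed
  with a b show "\<exists>i<2 ^ lo. \<exists>l<2 ^ hi. \<forall>j<length F. \<not> (ub i j \<and> vb l j)" by blast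
next
  assume "\<exists>i<2 ^ lo. \<exists>l<2 ^ hi. \<forall>j<length F. \<not> (ub i j \<and> vb l j)"
  then obtain a b where ab: "\<And>j. j < length F \<Longrightarrow> \<not> (ub a j \<and> vb b j)" by blast
  define \<alpha> where "\<alpha> v = (if v < lo then odd (a div 2 ^ v) else odd (b div 2 ^ (v - lo)))" for v
  have "\<exists>(v, b)\<in>set cl. \<alpha> v = b" if "cl \<in> set F" for cl
  proof -
    from that obtain j where j: "j < length F" "cl = F ! j" by (auto simp: in_set_conv_nth)
    from ab[OF j(1)] obtain l where "l \<in> set cl" "lit_true 0 lo a l \<or> lit_true lo hi b l"
      by (auto simp: ub_def vb_def unsat_row_def j(2))
    then show ?thesis by (intro bexI[of _ l]) (auto simp: lit_true_def \<alpha>_def)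
  qed
  then show "satisfiable F" unfolding satisfiable_def by blast
qed

end

section \<open>The lower bounds\<close>

text \<open>A logarithm is below every positive power:
  \<open>ln x \<le> x powr \<delta> / \<delta>\<close>. The asymptotic bound speaks of large
  \<open>N\<close> only; the sum \<open>s\<close> over the small ones extends the estimate down to
  \<open>N = 1\<close>.\<close>

lemma dimension_bound:
  assumes D: "(\<lambda>N. real (D N)) \<in> \<Theta>(\<lambda>N. ln (real N))" and \<delta>: "\<delta> > 0"
  obtains c where "1 \<le> c" "\<And>N. 1 \<le> N \<Longrightarrow> real (D N + 1) \<le> c * real N powr \<delta>"
proof -
  from D have "(\<lambda>N. real (D N)) \<in> O(\<lambda>N. ln (real N))" by (rule bigthetaD1)
  then obtain b where b: "b > 0" "eventually (\<lambda>N. norm (real (D N)) \<le> b * norm (ln (real N))) sequentially"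
    by (auto elim: landau_o.bigE)
  then obtain N0 where N0: "\<And>N. N \<ge> N0 \<Longrightarrow> real (D N) \<le> b * \<bar>ln (real N)\<bar>"
    by (auto simp: eventually_sequentially)
  define s where "s = (\<Sum>i<N0. real (D i))"
  have s: "0 \<le> s" by (simp add: s_def sum_nonneg)
  show thesis
  proof (rule that[of "1 + b / \<delta> + s"])
    show "1 \<le> 1 + b / \<delta> + s" using b \<delta> s by simp
    fix N :: nat assume N: "1 \<le> N"
    have one: "1 \<le> real N powr \<delta>" using N \<delta> by (intro ge_one_powr_ge_zero) auto
    have "real (D N) \<le> (b / \<delta> + s) * real N powr \<delta>"
    proof (cases "N0 \<le> N")
      case True
      have "real (D N) \<le> b * ln (real N)" using N0[OF True] N by simp
      also have "\<dots> \<le> b * (real N powr \<delta> / \<delta>)"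
        using ln_powr_bound[of "real N" \<delta>] N \<delta> b by (intro mult_left_mono) auto
      also have "\<dots> \<le> (b / \<delta> + s) * real N powr \<delta>" using s by (simp add: field_simps)
      finally show ?thesis .
    next
      case False
      then have "real (D N) \<le> s" unfolding s_def by (intro member_le_sum) auto
      also have "\<dots> \<le> s * real N powr \<delta>" using s one by (simp add: mult_le_cancel_left1)
      also have "\<dots> \<le> (b / \<delta> + s) * real N powr \<delta>" using b \<delta> by (intro mult_right_mono) auto
      finally show ?thesis .
    qed
    then show "real (D N + 1) \<le> (1 + b / \<delta> + s) * real N powr \<delta>"
      using one by (simp add: algebra_simps)
  qed
qed

lemma initial_array: "snd (initial_state xs) 0 = arr xs"
  by (auto simp: initial_state_def arr_def)

text \<open>The program is the same for all \<open>D\<close>; only the constant depends on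
  \<open>D\<close>. With \<open>D N + 1\<close> at most \<open>c * N powr (\<epsilon>/4)\<close>,
  the exponent of \<open>N\<close> is \<open>(1 + \<epsilon>/4) * (2 - \<epsilon>)\<close>, which is
  below \<open>2 - \<epsilon>/2\<close>.\<close>

lemma ov_solver_not_OVC:
  assumes solver: "ov_solver p z r \<epsilon> K" and K: "0 \<le> K" and \<epsilon>: "0 < \<epsilon>" "\<epsilon> \<le> 1/4"
  shows "\<not> OVC"
proof -
  let ?p = "total_prog Skip 0 z r p"
  have "solves_in_O ?p (ov_problem D) (\<lambda>(N, S1, S2) xs. real N powr (2 - \<epsilon>/2))"
    if D: "(\<lambda>N. real (D N)) \<in> \<Theta>(\<lambda>N. ln (real N))" for D
  proof -
    obtain c where c: "1 \<le> c" "\<And>N. 1 \<le> N \<Longrightarrow> real (D N + 1) \<le> c * real N powr (\<epsilon>/4)"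
      using dimension_bound[OF D, of "\<epsilon>/4"] \<epsilon> by auto
    define C0 where "C0 = (20 * 604 powr (3/2) + 3 * K) * c powr (2 - \<epsilon>)"
    have "\<exists>k s. exec ?p (initial_state xs) k s \<and> decides (\<exists>u\<in>S1. \<exists>v\<in>S2. (\<Sum>i<D N. u ! i * v ! i) = 0) (result_of s) \<and>
        real k \<le> C0 * real N powr (2 - \<epsilon>/2)"
      if N: "1 \<le> N" and S: "S1 \<subseteq> bit_vectors (D N)" "S2 \<subseteq> bit_vectors (D N)" "card S1 \<le> N" "card S2 \<le> N"
        and codes: "vectors_code S1 c1" "vectors_code S2 c2" "xs = [N, D N] @ c1 @ c2" for N S1 S2 xs c1 c2
    proof -
      define d where "d = D N"
      from codes(1) obtain us where us: "distinct us" "set us = S1" "c1 = length us # concat us"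
        by (auto simp: vectors_code_def)
      from codes(2) obtain vs where vs: "distinct vs" "set vs = S2" "c2 = length vs # concat vs"
        by (auto simp: vectors_code_def)
      define ub where "ub i j \<longleftrightarrow> us ! i ! j = 1" for i j
      define vb where "vb i j \<longleftrightarrow> vs ! i ! j = 1" for i j
      have n12: "length us \<le> N" "length vs \<le> N"
        using S(3,4) us vs distinct_card[of us] distinct_card[of vs] by auto
      have bits: "length u = d" "j < d \<Longrightarrow> u ! j = of_bool (u ! j = 1)" if "u \<in> S1 \<union> S2" for u j
      proof -
        have u: "length u = d" "set u \<subseteq> {0, 1}" using that S(1,2) by (auto simp: bit_vectors_def d_def)
        show "length u = d" by (rule u)
        show "u ! j = of_bool (u ! j = 1)" if "j < d" using u nth_mem[of j u] that by fastforce
      qed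
      have ulen: "length (us ! i) = d" and ubit: "\<And>j. j < d \<Longrightarrow> us ! i ! j = of_bool (ub i j)" if "i < length us" for i
        unfolding ub_def by (rule bits; use that us(2) in auto)+
      have vlen: "length (vs ! i) = d" and vbit: "\<And>j. j < d \<Longrightarrow> vs ! i ! j = of_bool (vb i j)" if "i < length vs" for i
        unfolding vb_def by (rule bits; use that vs(2) in auto)+
      have xs: "xs = [N, d, length us] @ concat (map ((!) us) [0..<length us]) @ [length vs] @
          concat (map ((!) vs) [0..<length vs])"
        using codes(3) us(3) vs(3) by (simp add: map_nth d_def)
      have "ov_input (arr xs) d (length us) (length vs) ub vb"
        unfolding xs by (rule ov_input_arr) (use ulen vlen ubit vbit in auto)
      then have run: "hoare (\<lambda>R M. R = (\<lambda>_. 0)(1 := 1) \<and> M = snd (initial_state xs)) Skip 1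
          (\<lambda>R M. R 0 = 0 \<and> R 1 = 1 \<and> ov_input (M 0) d (length us) (length vs) ub vb)"
        by (intro hoare_while_free) (auto simp: initial_array)
      have "\<forall>u\<in>S1. set u \<subseteq> {0, 1}" "\<forall>u\<in>S2. set u \<subseteq> {0, 1}" using S by (auto simp: bit_vectors_def)
      then have B: "x \<le> N + d" if "x \<in> set xs" for x
        using that N n12 us(2) vs(2) codes(3) us(3) vs(3) by (fastforce simp: d_def)
      from total_prog_correct[OF solver K _ _ _ run B n12 N] obtain k s where
        run': "exec ?p (initial_state xs) k s"
        "decides (\<exists>i<length us. \<exists>l<length vs. \<forall>j<d. \<not> (ub i j \<and> vb l j)) (result_of s)"
        "real k \<le> 20 * real (N + d + 1 + 601 * (N * (d + 1))) powr (3/2) + 3 * (K * real (N * d) powr (2 - \<epsilon>))"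
        by auto
      have "(\<exists>i<length us. \<exists>l<length vs. \<forall>j<d. \<not> (ub i j \<and> vb l j)) \<longleftrightarrow>
          (\<exists>i<length us. \<exists>l<length vs. (\<Sum>j<d. us ! i ! j * vs ! l ! j) = 0)"
        using ubit vbit by (intro ex_cong1 conj_cong refl) (auto simp: of_bool_conj[symmetric])
      also have "\<dots> \<longleftrightarrow> (\<exists>u\<in>S1. \<exists>v\<in>S2. (\<Sum>i<D N. u ! i * v ! i) = 0)"
        unfolding us(2)[symmetric] vs(2)[symmetric] d_def by (simp add: Bex_def in_set_conv_nth) blast
      finally have orth: "(\<exists>i<length us. \<exists>l<length vs. \<forall>j<d. \<not> (ub i j \<and> vb l j)) \<longleftrightarrow>
        (\<exists>u\<in>S1. \<exists>v\<in>S2. (\<Sum>i<D N. u ! i * v ! i) = 0)" .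
      define Y where "Y = real (N * (d + 1))"
      have "1 \<le> N * (d + 1)" using N by simp
      then have Y1: "1 \<le> Y" unfolding Y_def by linarith
      have "N + d + 1 \<le> 2 * (N * (d + 1))"
      proof -
        have "d \<le> N * d" using N by simp
        moreover have "N * (d + 1) = N * d + N" by simp
        ultimately show ?thesis using N by linarith
      qed
      then have "N + d + 1 + 601 * (N * (d + 1)) \<le> 604 * (N * (d + 1))" by linarith
      then have "real (N + d + 1 + 601 * (N * (d + 1))) \<le> real (604 * (N * (d + 1)))" by (rule of_nat_mono)
      also have "\<dots> = 604 * Y" by (simp add: Y_def)
      finally have "real (N + d + 1 + 601 * (N * (d + 1))) powr (3/2) \<le> (604 * Y) powr (3/2)"
        by (intro powr_mono2) auto
      also have "\<dots> = 604 powr (3/2) * Y powr (3/2)" using Y1 by (simp add: powr_mult)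
      also have "\<dots> \<le> 604 powr (3/2) * Y powr (2 - \<epsilon>)"
        using Y1 \<epsilon> by (intro mult_left_mono powr_mono) auto
      finally have 1: "real (N + d + 1 + 601 * (N * (d + 1))) powr (3/2) \<le> 604 powr (3/2) * Y powr (2 - \<epsilon>)" .
      have "real (N * d) powr (2 - \<epsilon>) \<le> Y powr (2 - \<epsilon>)"
        using \<epsilon> unfolding Y_def by (intro powr_mono2) auto
      then have "K * real (N * d) powr (2 - \<epsilon>) \<le> K * Y powr (2 - \<epsilon>)" using K by (rule mult_left_mono)
      with 1 run'(3) have 2: "real k \<le> (20 * 604 powr (3/2) + 3 * K) * Y powr (2 - \<epsilon>)"
        by (simp add: algebra_simps)
      have "Y \<le> c * real N powr (1 + \<epsilon>/4)"
      proof -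
        have "Y \<le> real N * (c * real N powr (\<epsilon>/4))"
          unfolding Y_def d_def using c(2)[OF N] by (simp only: of_nat_mult mult_left_mono of_nat_0_le_iff)
        also have "\<dots> = c * real N powr (1 + \<epsilon>/4)" using N by (simp add: powr_add)
        finally show ?thesis .
      qed
      then have "Y powr (2 - \<epsilon>) \<le> (c * real N powr (1 + \<epsilon>/4)) powr (2 - \<epsilon>)"
        using Y1 \<epsilon> by (intro powr_mono2) auto
      also have "\<dots> = c powr (2 - \<epsilon>) * real N powr ((1 + \<epsilon>/4) * (2 - \<epsilon>))"
        using c(1) by (simp add: powr_mult powr_powr)
      also have "\<dots> \<le> c powr (2 - \<epsilon>) * real N powr (2 - \<epsilon>/2)"
      proof (intro mult_left_mono powr_mono)
        have "(1 + \<epsilon>/4) * (2 - \<epsilon>) = 2 - \<epsilon>/2 - \<epsilon> * \<epsilon> / 4" by (simp add: field_simps)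
        then show "(1 + \<epsilon>/4) * (2 - \<epsilon>) \<le> 2 - \<epsilon>/2" by simp
      qed (use N in auto)
      finally have 3: "Y powr (2 - \<epsilon>) \<le> c powr (2 - \<epsilon>) * real N powr (2 - \<epsilon>/2)" .
      have "real k \<le> (20 * 604 powr (3/2) + 3 * K) * (c powr (2 - \<epsilon>) * real N powr (2 - \<epsilon>/2))"
        using 2 mult_left_mono[OF 3, of "20 * 604 powr (3/2) + 3 * K"] K by simp
      then have "real k \<le> C0 * real N powr (2 - \<epsilon>/2)" by (simp add: C0_def mult.assoc)
      with run'(1) run'(2)[unfolded orth] show ?thesis by blast
    qed
    then show ?thesis
      unfolding solves_in_O_def solves_within_def
      by (intro exI[of _ C0]) (auto simp: ov_problem_def)
  qed
  moreover have "\<epsilon>/2 > 0" using \<epsilon> by simp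
  ultimately show ?thesis unfolding OVC_def by blast
qed

text \<open>The rate \<open>1/12\<close> is chosen so that the reduction, with exponent
  \<open>(1/2 + 1/12) * (3/2) = 7/8\<close> in \<open>n\<close>, stays below
  \<open>1 - \<epsilon>/4\<close>, which is at least \<open>15/16\<close>.\<close>

lemma Suc_le_exp: "real n + 1 \<le> (1 + 12 / ln 2) * 2 powr (real n / 12)"
proof -
  have "real n / 12 * ln 2 \<le> exp (real n / 12 * ln 2)"
    using exp_ge_add_one_self[of "real n / 12 * ln 2"] by linarith
  then have "real n \<le> 12 / ln 2 * 2 powr (real n / 12)" by (simp add: powr_def field_simps)
  moreover have "1 \<le> 2 powr (real n / 12)" by (intro ge_one_powr_ge_zero) auto
  ultimately show ?thesis by (simp add: algebra_simps)
qed

text \<open>With at most \<open>2 ^ lo\<close> vectors on a side, the solver takes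
  \<open>O(2 powr ((1 - \<epsilon>/2) * n))\<close> times a power of the number of clauses. A single
  program serves all clause widths \<open>w\<close>, and only the constant depends on
  \<open>w\<close>.\<close>

lemma ov_solver_not_SETH:
  assumes solver: "ov_solver p z r \<epsilon> K" and K: "0 \<le> K" and \<epsilon>: "0 < \<epsilon>" "\<epsilon> \<le> 1/4"
  shows "\<not> SETH"
proof -
  let ?p = "total_prog sat_prog 2 z r p"
  have "solves_in_O ?p (ksat_problem w) (\<lambda>(n, F) xs. 2 powr ((1 - \<epsilon>/4) * real n) * (real (length F) + 1) ^ 2)" for w
  proof -
    define A :: real where "A = 1 + 12 / ln 2"
    have A: "0 \<le> A" by (simp add: A_def)
    define C1 where "C1 = (1000 * real (w + 1) * A * 2 powr (1/2)) powr (3/2)"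
    define C0 where "C0 = 20 * C1 + 3 * K * 2"
    have "\<exists>k s. exec ?p (initial_state xs) k s \<and> decides (satisfiable F) (result_of s) \<and>
        real k \<le> C0 * (2 powr ((1 - \<epsilon>/4) * real n) * (real (length F) + 1) ^ 2)"
      if inst: "\<forall>cl\<in>set F. length cl \<le> w \<and> (\<forall>(v, b)\<in>set cl. v < n)"
        and xs: "xs = [n, length F] @ concat (map clause_code F)" for n F xs
    proof -
      interpret sat_instance n F w
        by standard (use inst in auto)
      define m where "m = length F"
      have ys: "xs = ys" by (simp add: xs ys_def)
      have B: "x \<le> n + m + w + 1" if "x \<in> set xs" for x
      proof -
        have "x \<le> n + w + 1" if "cl \<in> set F" "x \<in> set (clause_code cl)" for cl
          using that inst by (fastforce simp: clause_code_def split: prod.splits)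
        then show ?thesis using that by (fastforce simp: xs m_def)
      qed
      have N: "2 ^ hi \<le> (2::nat) ^ lo" using lo_hi by (intro power_increasing) auto
      from total_prog_correct[OF solver K sat_prog_tame _ _ B order_refl N, where A = 2, unfolded ys, OF _ hoare_sat]
      obtain k s where run: "exec ?p (initial_state xs) k s"
        "decides (\<exists>i<2 ^ lo. \<exists>l<2 ^ hi. \<forall>j<length F. \<not> (ub i j \<and> vb l j)) (result_of s)"
        "real k \<le> 20 * real (n + m + w + 1 + 300 * (2 ^ lo * (n + 1) * (length F + 1) * (w + 1)) +
          601 * (2 ^ lo * (length F + 1))) powr (3/2) + 3 * (K * real (2 ^ lo * length F) powr (2 - \<epsilon>))"
        using ys by auto
      define E where "E = 2 powr ((1 - \<epsilon>/4) * real n)"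
      \<comment> \<open>Rounding \<open>n/2\<close> up costs a factor
        \<open>2 powr (1/2)\<close>.\<close>
      have "real lo \<le> real n / 2 + 1 / 2" by (simp add: lo_def)
      then have "2 powr real lo \<le> 2 powr (real n / 2 + 1 / 2)" by (intro powr_mono) auto
      then have lo2: "(2::real) ^ lo \<le> 2 powr (real n / 2) * 2 powr (1/2)"
        by (simp add: powr_realpow powr_add)
      define X where "X = n + m + w + 1 + 300 * (2 ^ lo * (n + 1) * (m + 1) * (w + 1)) + 601 * (2 ^ lo * (m + 1))"
      define Q where "Q = 2 ^ lo * (n + 1) * (m + 1) * (w + 1)"
      have "X \<le> 1000 * Q"
      proof -
        have "1 * (n + 1) * 1 * 1 \<le> Q" "1 * 1 * (m + 1) * 1 \<le> Q" "1 * 1 * 1 * (w + 1) \<le> Q"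
          "2 ^ lo * 1 * (m + 1) * 1 \<le> Q"
          unfolding Q_def by (intro mult_le_mono; simp)+
        then show ?thesis unfolding X_def Q_def[symmetric] by simp
      qed
      then have "real X \<le> real (1000 * Q)" by (rule of_nat_mono)
      also have "\<dots> = 1000 * (2 ^ lo * (real n + 1) * (real m + 1) * real (w + 1))"
        by (simp add: Q_def algebra_simps)
      also have "\<dots> \<le> 1000 * ((2 powr (real n / 2) * 2 powr (1/2)) * (A * 2 powr (real n / 12)) * (real m + 1) * real (w + 1))"
        using lo2 Suc_le_exp[of n] A by (intro mult_left_mono mult_right_mono mult_mono) (auto simp: A_def)
      also have "\<dots> = (1000 * real (w + 1) * A * 2 powr (1/2)) * (2 powr (real n / 2 + real n / 12) * (real m + 1))"
        unfolding powr_add by (simp only: mult_ac)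
      finally have "real X powr (3/2)
          \<le> ((1000 * real (w + 1) * A * 2 powr (1/2)) * (2 powr (real n / 2 + real n / 12) * (real m + 1))) powr (3/2)"
        by (intro powr_mono2) auto
      also have "\<dots> = C1 * (2 powr ((real n / 2 + real n / 12) * (3/2)) * (real m + 1) powr (3/2))"
        using A by (simp add: powr_mult powr_powr C1_def)
      also have "\<dots> \<le> C1 * (E * (real m + 1) ^ 2)"
      proof (intro mult_left_mono mult_mono)
        have "(1 - \<epsilon>/4) * real n \<ge> (1 - 1/16) * real n" using \<epsilon> by (intro mult_right_mono) auto
        then show "2 powr ((real n / 2 + real n / 12) * (3/2)) \<le> E" unfolding E_def by (intro powr_mono) auto
        have "(real m + 1) powr (3/2) \<le> (real m + 1) powr 2" by (intro powr_mono) auto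
        then show "(real m + 1) powr (3/2) \<le> (real m + 1) ^ 2" by simp
      qed (auto simp: C1_def E_def)
      finally have 1: "real X powr (3/2)
          \<le> C1 * (E * (real m + 1) ^ 2)" .
      have "real (2 ^ lo * m) powr (2 - \<epsilon>) \<le> ((2 powr (real n / 2) * 2 powr (1/2)) * (real m + 1)) powr (2 - \<epsilon>)"
        using lo2 \<epsilon> by (intro powr_mono2) (auto intro!: mult_mono)
      also have "\<dots> = 2 powr (real n / 2 * (2 - \<epsilon>)) * 2 powr (1/2 * (2 - \<epsilon>)) * (real m + 1) powr (2 - \<epsilon>)"
        by (simp add: powr_mult powr_powr)
      also have "\<dots> \<le> E * 2 * (real m + 1) ^ 2"
      proof (intro mult_mono)
        have "(1 - \<epsilon>/4) * real n - real n / 2 * (2 - \<epsilon>) = \<epsilon> * real n / 4" by (simp add: field_simps)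
        moreover have "0 \<le> \<epsilon> * real n / 4" using \<epsilon> by simp
        ultimately have "real n / 2 * (2 - \<epsilon>) \<le> (1 - \<epsilon>/4) * real n" by linarith
        then show "2 powr (real n / 2 * (2 - \<epsilon>)) \<le> E" unfolding E_def by (intro powr_mono) auto
        have "2 powr (1/2 * (2 - \<epsilon>)) \<le> 2 powr (1::real)" using \<epsilon> by (intro powr_mono) auto
        then show "2 powr (1/2 * (2 - \<epsilon>)) \<le> (2::real)" by simp
        have "(real m + 1) powr (2 - \<epsilon>) \<le> (real m + 1) powr 2" using \<epsilon> by (intro powr_mono) auto
        then show "(real m + 1) powr (2 - \<epsilon>) \<le> (real m + 1) ^ 2" by simp
      qed (auto simp: E_def)
      finally have "K * real (2 ^ lo * m) powr (2 - \<epsilon>) \<le> K * (E * 2 * (real m + 1) ^ 2)"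
        using K by (rule mult_left_mono)
      with 1 run(3)[folded m_def, folded X_def] have "real k \<le> 20 * (C1 * (E * (real m + 1) ^ 2)) + 3 * (K * (E * 2 * (real m + 1) ^ 2))"
        by linarith
      also have "\<dots> = C0 * (E * (real m + 1) ^ 2)" by (simp add: C0_def algebra_simps)
      finally have "real k \<le> C0 * (2 powr ((1 - \<epsilon>/4) * real n) * (real (length F) + 1) ^ 2)"
        unfolding m_def E_def .
      with run(1) run(2)[folded satisfiable_iff] show ?thesis by blast
    qed
    then show ?thesis
      unfolding solves_in_O_def solves_within_def
      by (intro exI[of _ C0]) (auto simp: ksat_problem_def)
  qed
  moreover have "\<epsilon>/4 > 0" using \<epsilon> by simp
  ultimately show ?thesis unfolding SETH_def by blast
qed

lemma no_fast_algorithm_if_encodes_ov: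
  assumes "OVC \<or> SETH" "\<epsilon> > 0" "encodes_ov Pb z r"
  shows "no_fast_algorithm \<epsilon> Pb"
proof (rule ccontr)
  assume "\<not> no_fast_algorithm \<epsilon> Pb"
  from ov_solver_of_fast[OF assms(3,2) this] obtain p K \<delta> where
    "0 \<le> K" "0 < \<delta>" "\<delta> \<le> 1/4" "ov_solver p z r \<delta> K" by blast
  with assms(1) ov_solver_not_OVC ov_solver_not_SETH show False by blast
qed

theorem theorem8:
  fixes \<epsilon> :: real
  assumes "OVC \<or> SETH" and "\<epsilon> > 0"
  shows "no_fast_algorithm \<epsilon> buechi_query_problem \<and>
    no_fast_algorithm \<epsilon> cobuechi_objective_problem \<and>
    no_fast_algorithm \<epsilon> cobuechi_query_problem \<and>
    no_fast_algorithm \<epsilon> singleton_cobuechi_objective_problem \<and>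
    no_fast_algorithm \<epsilon> singleton_cobuechi_query_problem \<and>
    no_fast_algorithm \<epsilon> rabin_problem"
  by (intro conjI encodes_ov_problems[THEN no_fast_algorithm_if_encodes_ov[OF assms]])

end
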